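(* Let $\pi_n\in S_n$, $n\ge 1$, be a sequence of random permutations such that the permutation process satisfies $\pi_n(\cdot)\Rightarrow Z(\cdot)$ for some stochastic process $Z(\cdot)$ on $(0,1]$. Then there exists a (possibly random) measure $\mu\in\mathcal{M}$, defined jointly with (a version of) $Z(\cdot)$ on a common probability space, such that the permuton $\nu_{\pi_n}$ associated with $\pi_n$ converges weakly in distribution to $\mu$, and the degree process satisfies $d_n(\cdot)\Rightarrow D(\cdot)$, where $$D(t)=t+Z(t)-2F_\mu(t,Z(t)),\qquad t\in(0,1],$$ and $F_\mu$ is the bivariate distribution function of $\mu$, i.e. $F_\mu(x,y)=\mu([0,x]\times[0,y])$.
   Context: $S_n$ is the set of permutations of $[n]=\{1,\dots,n\}$. The permutation graph $G_{\pi_n}$ of $\pi_n\in S_n$ has vertex set $[n]$ and an edge between $i$ and $j$ iff $(i-j)(\pi_n(i)-\pi_n(j))<0$; $d_n(i)$ is the degree of vertex $i$ in $G_{\pi_n}$. The permutation process is $\pi_n(t):=\pi_n(\lceil nt\rceil)/n$ and the degree process is $d_n(t):=d_n(\lceil nt\rceil)/n$, for $t\in(0,1]$. For processes on $(0,1]$ with values in $[0,1]$, $Z_n(\cdot)\Rightarrow Z(\cdot)$ means convergence in distribution of all finite dimensional distributions. $\mathcal{M}$ is the set of Borel probability measures on $[0,1]^2$ with both marginals uniform on $[0,1]$. A sequence of random measures $\mu_n\in\mathcal{M}$ converges weakly in distribution to a random measure $\mu\in\mathcal{M}$ if $\int f\,d\mu_n\to\int f\,d\mu$ in distribution for every continuous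 $f:[0,1]^2\to\mathbb{R}$. The permuton $\nu_{\pi_n}\in\mathcal{M}$ associated with $\pi_n$ has Lebesgue density equal to $n$ on each square $\left(\frac{i-1}{n},\frac{i}{n}\right]\times\left(\frac{\pi_n(i)-1}{n},\frac{\pi_n(i)}{n}\right]$, $i\in[n]$, and $0$ elsewhere. *)

theory Defs
  imports "HOL-Probability.Probability" "HOL-Combinatorics.Permutations"
begin

section \<open>Permutation graphs and the rescaled processes\<close>

definition perm_graph_edges :: "nat \<Rightarrow> (nat \<Rightarrow> nat) \<Rightarrow> nat set set" where
  "perm_graph_edges n p =
     {{i, j} | i j. i \<in> {1..n} \<and> j \<in> {1..n} \<and> (int i - int j) * (int (p i) - int (p j)) < 0}"

definition perm_graph_degree :: "nat \<Rightarrow> (nat \<Rightarrow> nat) \<Rightarrow> nat \<Rightarrow> nat" where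
  "perm_graph_degree n p i = card {e \<in> perm_graph_edges n p. i \<in> e}"

definition perm_process :: "nat \<Rightarrow> (nat \<Rightarrow> nat) \<Rightarrow> real \<Rightarrow> real" where
  "perm_process n p t = real (p (nat \<lceil>real n * t\<rceil>)) / real n"

definition degree_process :: "nat \<Rightarrow> (nat \<Rightarrow> nat) \<Rightarrow> real \<Rightarrow> real" where
  "degree_process n p t = real (perm_graph_degree n p (nat \<lceil>real n * t\<rceil>)) / real n"

text \<open>The spaces \<open>M n\<close> on which the random permutations live may differ with \<open>n\<close>.\<close>

definition random_permutations ::
  "(nat \<Rightarrow> 'a measure) \<Rightarrow> (nat \<Rightarrow> 'a \<Rightarrow> nat \<Rightarrow> nat) \<Rightarrow> bool" where
  "random_permutations M \<pi> \<longleftrightarrow>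
     (\<forall>n\<ge>1. prob_space (M n) \<and> \<pi> n \<in> M n \<rightarrow>\<^sub>M count_space {p. p permutes {1..n}})"


section \<open>Processes on (0,1] with values in [0,1]\<close>

definition unit_process :: "'a measure \<Rightarrow> (real \<Rightarrow> 'a \<Rightarrow> real) \<Rightarrow> bool" where
  "unit_process N Z \<longleftrightarrow> prob_space N \<and>
     (\<forall>t\<in>{0<..1}. Z t \<in> borel_measurable N \<and> (\<forall>\<omega>\<in>space N. Z t \<omega> \<in> {0..1}))"

text \<open>The random vector of the values of \<open>Z\<close> at the times in \<open>J\<close>, an element of \<open>J \<rightarrow>\<^sub>E UNIV\<close>.\<close>

definition fdd_vector :: "(real \<Rightarrow> 'a \<Rightarrow> real) \<Rightarrow> real set \<Rightarrow> 'a \<Rightarrow> real \<Rightarrow> real" where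
  "fdd_vector Z J \<omega> = (\<lambda>t\<in>J. Z t \<omega>)"

text \<open>Convergence in distribution of all finite dimensional distributions; the topology on the
  vectors indexed by a finite set \<open>J\<close> of times is the Euclidean topology of \<open>\<real>\<^sup>J\<close>.\<close>

definition fdd_converges ::
  "(nat \<Rightarrow> 'a measure) \<Rightarrow> (nat \<Rightarrow> real \<Rightarrow> 'a \<Rightarrow> real) \<Rightarrow> 'b measure \<Rightarrow> (real \<Rightarrow> 'b \<Rightarrow> real) \<Rightarrow> bool"
where
  "fdd_converges M X N Z \<longleftrightarrow>
     (\<forall>J f. finite J \<and> J \<subseteq> {0<..1} \<and>
        continuous_map (product_topology (\<lambda>_. euclideanreal) J) euclideanreal f \<and>
        bounded (f ` (J \<rightarrow>\<^sub>E UNIV)) \<longrightarrow>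
        (\<lambda>n. \<integral>\<omega>. f (fdd_vector (X n) J \<omega>) \<partial>M n) \<longlonglongrightarrow> (\<integral>\<omega>. f (fdd_vector Z J \<omega>) \<partial>N))"

definition same_fdds ::
  "'a measure \<Rightarrow> (real \<Rightarrow> 'a \<Rightarrow> real) \<Rightarrow> 'b measure \<Rightarrow> (real \<Rightarrow> 'b \<Rightarrow> real) \<Rightarrow> bool" where
  "same_fdds N Z N' Z' \<longleftrightarrow>
     (\<forall>J. finite J \<and> J \<subseteq> {0<..1} \<longrightarrow>
        distr N (PiM J (\<lambda>_. borel)) (fdd_vector Z J) =
        distr N' (PiM J (\<lambda>_. borel)) (fdd_vector Z' J))"


section \<open>Permutons\<close>

abbreviation unit_square :: "(real \<times> real) set" where
  "unit_square \<equiv> {0..1} \<times> {0..1}"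

abbreviation borel_square :: "(real \<times> real) measure" where
  "borel_square \<equiv> restrict_space borel unit_square"

definition permutons :: "(real \<times> real) measure set" where
  "permutons = {\<mu> \<in> space (prob_algebra borel_square).
     distr \<mu> borel fst = uniform_measure lborel {0..1} \<and>
     distr \<mu> borel snd = uniform_measure lborel {0..1}}"

text \<open>The \<open>\<sigma>\<close>-algebra of the Giry monad, generated by the evaluations \<open>\<mu> \<mapsto> \<mu> A\<close>, is the Borel
  \<open>\<sigma>\<close>-algebra of the weak topology on the probability measures on the unit square.\<close>

definition random_permuton :: "'a measure \<Rightarrow> ('a \<Rightarrow> (real \<times> real) measure) \<Rightarrow> bool" where
  "random_permuton N \<mu> \<longleftrightarrow> prob_space N \<and>
     \<mu> \<in> N \<rightarrow>\<^sub>M prob_algebra borel_square \<and> (\<forall>\<omega>\<in>space N. \<mu> \<omega> \<in> permutons)"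

definition permuton_of_perm :: "nat \<Rightarrow> (nat \<Rightarrow> nat) \<Rightarrow> (real \<times> real) measure" where
  "permuton_of_perm n p = density (restrict_space lborel unit_square)
     (\<lambda>z. if \<exists>i\<in>{1..n}. z \<in> {(real i - 1) / real n <.. real i / real n} \<times>
                            {(real (p i) - 1) / real n <.. real (p i) / real n}
          then ennreal (real n) else 0)"

definition random_permutons_converge ::
  "(nat \<Rightarrow> 'a measure) \<Rightarrow> (nat \<Rightarrow> 'a \<Rightarrow> (real \<times> real) measure) \<Rightarrow>
   'b measure \<Rightarrow> ('b \<Rightarrow> (real \<times> real) measure) \<Rightarrow> bool" where
  "random_permutons_converge M \<mu>s N \<mu> \<longleftrightarrow>
     (\<forall>f :: real \<times> real \<Rightarrow> real. continuous_on unit_square f \<longrightarrow>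
        weak_conv_m (\<lambda>n. distr (M n) borel (\<lambda>\<omega>. \<integral>z. f z \<partial>\<mu>s n \<omega>))
                    (distr N borel (\<lambda>\<omega>. \<integral>z. f z \<partial>\<mu> \<omega>)))"

definition bivariate_cdf :: "(real \<times> real) measure \<Rightarrow> real \<Rightarrow> real \<Rightarrow> real" where
  "bivariate_cdf \<mu> x y = measure \<mu> ({0..x} \<times> {0..y})"

end

theory Submission
  imports Defs
begin

text \<open>Write \<open>Y\<close> for the permutation process of \<open>\<pi> n\<close> and \<open>A f\<close> for the average of \<open>f\<close> over the rescaled graph
of \<open>\<pi> n\<close>, the points \<open>(i/n, \<pi> n i/n)\<close>. Two elementary facts reduce the theorem to statements about such
averages. First, the integral of a continuous \<open>f\<close> against the permuton of \<open>\<pi> n\<close> differs from \<open>A f\<close> by at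
most the oscillation of \<open>f\<close> over cells of side \<open>1/n\<close> (\<open>permuton_of_perm_close\<close>). Second, counting the
vertices to the lower left of a vertex shows that its rescaled degree at time \<open>t\<close> is
\<open>t + Y t - 2 A (1 on [0,t] \<times> [0,Y t])\<close> up to \<open>O(1/n)\<close> (\<open>degree_process_eq\<close>), and the indicator may be
replaced by a continuous ramp because a strip of width \<open>e\<close> carries mass at most \<open>e + 1/n\<close>.

The key point is that finitely many values of \<open>Y\<close> at \<^emph>\<open>fixed\<close> times already determine \<open>A f\<close> approximately.
If the times were independent and uniform, the mean of \<open>f(t, Y t)\<close> over \<open>m\<close> of them would miss \<open>A f\<close> by
\<open>O(1/sqrt m)\<close> in mean square. This mean square error is an expression in the covariance kernel
\<open>K(s,t) = E[f(s, Y s) f(t, Y t)]\<close> only, and the kernel converges as \<open>n\<close> grows because the two-dimensional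
distributions do. A greedy choice of the times for the limit kernel (\<open>sampling_defect_small\<close>) therefore
gives one fixed list of times that works for all large \<open>n\<close>, simultaneously for finitely many monomials
(\<open>good_sample_exists\<close>). Taking better and better lists, one at each stage \<open>k\<close>, with error \<open>2^-k\<close>, yields
sampled averages which converge almost surely when \<open>Y\<close> is replaced by the limit process \<open>Z\<close>. By weak
compactness on the square the limits of these averages are the integrals against a random measure \<open>\<mu>\<close>,
which has uniform marginals because the graph of a permutation does (\<open>limit_permuton_exists\<close>). So \<open>\<mu>\<close> is
built as a function on the probability space of \<open>Z\<close> itself, and this is what makes the two jointly defined.

The same sampled averages transfer convergence: they are continuous functions of finitely many values
of \<open>Y\<close>, so they converge in distribution together with these values, while they approximate \<open>A f\<close> for
large \<open>n\<close> and the integral of \<open>f\<close> against \<open>\<mu>\<close> in the limit. This gives joint convergence of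
\<open>A (g (_, Y t))\<close> for finitely many \<open>t\<close>, even with test functions \<open>g\<close> that depend on the random value
\<open>Y t\<close> (\<open>joint_convergence\<close>). A test function that ignores \<open>Y t\<close> gives the convergence of permutons, and the
ramps give the convergence of degrees. Finally the pair \<open>(Z, \<mu>)\<close> is pushed forward to the space of paths
and measures.\<close>


section \<open>Weak compactness of empirical measures on the unit square\<close>

text \<open>Schoenberg's space-filling curve in its ternary form: the step function reads off whether the ternary
expansion of its argument, modulo 2, starts with 0 or 2, and the two coordinates collect the even and odd
digits. The clipped cosine has period 2, equals 0 on \<open>[0, 1/3]\<close> and equals 1 on \<open>[2/3, 1]\<close>.\<close>

definition schoenberg_step :: "real \<Rightarrow> real" where
  "schoenberg_step t = max 0 (min 1 (1 / 2 - cos (pi * t)))"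

definition schoenberg_coord :: "nat \<Rightarrow> real \<Rightarrow> real" where
  "schoenberg_coord k t = (\<Sum>n. schoenberg_step (3 ^ (2 * n + k) * t) * (1 / 2) ^ Suc n)"

definition schoenberg_curve :: "real \<Rightarrow> real \<times> real" where
  "schoenberg_curve t = (schoenberg_coord 0 t, schoenberg_coord 1 t)"

lemma schoenberg_step_bounds: "0 \<le> schoenberg_step t" "schoenberg_step t \<le> 1"
  by (auto simp: schoenberg_step_def)

lemma schoenberg_coord_summable:
  "summable (\<lambda>n. schoenberg_step (f n) * (1 / 2) ^ Suc n)"
proof (rule summable_comparison_test'[where N = 0])
  show "summable (\<lambda>n. (1 / 2 :: real) ^ Suc n)"
    using power_half_series by (rule sums_summable)
  show "\<And>n. 0 \<le> n \<Longrightarrow> norm (schoenberg_step (f n) * (1 / 2) ^ Suc n) \<le> (1 / 2) ^ Suc n"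
    using schoenberg_step_bounds by (simp add: abs_mult)
qed

lemma schoenberg_coord_bounds: "schoenberg_coord k t \<in> {0..1}"
proof -
  have "schoenberg_coord k t \<le> (\<Sum>n. (1 / 2 :: real) ^ Suc n)"
    unfolding schoenberg_coord_def
    using schoenberg_step_bounds
    by (intro suminf_le schoenberg_coord_summable sums_summable[OF power_half_series])
       (simp add: mult_left_le_one_le)
  moreover have "(\<Sum>n. (1 / 2 :: real) ^ Suc n) = 1"
    using power_half_series by (rule sums_unique[symmetric])
  moreover have "0 \<le> schoenberg_coord k t"
    unfolding schoenberg_coord_def
    using schoenberg_step_bounds by (intro suminf_nonneg schoenberg_coord_summable) simp
  ultimately show ?thesis by simp
qed

lemma continuous_on_schoenberg_coord: "continuous_on UNIV (schoenberg_coord k)"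
proof -
  have "uniform_limit UNIV (\<lambda>N t. \<Sum>n<N. schoenberg_step (3 ^ (2 * n + k) * t) * (1 / 2) ^ Suc n)
     (schoenberg_coord k) sequentially"
    unfolding schoenberg_coord_def[abs_def]
  proof (rule Weierstrass_m_test)
    show "summable (\<lambda>n. (1 / 2 :: real) ^ Suc n)"
      using power_half_series by (rule sums_summable)
    show "\<And>n x. x \<in> UNIV \<Longrightarrow> norm (schoenberg_step (3 ^ (2 * n + k) * x) * (1 / 2) ^ Suc n) \<le> (1 / 2) ^ Suc n"
      using schoenberg_step_bounds by (simp add: abs_mult)
  qed
  then show ?thesis
    unfolding schoenberg_step_def
    by (rule uniform_limit_theorem[rotated])
       (auto intro!: always_eventually continuous_intros)
qed

text \<open>The greedy expansion: the remainders \<open>r\<close> stay in \<open>[0, 1]\<close>, and the endpoint 1 expands into ones only.\<close>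

lemma binary_expansion_ex:
  assumes "x \<in> {0..1::real}"
  shows "\<exists>b :: nat \<Rightarrow> nat. (\<forall>n. b n \<in> {0, 1}) \<and> (\<lambda>n. real (b n) * (1 / 2) ^ Suc n) sums x"
proof -
  define r where "r = rec_nat x (\<lambda>_ y. if y \<ge> 1 / 2 then 2 * y - 1 else 2 * y)"
  define b where "b n = (if r n \<ge> 1 / 2 then 1 else 0 :: nat)" for n
  have r_Suc: "r (Suc n) = 2 * r n - real (b n)" for n
    by (simp add: r_def b_def)
  have r0: "r 0 = x" by (simp add: r_def)
  have r: "r n \<in> {0..1}" for n
    by (induction n) (use assms r0 r_Suc in \<open>auto simp: b_def\<close>)
  have sum: "x - (\<Sum>k<n. real (b k) * (1 / 2) ^ Suc k) = r n * (1 / 2) ^ n" for n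
    by (induction n) (auto simp: r0 r_Suc algebra_simps)
  have "(\<lambda>n. r n * (1 / 2) ^ n) \<longlonglongrightarrow> 0"
  proof (rule Lim_null_comparison)
    show "\<forall>\<^sub>F n in sequentially. norm (r n * (1 / 2) ^ n) \<le> (1 / 2) ^ n"
      using r by (simp add: abs_mult)
    show "(\<lambda>n. (1 / 2 :: real) ^ n) \<longlonglongrightarrow> 0" by (intro LIMSEQ_realpow_zero) auto
  qed
  then have "(\<lambda>n. x - (x - (\<Sum>k<n. real (b k) * (1 / 2) ^ Suc k))) \<longlonglongrightarrow> x - 0"
    unfolding sum by (intro tendsto_diff tendsto_const)
  then have "(\<lambda>n. real (b n) * (1 / 2) ^ Suc n) sums x"
    by (simp add: sums_def)
  then show ?thesis by (intro exI[of _ b]) (auto simp: b_def)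
qed

text \<open>Take \<open>t\<close> with ternary digits \<open>2 * a n\<close>. Multiplying by \<open>3 ^ n\<close> shifts the digits, and the digits that
leave contribute an even integer, which the period 2 of the step function does not see. The remaining
tail lies in \<open>[0, 1/3]\<close> or \<open>[2/3, 1]\<close> according to the digit \<open>a n\<close>.\<close>

lemma schoenberg_step_ternary:
  fixes a :: "nat \<Rightarrow> nat"
  assumes "\<And>n. a n \<in> {0, 1}"
  shows "\<exists>t\<in>{0..1}. \<forall>n. schoenberg_step (3 ^ n * t) = real (a n)"
proof -
  define R where "R n = (\<Sum>k. 2 * real (a (n + k)) * (1 / 3) ^ Suc k)" for n
  have geo: "(\<lambda>k. 2 * (1 / 3 :: real) ^ Suc k) sums 1"
    using sums_mult[OF geometric_sums[of "1 / 3 :: real"], of "2 / 3"] by simp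
  have le: "2 * real (a n) * (1 / 3) ^ Suc k \<le> 2 * (1 / 3) ^ Suc k" for n k
    using assms[of n] by auto
  have summ: "summable (\<lambda>k. 2 * real (a (n + k)) * (1 / 3) ^ Suc k)" for n
    using le by (intro summable_comparison_test'[OF sums_summable[OF geo], of 0]) auto
  have R_bounds: "0 \<le> R n" "R n \<le> 1" for n
    unfolding R_def using suminf_le[OF le summ sums_summable[OF geo]] sums_unique[OF geo]
    by (auto intro!: suminf_nonneg simp del: power_Suc intro: summ)
  have R_Suc: "3 * R n = 2 * real (a n) + R (Suc n)" for n
  proof -
    have "R n = (\<Sum>k. 2 * real (a (n + Suc k)) * (1 / 3) ^ Suc (Suc k)) + 2 * real (a n) / 3"
      unfolding R_def using suminf_split_head[OF summ[of n]] by simp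
    also have "(\<Sum>k. 2 * real (a (n + Suc k)) * (1 / 3) ^ Suc (Suc k)) = R (Suc n) / 3"
      unfolding R_def using suminf_divide[OF summ[of "Suc n"], of 3] by simp
    finally show ?thesis by simp
  qed
  have shift: "\<exists>z :: int. 3 ^ n * R 0 = 2 * of_int z + R n" for n
  proof (induction n)
    case (Suc n)
    then obtain z :: int where "3 ^ n * R 0 = 2 * of_int z + R n" by auto
    then have "3 ^ Suc n * R 0 = 2 * of_int (3 * z + int (a n)) + R (Suc n)"
      using R_Suc[of n] by simp
    then show ?case by blast
  qed (auto intro: exI[of _ 0])
  have "schoenberg_step (3 ^ n * R 0) = real (a n)" for n
  proof -
    obtain z :: int where z: "3 ^ n * R 0 = 2 * of_int z + R n" using shift by auto
    have cos_eq: "cos (pi * (3 ^ n * R 0)) = cos (pi * R n)"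
    proof -
      have "pi * (3 ^ n * R 0) = pi * R n + of_int z * (2 * pi)"
        unfolding z by (simp add: algebra_simps)
      then show ?thesis
        using cos_eq_periodic_intro by (metis cos_int_2pin cos_add sin_int_2pin mult.commute mult.right_neutral mult_zero_right diff_zero)
    qed
    consider "a n = 0" | "a n = 1" using assms[of n] by auto
    then show ?thesis
    proof cases
      case 1
      then have "R n \<le> 1 / 3" using R_Suc[of n] R_bounds[of "Suc n"] by simp
      then have "cos (pi / 3) \<le> cos (pi * R n)"
        using R_bounds[of n] by (intro cos_monotone_0_pi_le) auto
      then show ?thesis unfolding schoenberg_step_def cos_eq using 1 by (simp add: cos_60)
    next
      case 2
      then have "2 / 3 \<le> R n" using R_Suc[of n] R_bounds[of "Suc n"] by simp
      then have "cos (pi * R n) \<le> cos (pi * 2 / 3)"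
        using R_bounds[of n] by (intro cos_monotone_0_pi_le) auto
      moreover have "cos (pi * 2 / 3) = - 1 / 2"
        using cos_double_cos[of "pi / 3"] by (simp add: cos_60 power2_eq_square mult.commute)
      ultimately show ?thesis unfolding schoenberg_step_def cos_eq using 2 by simp
    qed
  qed
  then show ?thesis using R_bounds[of 0] by (intro bexI[of _ "R 0"] allI) auto
qed

lemma schoenberg_curve_surj:
  assumes "z \<in> unit_square"
  shows "\<exists>t\<in>{0..1}. schoenberg_curve t = z"
proof -
  obtain b where b: "\<And>n. b n \<in> {0, 1 :: nat}" "(\<lambda>n. real (b n) * (1 / 2) ^ Suc n) sums fst z"
    using binary_expansion_ex[of "fst z"] assms by (metis mem_Times_iff)
  obtain b' where b': "\<And>n. b' n \<in> {0, 1 :: nat}" "(\<lambda>n. real (b' n) * (1 / 2) ^ Suc n) sums snd z"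
    using binary_expansion_ex[of "snd z"] assms by (metis mem_Times_iff)
  have "(if even n then b (n div 2) else b' (n div 2)) \<in> {0, 1}" for n
    using b(1) b'(1) by simp
  then obtain t where t: "t \<in> {0..1}" "\<forall>n. schoenberg_step (3 ^ n * t) = real (if even n then b (n div 2) else b' (n div 2))"
    using schoenberg_step_ternary[of "\<lambda>n. if even n then b (n div 2) else b' (n div 2)"] by metis
  from t(2) have "schoenberg_step (3 ^ (2 * n) * t) = real (b n)"
    "schoenberg_step (3 ^ (2 * n + 1) * t) = real (b' n)" for n
    by (auto simp del: power_Suc)
  then have "schoenberg_coord 0 t = fst z" "schoenberg_coord 1 t = snd z"
    unfolding schoenberg_coord_def
    using sums_unique[OF b(2)] sums_unique[OF b'(2)] by simp_all
  then show ?thesis using t(1) by (auto simp: schoenberg_curve_def prod_eq_iff)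
qed

lemma continuous_on_schoenberg_curve: "continuous_on UNIV schoenberg_curve"
  unfolding schoenberg_curve_def[abs_def]
  by (intro continuous_intros continuous_on_schoenberg_coord)

lemma schoenberg_curve_in_square: "schoenberg_curve t \<in> unit_square"
  using schoenberg_coord_bounds by (auto simp: schoenberg_curve_def)

lemma schoenberg_curve_measurable: "schoenberg_curve \<in> borel \<rightarrow>\<^sub>M borel_square"
  using borel_measurable_continuous_onI[OF continuous_on_schoenberg_curve] schoenberg_curve_in_square
  by (intro measurable_restrict_space2) auto

lemma continuous_square_measurable:
  fixes f :: "real \<times> real \<Rightarrow> real"
  assumes "continuous_on unit_square f"
  shows "f \<in> borel_measurable borel_square"
  using assms by (rule borel_measurable_continuous_on_restrict)

lemma continuous_square_bounded:
  fixes f :: "real \<times> real \<Rightarrow> real"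
  assumes "continuous_on unit_square f"
  shows "\<exists>B\<ge>0. \<forall>z\<in>unit_square. \<bar>f z\<bar> \<le> B"
proof -
  have "bounded (f ` unit_square)"
    by (intro compact_imp_bounded compact_continuous_image assms compact_Times) auto
  then obtain B where "B > 0" "\<forall>z\<in>f ` unit_square. norm z \<le> B" by (auto simp: bounded_pos)
  then show ?thesis by (auto intro!: exI[of _ B])
qed

text \<open>Compactness in two dimensions is reduced to Helly's theorem on the line: the points are lifted along the
space-filling curve into \<open>[0, 1]\<close>, where the empirical measures are tight, and a weak limit on the line is
mapped back by the continuous curve.\<close>

lemma empirical_measures_subsequence:
  fixes m :: "nat \<Rightarrow> nat" and p :: "nat \<Rightarrow> nat \<Rightarrow> real \<times> real"
  assumes m: "\<And>k. m k > 0" and p: "\<And>k i. i < m k \<Longrightarrow> p k i \<in> unit_square"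
  obtains r \<mu> where "strict_mono (r :: nat \<Rightarrow> nat)" "\<mu> \<in> space (prob_algebra borel_square)"
    "\<And>f :: real \<times> real \<Rightarrow> real. continuous_on unit_square f \<Longrightarrow>
       (\<lambda>k. (\<Sum>i<m (r k). f (p (r k) i)) / m (r k)) \<longlonglongrightarrow> (\<integral>z. f z \<partial>\<mu>)"
proof -
  have "\<forall>k i. \<exists>w. i < m k \<longrightarrow> w \<in> {0..1} \<and> schoenberg_curve w = p k i"
    using schoenberg_curve_surj p by blast
  then obtain w where w: "\<And>k i. i < m k \<Longrightarrow> w k i \<in> {0..1}"
      "\<And>k i. i < m k \<Longrightarrow> schoenberg_curve (w k i) = p k i"
    by metis
  define Q where "Q k = measure_pmf (pmf_of_set {..<m k})" for k
  define P where "P k = distr (Q k) borel (w k)" for k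
  have fin: "finite {..<m k}" "{..<m k} \<noteq> {}" for k
    using m[of k] by auto
  have P_rd: "real_distribution (P k)" for k
    unfolding P_def Q_def real_distribution_def real_distribution_axioms_def
    by (auto intro!: measure_pmf.prob_space_distr)
  have mass: "measure (P k) {- 1<..1} = 1" for k
  proof -
    have "AE i in Q k. w k i \<in> {- 1<..1}"
      unfolding Q_def AE_measure_pmf_iff using w(1)[of _ k] fin[of k]
      by (auto simp: set_pmf_of_set) (metis le_less_trans less_minus_one_simps(1) less_le_trans neg_less_0_iff_less zero_less_one)+
    then have "measure (Q k) (w k -` {- 1<..1} \<inter> space (Q k)) = 1"
      unfolding Q_def by (intro measure_pmf.prob_eq_1[THEN iffD2]) auto
    then show ?thesis unfolding P_def by (subst measure_distr) (auto simp: Q_def)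
  qed
  have "tight P"
    unfolding tight_def
  proof (intro conjI allI impI P_rd)
    fix \<epsilon> :: real assume "\<epsilon> > 0"
    then show "\<exists>a b. a < b \<and> (\<forall>n. 1 - \<epsilon> < measure (P n) {a<..b})"
      by (intro exI[of _ "- 1"] exI[of _ 1]) (simp add: mass)
  qed
  then obtain r L where r: "strict_mono (r :: nat \<Rightarrow> nat)" and L: "real_distribution L"
    and conv: "weak_conv_m (P \<circ> id \<circ> r) L"
    using tight_imp_convergent_subsubsequence[of P id] by (auto simp: strict_mono_id)
  interpret L: real_distribution L by fact
  define \<mu> where "\<mu> = distr L borel_square schoenberg_curve"
  have meas[measurable]: "schoenberg_curve \<in> L \<rightarrow>\<^sub>M borel_square"
    using schoenberg_curve_measurable by (simp cong: measurable_cong_sets)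
  have "\<mu> \<in> space (prob_algebra borel_square)"
    unfolding space_prob_algebra \<mu>_def using meas by (auto intro: L.prob_space_distr)
  moreover have "(\<lambda>k. (\<Sum>i<m (r k). f (p (r k) i)) / m (r k)) \<longlonglongrightarrow> (\<integral>z. f z \<partial>\<mu>)"
    if f: "continuous_on unit_square f" for f :: "real \<times> real \<Rightarrow> real"
  proof -
    have cont: "continuous_on UNIV (\<lambda>x. f (schoenberg_curve x))"
      by (intro continuous_on_compose2[OF f continuous_on_schoenberg_curve] image_subsetI
          schoenberg_curve_in_square)
    obtain B where B: "\<forall>z\<in>unit_square. \<bar>f z\<bar> \<le> B"
      using continuous_square_bounded[OF f] by blast
    have "(\<lambda>k. \<integral>x. f (schoenberg_curve x) \<partial>(P \<circ> id \<circ> r) k) \<longlonglongrightarrow> (\<integral>x. f (schoenberg_curve x) \<partial>L)"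
      using cont bspec[OF B schoenberg_curve_in_square] P_rd
      by (intro weak_conv_imp_integral_bdd_continuous_conv[OF _ L conv, where B = B])
         (auto simp: continuous_on_eq_continuous_at)
    moreover have "(\<integral>x. f (schoenberg_curve x) \<partial>(P \<circ> id \<circ> r) k) = (\<Sum>i<m (r k). f (p (r k) i)) / m (r k)" for k
    proof -
      have "(\<integral>x. f (schoenberg_curve x) \<partial>(P \<circ> id \<circ> r) k) = (\<integral>i. f (schoenberg_curve (w (r k) i)) \<partial>Q (r k))"
        unfolding comp_def id_def P_def
        using borel_measurable_continuous_onI[OF cont]
        by (subst integral_distr) (auto simp: Q_def)
      also have "\<dots> = (\<Sum>i<m (r k). f (schoenberg_curve (w (r k) i))) / m (r k)"
        unfolding Q_def using fin[of "r k"] by (subst integral_pmf_of_set) auto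
      finally show ?thesis using w(2) by simp
    qed
    moreover have "(\<integral>z. f z \<partial>\<mu>) = (\<integral>x. f (schoenberg_curve x) \<partial>L)"
      unfolding \<mu>_def by (intro integral_distr meas continuous_square_measurable f)
    ultimately show ?thesis by simp
  qed
  ultimately show ?thesis using that r by blast
qed


section \<open>Polynomial approximation and the greedy choice of sample times\<close>

text \<open>A polynomial \<open>\<Sum> c x^a y^b v^d\<close> in a point \<open>(x, y)\<close> and a further variable \<open>v\<close>, given by the list of its
terms \<open>(c, a, b, d)\<close>. The variable \<open>v\<close> is kept apart because the random value of the process enters there,
while \<open>(x, y)\<close> is averaged over.\<close>

definition poly3 :: "(real \<times> nat \<times> nat \<times> nat) list \<Rightarrow> (real \<times> real) \<times> real \<Rightarrow> real" where
  "poly3 xs w = (\<Sum>(c, a, b, d)\<leftarrow>xs. c * (fst (fst w) ^ a * snd (fst w) ^ b) * snd w ^ d)"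

lemma poly3_simps:
  "poly3 [] w = 0"
  "poly3 ((c, a, b, d) # xs) w = c * (fst (fst w) ^ a * snd (fst w) ^ b) * snd w ^ d + poly3 xs w"
  "poly3 (xs @ ys) w = poly3 xs w + poly3 ys w"
  by (simp_all add: poly3_def)

lemma poly3_mult_monomial:
  "poly3 (map (\<lambda>(c', a', b', d'). (c * c', a + a', b + b', d + d')) ys) w =
     c * (fst (fst w) ^ a * snd (fst w) ^ b) * snd w ^ d * poly3 ys w"
  by (induction ys) (auto simp: poly3_simps algebra_simps power_add)

lemma poly3_mult: "\<exists>zs. \<forall>w. poly3 zs w = poly3 xs w * poly3 ys w"
proof (induction xs)
  case Nil
  show ?case by (intro exI[of _ "[]"]) (simp add: poly3_simps)
next
  case (Cons x xs)
  obtain c a b d where x: "x = (c, a, b, d)" by (cases x) auto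
  obtain zs where "\<forall>w. poly3 zs w = poly3 xs w * poly3 ys w" using Cons by blast
  then show ?case
    by (intro exI[of _ "map (\<lambda>(c', a', b', d'). (c * c', a + a', b + b', d + d')) ys @ zs"])
       (simp only: x poly3_simps poly3_mult_monomial distrib_right simp_thms)
qed

lemma real_polynomial_function_poly3:
  assumes "real_polynomial_function (p :: (real \<times> real) \<times> real \<Rightarrow> real)"
  shows "\<exists>xs. \<forall>w. p w = poly3 xs w"
  using assms
proof induction
  case (linear f)
  then interpret bounded_linear f .
  have "f w = f ((1, 0), 0) * fst (fst w) + f ((0, 1), 0) * snd (fst w) + f ((0, 0), 1) * snd w" for w
  proof -
    obtain x y v where w: "w = ((x, y), v)" by (metis prod.collapse)
    have "w = x *\<^sub>R ((1, 0), 0) + y *\<^sub>R ((0, 1), 0) + v *\<^sub>R ((0, 0), 1)"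
      by (simp add: w)
    then have "f w = f (x *\<^sub>R ((1, 0), 0) + y *\<^sub>R ((0, 1), 0) + v *\<^sub>R ((0, 0), 1))" by metis
    then show ?thesis unfolding add scaleR w by simp
  qed
  then obtain r s t where "\<And>w. f w = r * fst (fst w) + s * snd (fst w) + t * snd w" by blast
  then show ?case
    by (intro exI[of _ "[(r, 1, 0, 0), (s, 0, 1, 0), (t, 0, 0, 1)]"]) (simp add: poly3_simps)
next
  case (const c)
  show ?case by (intro exI[of _ "[(c, 0, 0, 0)]"]) (simp add: poly3_simps)
next
  case (add f g)
  then show ?case by (metis poly3_simps(3))
next
  case (mult f g)
  then show ?case by (metis poly3_mult)
qed

lemma poly3_approx:
  assumes "continuous_on (unit_square \<times> {0..1}) g" "0 < e"
  obtains xs where "\<And>w. w \<in> unit_square \<times> {0..1} \<Longrightarrow> \<bar>g w - poly3 xs w\<bar> < e"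
proof -
  have "compact (unit_square \<times> {0..1::real})" by (intro compact_Times) auto
  from Stone_Weierstrass_real_polynomial_function[OF this assms]
  obtain p where "real_polynomial_function p" "\<And>w. w \<in> unit_square \<times> {0..1} \<Longrightarrow> \<bar>g w - p w\<bar> < e"
    by metis
  then show ?thesis using that real_polynomial_function_poly3 by metis
qed


text \<open>The half-open interval matches the range of the times, so that \<open>\<lceil>n s\<rceil>\<close> runs through \<open>1..n\<close>.\<close>

abbreviation unit_lebesgue :: "real measure" where
  "unit_lebesgue \<equiv> restrict_space lborel {0<..1}"

lemma prob_space_unit_lebesgue: "prob_space unit_lebesgue"
  by (intro prob_spaceI) (simp add: emeasure_restrict_space space_restrict_space)

lemma space_unit_lebesgue [simp]: "space unit_lebesgue = {0<..1}"
  by (simp add: space_restrict_space)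

text \<open>If \<open>K s t\<close> is the inner product of vectors \<open>u s\<close> and \<open>u t\<close> in a Hilbert space, this is the squared norm of
\<open>u(\<tau> 0) + ... + u(\<tau> (m - 1)) - m * (integral of u)\<close>.\<close>

definition sampling_defect :: "(real \<Rightarrow> real \<Rightarrow> real) \<Rightarrow> (nat \<Rightarrow> real) \<Rightarrow> nat \<Rightarrow> real" where
  "sampling_defect K \<tau> m =
     (\<Sum>i<m. \<Sum>j<m. K (\<tau> i) (\<tau> j)) - 2 * real m * (\<Sum>i<m. \<integral>s. K (\<tau> i) s \<partial>unit_lebesgue)
     + (real m)\<^sup>2 * (\<integral>t. \<integral>s. K t s \<partial>unit_lebesgue \<partial>unit_lebesgue)"

text \<open>Choose the points one after the other. In the Hilbert space picture, the inner product of the current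
error with the next increment \<open>u t - (integral of u)\<close> has mean zero over \<open>t\<close>, so some \<open>t\<close> makes it
nonpositive; then the squared norm grows by at most \<open>4 C\<close>. Only single integrals over \<open>t\<close> occur, no
product measure on lists of times.\<close>

lemma sampling_defect_small:
  assumes K[measurable]: "(\<lambda>(s, t). K s t) \<in> borel_measurable (unit_lebesgue \<Otimes>\<^sub>M unit_lebesgue)"
    and sym: "\<And>s t. K s t = K t s"
    and bound: "\<And>s t. s \<in> {0<..1} \<Longrightarrow> t \<in> {0<..1} \<Longrightarrow> \<bar>K s t\<bar> \<le> C"
  shows "\<exists>\<tau>. (\<forall>i. \<tau> i \<in> {0<..1}) \<and> sampling_defect K \<tau> m \<le> 4 * C * real m"
proof (induction m)
  case 0
  show ?case by (intro exI[of _ "\<lambda>_. 1"]) (simp add: sampling_defect_def)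
next
  case (Suc m)
  interpret U: prob_space unit_lebesgue by (rule prob_space_unit_lebesgue)
  obtain \<tau> where \<tau>: "\<And>i. \<tau> i \<in> {0<..1}" and IH: "sampling_defect K \<tau> m \<le> 4 * C * real m"
    using Suc by auto
  define \<kappa> where "\<kappa> t = (\<integral>s. K t s \<partial>unit_lebesgue)" for t
  define I where "I = (\<integral>t. \<kappa> t \<partial>unit_lebesgue)"
  have [measurable]: "K t \<in> borel_measurable unit_lebesgue" if "t \<in> {0<..1}" for t
    using measurable_compose[OF measurable_Pair1'[of t unit_lebesgue unit_lebesgue] K] that by simp
  have \<kappa>_meas[measurable]: "\<kappa> \<in> borel_measurable unit_lebesgue"
    unfolding \<kappa>_def by measurable
  have intK: "integrable unit_lebesgue (K t)" if "t \<in> {0<..1}" for t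
    using that bound by (intro U.integrable_const_bound[where B = C]) auto
  have \<kappa>_bound: "\<bar>\<kappa> t\<bar> \<le> C" if "t \<in> {0<..1}" for t
  proof -
    have "\<bar>\<kappa> t\<bar> \<le> (\<integral>s. \<bar>K t s\<bar> \<partial>unit_lebesgue)" unfolding \<kappa>_def by (rule integral_abs_bound)
    also have "\<dots> \<le> (\<integral>s. C \<partial>unit_lebesgue)"
      using bound that intK by (intro integral_mono) auto
    finally show ?thesis by (simp add: U.prob_space[simplified])
  qed
  have int\<kappa>: "integrable unit_lebesgue \<kappa>"
    using \<kappa>_bound by (intro U.integrable_const_bound[where B = C]) auto
  have I_bound: "\<bar>I\<bar> \<le> C"
  proof -
    have "\<bar>I\<bar> \<le> (\<integral>s. \<bar>\<kappa> s\<bar> \<partial>unit_lebesgue)" unfolding I_def by (rule integral_abs_bound)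
    also have "\<dots> \<le> (\<integral>s. C \<partial>unit_lebesgue)"
      using \<kappa>_bound int\<kappa> by (intro integral_mono) auto
    finally show ?thesis by (simp add: U.prob_space[simplified])
  qed
  \<comment> \<open>\<open>q t\<close> is the inner product of the current error with the increment at \<open>t\<close>.\<close>
  define q where "q t = (\<Sum>i<m. K (\<tau> i) t) - m * \<kappa> t - (\<Sum>i<m. \<kappa> (\<tau> i)) + m * I" for t
  have intq: "integrable unit_lebesgue q"
    unfolding q_def using intK \<tau> int\<kappa> by simp
  have "(\<integral>t. q t \<partial>unit_lebesgue) = 0"
    unfolding q_def using intK \<tau> int\<kappa> by (simp add: U.prob_space[simplified] I_def[symmetric]) (simp add: \<kappa>_def)
  moreover have "(\<integral>t. q t \<partial>unit_lebesgue) > 0" if "\<And>t. t \<in> {0<..1} \<Longrightarrow> q t > 0"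
    by (intro U.expectation_greater[OF intq] AE_I2) (use that in auto)
  ultimately obtain t where t: "t \<in> {0<..1}" "q t \<le> 0" by (metis not_le less_irrefl)
  define \<tau>' where "\<tau>' = \<tau>(m := t)"
  have \<tau>': "\<tau>' m = t" "\<And>i. i < m \<Longrightarrow> \<tau>' i = \<tau> i" by (auto simp: \<tau>'_def)
  have "sampling_defect K \<tau>' (Suc m) = sampling_defect K \<tau> m + 2 * q t + K t t - 2 * \<kappa> t + I"
    unfolding sampling_defect_def \<kappa>_def[symmetric] I_def[symmetric] q_def
    using sym by (simp add: \<tau>' sum.distrib algebra_simps power2_eq_square sum_distrib_left)
  also have "\<dots> \<le> 4 * C * real m + C + 2 * C + C"
    using IH t bound[OF t(1) t(1)] \<kappa>_bound[OF t(1)] I_bound by linarith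
  finally have "sampling_defect K \<tau>' (Suc m) \<le> 4 * C * real (Suc m)" by (simp add: algebra_simps)
  moreover have "\<tau>' i \<in> {0<..1}" for i using \<tau> t by (simp add: \<tau>'_def)
  ultimately show ?case by blast
qed


section \<open>Graph averages, sample averages and the permutation process\<close>

definition graph_average :: "nat \<Rightarrow> (nat \<Rightarrow> nat) \<Rightarrow> (real \<times> real \<Rightarrow> real) \<Rightarrow> real" where
  "graph_average n p f = (\<Sum>i\<in>{1..n}. f (real i / real n, real (p i) / real n)) / real n"

definition sample_average ::
  "(nat \<Rightarrow> real) \<Rightarrow> nat \<Rightarrow> (real \<Rightarrow> real) \<Rightarrow> (real \<times> real \<Rightarrow> real) \<Rightarrow> real" where
  "sample_average \<tau> m z f = (\<Sum>l<m. f (\<tau> l, z (\<tau> l))) / real m"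

definition monomial :: "nat \<Rightarrow> nat \<Rightarrow> real \<times> real \<Rightarrow> real" where
  "monomial a b z = fst z ^ a * snd z ^ b"

lemma ceiling_index:
  assumes "n \<ge> 1" "s \<in> {0<..1}"
  shows "nat \<lceil>real n * s\<rceil> \<in> {1..n}"
proof -
  have "0 < real n * s" "real n * s \<le> real n" using assms by auto
  then have "0 < \<lceil>real n * s\<rceil>" "\<lceil>real n * s\<rceil> \<le> int n"
    by (simp_all add: ceiling_le_iff)
  then show ?thesis unfolding atLeastAtMost_iff by linarith
qed

lemma perm_process_unit:
  assumes "p permutes {1..n}" "n \<ge> 1" "t \<in> {0<..1}"
  shows "perm_process n p t \<in> {0..1}"
proof -
  have "p (nat \<lceil>real n * t\<rceil>) \<in> {1..n}"
    using permutes_in_image[OF assms(1)] ceiling_index[OF assms(2,3)] by blast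
  then show ?thesis using assms(2) by (auto simp: perm_process_def)
qed

lemma ceiling_over_tendsto: "(\<lambda>n. real (nat \<lceil>real n * s\<rceil>) / real n) \<longlonglongrightarrow> s" if "s \<ge> 0"
proof (rule tendsto_sandwich[of "\<lambda>_. s" _ _ "\<lambda>n. s + 1 / real n"])
  have *: "s \<le> real (nat \<lceil>real n * s\<rceil>) / real n \<and> real (nat \<lceil>real n * s\<rceil>) / real n \<le> s + 1 / real n"
    if "n > 0" for n
  proof -
    have "real n * s \<le> real (nat \<lceil>real n * s\<rceil>)" "real (nat \<lceil>real n * s\<rceil>) \<le> real n * s + 1"
      using mult_nonneg_nonneg[of "real n" s] \<open>s \<ge> 0\<close> by linarith+
    then show ?thesis using that by (simp add: field_simps)
  qed
  show "\<forall>\<^sub>F n in sequentially. s \<le> real (nat \<lceil>real n * s\<rceil>) / real n"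
    "\<forall>\<^sub>F n in sequentially. real (nat \<lceil>real n * s\<rceil>) / real n \<le> s + 1 / real n"
    using * by (auto intro: eventually_mono[OF eventually_gt_at_top[of 0]])
  have "(\<lambda>n. s + 1 / real n) \<longlonglongrightarrow> s + 0"
    by (intro tendsto_add tendsto_const lim_1_over_n)
  then show "(\<lambda>n. s + 1 / real n) \<longlonglongrightarrow> s" by simp
qed auto

text \<open>Averages over the vertices are integrals over time of a step function; this is what turns the averages
over the graph into integrals of a kernel.\<close>

lemma integral_ceiling_step:
  assumes "n \<ge> 1"
  shows "(\<integral>s. g (nat \<lceil>real n * s\<rceil>) \<partial>unit_lebesgue) = (\<Sum>i\<in>{1..n}. g i) / real n"
proof -
  have eq: "nat \<lceil>real n * s\<rceil> = i \<longleftrightarrow> s \<in> {(real i - 1) / real n <.. real i / real n}"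
    if "i \<ge> 1" for i s
  proof -
    have "nat \<lceil>real n * s\<rceil> = i \<longleftrightarrow> \<lceil>real n * s\<rceil> = int i" using that by auto
    also have "\<dots> \<longleftrightarrow> real i - 1 < real n * s \<and> real n * s \<le> real i" by (simp add: ceiling_eq_iff)
    finally show ?thesis using assms by (simp add: field_simps)
  qed
  have "(\<integral>s. g (nat \<lceil>real n * s\<rceil>) \<partial>unit_lebesgue) =
      (\<integral>s. (\<Sum>i\<in>{1..n}. g i * indicator {(real i - 1) / real n <.. real i / real n} s) \<partial>unit_lebesgue)"
  proof (rule Bochner_Integration.integral_cong[OF refl])
    fix s :: real assume "s \<in> space unit_lebesgue"
    then have s: "nat \<lceil>real n * s\<rceil> \<in> {1..n}" using ceiling_index[OF assms] by simp
    have "(\<Sum>i\<in>{1..n}. g i * indicator {(real i - 1) / real n <.. real i / real n} s) =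
        (\<Sum>i\<in>{1..n}. if i = nat \<lceil>real n * s\<rceil> then g i else 0)"
      by (intro sum.cong refl) (use eq[of _ s] in \<open>auto simp: indicator_def\<close>)
    then show "g (nat \<lceil>real n * s\<rceil>) =
        (\<Sum>i\<in>{1..n}. g i * indicator {(real i - 1) / real n <.. real i / real n} s)"
      using s by simp
  qed
  also have "\<dots> = (\<Sum>i\<in>{1..n}. g i * (1 / real n))"
  proof -
    have meas: "measure unit_lebesgue {(real i - 1) / real n <.. real i / real n} = 1 / real n"
      and sets: "{(real i - 1) / real n <.. real i / real n} \<in> sets unit_lebesgue"
      if "i \<in> {1..n}" for i
    proof -
      have sub: "{(real i - 1) / real n <.. real i / real n} \<subseteq> {0<..1}"
      proof
        fix s assume s: "s \<in> {(real i - 1) / real n <.. real i / real n}"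
        have "0 \<le> (real i - 1) / real n" "real i / real n \<le> 1" using that assms by auto
        with s show "s \<in> {0<..1}" by auto
      qed
      show "measure unit_lebesgue {(real i - 1) / real n <.. real i / real n} = 1 / real n"
        using sub assms by (subst measure_restrict_space) (auto simp: diff_divide_distrib)
      show "{(real i - 1) / real n <.. real i / real n} \<in> sets unit_lebesgue"
        using sub by (simp add: sets_restrict_space_iff)
    qed
    interpret U: prob_space unit_lebesgue by (rule prob_space_unit_lebesgue)
    have int: "integrable unit_lebesgue (\<lambda>s. indicator {(real i - 1) / real n <.. real i / real n} s :: real)"
      if "i \<in> {1..n}" for i
      using sets[OF that] by (intro integrable_real_indicator) (auto simp: U.emeasure_finite less_top[symmetric])
    have "(\<integral>s. (\<Sum>i\<in>{1..n}. g i * indicator {(real i - 1) / real n <.. real i / real n} s) \<partial>unit_lebesgue) =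
        (\<Sum>i\<in>{1..n}. \<integral>s. g i * indicator {(real i - 1) / real n <.. real i / real n} s \<partial>unit_lebesgue)"
      by (intro Bochner_Integration.integral_sum integrable_mult_right int)
    also have "\<dots> = (\<Sum>i\<in>{1..n}. g i * (1 / real n))"
    proof (rule sum.cong[OF refl])
      fix i assume i: "i \<in> {1..n}"
      have "(\<integral>s. indicator {(real i - 1) / real n <.. real i / real n} s \<partial>unit_lebesgue) = 1 / real n"
        using meas[OF i] sets.sets_into_space[OF sets[OF i]]
        by (simp only: Bochner_Integration.integral_indicator Int_absorb2)
      then show "(\<integral>s. g i * indicator {(real i - 1) / real n <.. real i / real n} s \<partial>unit_lebesgue) = g i * (1 / real n)"
        by simp
    qed
    finally show ?thesis .
  qed
  finally show ?thesis by (simp add: sum_divide_distrib)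
qed

lemma continuous_map_coordinate:
  assumes "continuous_on UNIV h" "i \<in> J"
  shows "continuous_map (powertop_real J) euclideanreal (\<lambda>x. h (x i))"
  using continuous_map_compose[OF continuous_map_product_projection[OF assms(2)], of "\<lambda>_. euclideanreal" euclideanreal h] assms(1)
  by (simp add: comp_def)

text \<open>All values lie in the unit cube, and composing \<open>h\<close> with the retraction onto the cube makes it bounded
without changing its values there.\<close>

lemma fdd_converges_continuous:
  assumes conv: "fdd_converges M X N Z" and J: "finite J" "J \<subseteq> {0<..1}"
    and h: "continuous_map (powertop_real J) euclideanreal h"
    and X: "\<And>n \<omega> t. n \<ge> 1 \<Longrightarrow> \<omega> \<in> space (M n) \<Longrightarrow> t \<in> J \<Longrightarrow> X n t \<omega> \<in> {0..1}"
    and Z: "\<And>\<omega> t. \<omega> \<in> space N \<Longrightarrow> t \<in> J \<Longrightarrow> Z t \<omega> \<in> {0..1}"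
  shows "(\<lambda>n. \<integral>\<omega>. h (fdd_vector (X n) J \<omega>) \<partial>M n) \<longlonglongrightarrow> (\<integral>\<omega>. h (fdd_vector Z J \<omega>) \<partial>N)"
proof -
  let ?T = "powertop_real J"
  define cl where "cl x = (\<lambda>t\<in>J. max 0 (min 1 (x t)))" for x :: "real \<Rightarrow> real"
  have clamp: "continuous_on UNIV (\<lambda>y :: real. max 0 (min 1 y))"
    by (intro continuous_intros)
  have cl: "continuous_map ?T ?T cl"
    unfolding continuous_map_componentwise cl_def
  proof (intro conjI ballI)
    fix t assume "t \<in> J"
    then show "continuous_map ?T euclideanreal (\<lambda>x. (\<lambda>t\<in>J. max 0 (min 1 (x t))) t)"
      using continuous_map_coordinate[of "\<lambda>y. max 0 (min 1 y)" t J, OF clamp] by simp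
  qed auto
  have "compactin ?T (PiE J (\<lambda>_. {0..1}))"
    by (simp add: compactin_PiE)
  then have "compactin euclideanreal (h ` PiE J (\<lambda>_. {0..1}))"
    using h by (rule image_compactin)
  then have "bounded (h ` PiE J (\<lambda>_. {0..1}))"
    by (simp add: compact_imp_bounded)
  then have "bounded ((h \<circ> cl) ` (J \<rightarrow>\<^sub>E UNIV))"
    by (rule bounded_subset) (auto simp: cl_def)
  then have "(\<lambda>n. \<integral>\<omega>. (h \<circ> cl) (fdd_vector (X n) J \<omega>) \<partial>M n) \<longlonglongrightarrow> (\<integral>\<omega>. (h \<circ> cl) (fdd_vector Z J \<omega>) \<partial>N)"
    using conv J continuous_map_compose[OF cl h] unfolding fdd_converges_def by blast
  moreover have "(\<integral>\<omega>. (h \<circ> cl) (fdd_vector Z J \<omega>) \<partial>N) = (\<integral>\<omega>. h (fdd_vector Z J \<omega>) \<partial>N)"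
    using Z by (intro Bochner_Integration.integral_cong refl)
      (auto simp: cl_def fdd_vector_def intro!: arg_cong[of _ _ h])
  moreover have "(\<integral>\<omega>. (h \<circ> cl) (fdd_vector (X n) J \<omega>) \<partial>M n) = (\<integral>\<omega>. h (fdd_vector (X n) J \<omega>) \<partial>M n)"
    if "n \<ge> 1" for n
    using X[OF that] by (intro Bochner_Integration.integral_cong refl)
      (auto simp: cl_def fdd_vector_def intro!: arg_cong[of _ _ h])
  ultimately show ?thesis
    by (intro Lim_transform_eventually[where g = "\<lambda>n. \<integral>\<omega>. h (fdd_vector (X n) J \<omega>) \<partial>M n"
          and f = "\<lambda>n. \<integral>\<omega>. (h \<circ> cl) (fdd_vector (X n) J \<omega>) \<partial>M n"])
       (auto intro: eventually_mono[OF eventually_ge_at_top[of 1]])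
qed

text \<open>The hypotheses of the theorem.\<close>

locale permutation_limit =
  fixes M :: "nat \<Rightarrow> 'a measure" and \<pi> :: "nat \<Rightarrow> 'a \<Rightarrow> nat \<Rightarrow> nat"
    and N :: "'b measure" and Z :: "real \<Rightarrow> 'b \<Rightarrow> real"
  assumes perms: "random_permutations M \<pi>"
    and unit: "unit_process N Z"
    and conv: "fdd_converges M (\<lambda>n t \<omega>. perm_process n (\<pi> n \<omega>) t) N Z"
begin

lemma prob_M: "n \<ge> 1 \<Longrightarrow> prob_space (M n)"
  using perms by (simp add: random_permutations_def)

lemma measurable_perm: "n \<ge> 1 \<Longrightarrow> \<pi> n \<in> M n \<rightarrow>\<^sub>M count_space {p. p permutes {1..n}}"
  using perms by (simp add: random_permutations_def)

lemma permutes: "n \<ge> 1 \<Longrightarrow> \<omega> \<in> space (M n) \<Longrightarrow> \<pi> n \<omega> permutes {1..n}"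
  using measurable_space[OF measurable_perm] by simp

lemma prob_N: "prob_space N"
  using unit by (simp add: unit_process_def)

lemma Z_measurable: "t \<in> {0<..1} \<Longrightarrow> Z t \<in> borel_measurable N"
  using unit by (simp add: unit_process_def)

lemma Z_unit: "t \<in> {0<..1} \<Longrightarrow> \<omega> \<in> space N \<Longrightarrow> Z t \<omega> \<in> {0..1}"
  using unit by (simp add: unit_process_def)

abbreviation Ypath :: "nat \<Rightarrow> 'a \<Rightarrow> real \<Rightarrow> real" where
  "Ypath n \<omega> \<equiv> perm_process n (\<pi> n \<omega>)"

text \<open>There are only finitely many permutations of \<open>{1..n}\<close>, so every function of \<open>\<pi> n\<close> is bounded.\<close>

lemma integrable_perm:
  fixes g :: "(nat \<Rightarrow> nat) \<Rightarrow> real"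
  assumes "n \<ge> 1"
  shows "integrable (M n) (\<lambda>\<omega>. g (\<pi> n \<omega>))"
proof -
  interpret prob_space "M n" by (rule prob_M[OF assms])
  have "finite (g ` {p. p permutes {1..n}})" by (intro finite_imageI finite_permutations) simp
  then have "bounded (g ` {p. p permutes {1..n}})" by (rule finite_imp_bounded)
  then obtain B where "\<And>p. p permutes {1..n} \<Longrightarrow> norm (g p) \<le> B"
    unfolding bounded_iff by blast
  then show ?thesis
    using permutes[OF assms] measurable_compose[OF measurable_perm[OF assms], of g borel]
    by (intro integrable_const_bound[where B = B]) auto
qed

lemma fdd_expectation_tendsto:
  assumes "finite J" "J \<subseteq> {0<..1}"
    and "continuous_map (powertop_real J) euclideanreal h"
  shows "(\<lambda>n. \<integral>\<omega>. h (\<lambda>t\<in>J. Ypath n \<omega> t) \<partial>M n) \<longlonglongrightarrow> (\<integral>\<omega>. h (\<lambda>t\<in>J. Z t \<omega>) \<partial>N)"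
proof -
  have "(\<lambda>n. \<integral>\<omega>. h (fdd_vector (\<lambda>t \<omega>. Ypath n \<omega> t) J \<omega>) \<partial>M n) \<longlonglongrightarrow>
      (\<integral>\<omega>. h (fdd_vector Z J \<omega>) \<partial>N)"
    using assms(2)
    by (intro fdd_converges_continuous[OF conv assms] perm_process_unit[OF permutes] Z_unit) auto
  then show ?thesis by (simp add: fdd_vector_def)
qed

end


section \<open>Sampling a random permutation at finitely many fixed times\<close>

text \<open>Dominated convergence, once for the single and once for the double integral.\<close>

lemma sampling_defect_tendsto:
  assumes meas: "\<And>n. (\<lambda>(s, t). K n s t) \<in> borel_measurable (unit_lebesgue \<Otimes>\<^sub>M unit_lebesgue)"
    and bound: "\<And>n s t. s \<in> {0<..1} \<Longrightarrow> t \<in> {0<..1} \<Longrightarrow> \<bar>K n s t\<bar> \<le> C"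
    and lim: "\<And>s t. s \<in> {0<..1} \<Longrightarrow> t \<in> {0<..1} \<Longrightarrow> (\<lambda>n. K n s t) \<longlonglongrightarrow> L s t"
    and \<tau>: "\<And>i. \<tau> i \<in> {0<..1}"
  shows "(\<lambda>(s, t). L s t) \<in> borel_measurable (unit_lebesgue \<Otimes>\<^sub>M unit_lebesgue)"
    and "(\<lambda>n. sampling_defect (K n) \<tau> m) \<longlonglongrightarrow> sampling_defect L \<tau> m"
proof -
  interpret U: prob_space unit_lebesgue by (rule prob_space_unit_lebesgue)
  show L_meas: "(\<lambda>(s, t). L s t) \<in> borel_measurable (unit_lebesgue \<Otimes>\<^sub>M unit_lebesgue)"
    by (rule borel_measurable_LIMSEQ_real[OF _ meas]) (auto simp: space_pair_measure intro!: lim)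
  have K1: "K n t \<in> borel_measurable unit_lebesgue" and L1: "L t \<in> borel_measurable unit_lebesgue"
    if "t \<in> {0<..1}" for n t
    using measurable_compose[OF measurable_Pair1'[of t unit_lebesgue unit_lebesgue] meas]
      measurable_compose[OF measurable_Pair1'[of t unit_lebesgue unit_lebesgue] L_meas] that by simp_all
  have C: "0 \<le> C"
    using order_trans[OF abs_ge_zero bound[of 1 1 0]] by simp
  have inner: "(\<lambda>n. \<integral>s. K n t s \<partial>unit_lebesgue) \<longlonglongrightarrow> (\<integral>s. L t s \<partial>unit_lebesgue)"
    if t: "t \<in> {0<..1}" for t
    by (rule integral_dominated_convergence[where w = "\<lambda>_. C"])
       (use t K1 L1 lim bound C in auto)
  have inner_bound: "\<bar>\<integral>s. K n t s \<partial>unit_lebesgue\<bar> \<le> C" if t: "t \<in> {0<..1}" for n t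
  proof -
    have "\<bar>\<integral>s. K n t s \<partial>unit_lebesgue\<bar> \<le> (\<integral>s. \<bar>K n t s\<bar> \<partial>unit_lebesgue)"
      by (rule integral_abs_bound)
    also have "\<dots> \<le> (\<integral>s. C \<partial>unit_lebesgue)"
      using t K1[OF t] bound C
      by (intro integral_mono integrable_abs U.integrable_const_bound[where B = C]) auto
    finally show ?thesis by (simp add: U.prob_space[simplified])
  qed
  have outer: "(\<lambda>n. \<integral>t. \<integral>s. K n t s \<partial>unit_lebesgue \<partial>unit_lebesgue) \<longlonglongrightarrow>
      (\<integral>t. \<integral>s. L t s \<partial>unit_lebesgue \<partial>unit_lebesgue)"
    by (rule integral_dominated_convergence[where w = "\<lambda>_. C"])
       (use inner inner_bound meas L_meas in \<open>auto intro!: U.borel_measurable_lebesgue_integral\<close>)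
  show "(\<lambda>n. sampling_defect (K n) \<tau> m) \<longlonglongrightarrow> sampling_defect L \<tau> m"
    unfolding sampling_defect_def
    by (intro tendsto_intros lim inner outer \<tau>)
qed

lemma sum_swap_inner: "(\<Sum>i\<in>A. \<Sum>j\<in>B. \<Sum>x\<in>F. g x i j) = (\<Sum>x\<in>F. \<Sum>i\<in>A. \<Sum>j\<in>B. g x i j)"
proof -
  have "(\<Sum>i\<in>A. \<Sum>j\<in>B. \<Sum>x\<in>F. g x i j) = (\<Sum>i\<in>A. \<Sum>x\<in>F. \<Sum>j\<in>B. g x i j)"
    by (intro sum.cong refl sum.swap)
  then show ?thesis by (simp add: sum.swap[of _ F A])
qed

lemma sum_square_difference:
  fixes u :: "'x \<Rightarrow> 'i \<Rightarrow> real" and v :: "'x \<Rightarrow> 'j \<Rightarrow> real"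
  shows "(\<Sum>x\<in>F. ((\<Sum>l\<in>A. u x l) - r * (\<Sum>i\<in>B. v x i))\<^sup>2) =
     (\<Sum>l\<in>A. \<Sum>l'\<in>A. \<Sum>x\<in>F. u x l * u x l') - 2 * r * (\<Sum>l\<in>A. \<Sum>i\<in>B. \<Sum>x\<in>F. u x l * v x i)
     + r\<^sup>2 * (\<Sum>i\<in>B. \<Sum>i'\<in>B. \<Sum>x\<in>F. v x i * v x i')"
proof -
  have "((\<Sum>l\<in>A. u x l) - r * (\<Sum>i\<in>B. v x i))\<^sup>2 =
     (\<Sum>l\<in>A. \<Sum>l'\<in>A. u x l * u x l') - 2 * r * (\<Sum>l\<in>A. \<Sum>i\<in>B. u x l * v x i)
     + r\<^sup>2 * (\<Sum>i\<in>B. \<Sum>i'\<in>B. v x i * v x i')" for x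
    unfolding sum_product[symmetric] by (simp add: power2_eq_square algebra_simps)
  then show ?thesis
    unfolding sum_swap_inner[where F = F and A = A and B = A]
      sum_swap_inner[where F = F and A = A and B = B] sum_swap_inner[where F = F and A = B and B = B]
    by (simp only: sum.distrib sum_subtractf sum_distrib_left[symmetric])
qed

context permutation_limit begin

text \<open>The covariance kernel of the family of all monomials with exponents in \<open>F\<close>, on vertices and, in the
limit, on times. Summing over \<open>F\<close> lets one choice of times serve all of these monomials.\<close>

definition index_kernel :: "(nat \<times> nat) set \<Rightarrow> nat \<Rightarrow> nat \<Rightarrow> nat \<Rightarrow> real" where
  "index_kernel F n i j = (\<integral>\<omega>. (\<Sum>x\<in>F.
      monomial (fst x) (snd x) (real i / real n, real (\<pi> n \<omega> i) / real n) *
      monomial (fst x) (snd x) (real j / real n, real (\<pi> n \<omega> j) / real n)) \<partial>M n)"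

definition time_kernel :: "(nat \<times> nat) set \<Rightarrow> real \<Rightarrow> real \<Rightarrow> real" where
  "time_kernel F s t = (\<Sum>x\<in>F. s ^ fst x * t ^ fst x * (\<integral>\<omega>. Z s \<omega> ^ snd x * Z t \<omega> ^ snd x \<partial>N))"

lemma index_kernel_bound:
  assumes n: "n \<ge> 1" and ij: "i \<in> {1..n}" "j \<in> {1..n}"
  shows "\<bar>index_kernel F n i j\<bar> \<le> real (card F)"
proof -
  interpret prob_space "M n" by (rule prob_M[OF n])
  have mono1: "\<bar>monomial a b (real i / real n, real (\<pi> n \<omega> i) / real n)\<bar> \<le> 1"
    if "\<omega> \<in> space (M n)" "i \<in> {1..n}" for \<omega> i a b
  proof -
    have "\<pi> n \<omega> i \<in> {1..n}" using permutes_in_image[OF permutes[OF n that(1)]] that(2) by blast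
    then show ?thesis using that(2)
      by (auto simp: monomial_def abs_mult intro!: mult_le_one power_le_one)
  qed
  have "\<bar>\<Sum>x\<in>F. monomial (fst x) (snd x) (real i / real n, real (\<pi> n \<omega> i) / real n) *
      monomial (fst x) (snd x) (real j / real n, real (\<pi> n \<omega> j) / real n)\<bar> \<le> real (card F)"
    if "\<omega> \<in> space (M n)" for \<omega>
  proof -
    have "\<bar>\<Sum>x\<in>F. monomial (fst x) (snd x) (real i / real n, real (\<pi> n \<omega> i) / real n) *
      monomial (fst x) (snd x) (real j / real n, real (\<pi> n \<omega> j) / real n)\<bar> \<le> (\<Sum>x\<in>F. 1)"
      using mono1[OF that ij(1)] mono1[OF that ij(2)]
      by (intro order_trans[OF sum_abs] sum_mono) (auto simp: abs_mult intro!: mult_le_one)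
    then show ?thesis by simp
  qed
  then have "(\<integral>\<omega>. \<bar>\<Sum>x\<in>F. monomial (fst x) (snd x) (real i / real n, real (\<pi> n \<omega> i) / real n) *
      monomial (fst x) (snd x) (real j / real n, real (\<pi> n \<omega> j) / real n)\<bar> \<partial>M n) \<le> (\<integral>\<omega>. real (card F) \<partial>M n)"
    by (intro integral_mono integrable_const
        integrable_perm[OF n, of "\<lambda>p. \<bar>\<Sum>x\<in>F. monomial (fst x) (snd x) (real i / real n, real (p i) / real n) *
      monomial (fst x) (snd x) (real j / real n, real (p j) / real n)\<bar>"])
  then have "\<bar>index_kernel F n i j\<bar> \<le> (\<integral>\<omega>. real (card F) \<partial>M n)"
    unfolding index_kernel_def by (rule order_trans[OF integral_abs_bound])
  then show ?thesis by (simp add: prob_space)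
qed

text \<open>For monomials the first coordinate splits off as a deterministic factor, so that only the two-dimensional
distributions of the process enter.\<close>

lemma index_kernel_tendsto:
  assumes F: "finite F" and s: "s \<in> {0<..1}" and t: "t \<in> {0<..1}"
  shows "(\<lambda>n. index_kernel F n (nat \<lceil>real n * s\<rceil>) (nat \<lceil>real n * t\<rceil>)) \<longlonglongrightarrow> time_kernel F s t"
proof -
  let ?r = "\<lambda>n s. real (nat \<lceil>real n * s\<rceil>) / real n"
  let ?Y = "\<lambda>n t \<omega>. Ypath n \<omega> t"
  have "(\<lambda>n. \<Sum>x\<in>F. ?r n s ^ fst x * ?r n t ^ fst x * (\<integral>\<omega>. ?Y n s \<omega> ^ snd x * ?Y n t \<omega> ^ snd x \<partial>M n))
      \<longlonglongrightarrow> time_kernel F s t"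
    unfolding time_kernel_def
  proof (intro tendsto_sum tendsto_mult tendsto_power ceiling_over_tendsto)
    fix x assume "x \<in> F"
    have "continuous_on UNIV (\<lambda>y :: real. y ^ snd x)" by (intro continuous_intros)
    then have "continuous_map (powertop_real {s, t}) euclideanreal
        (\<lambda>y. y s ^ snd x * y t ^ snd x)"
      using continuous_map_coordinate[of "\<lambda>y. y ^ snd x" s "{s, t}"]
        continuous_map_coordinate[of "\<lambda>y. y ^ snd x" t "{s, t}"]
      by (intro continuous_map_real_mult) auto
    from fdd_expectation_tendsto[OF _ _ this] s t
    show "(\<lambda>n. \<integral>\<omega>. ?Y n s \<omega> ^ snd x * ?Y n t \<omega> ^ snd x \<partial>M n) \<longlonglongrightarrow>
        (\<integral>\<omega>. Z s \<omega> ^ snd x * Z t \<omega> ^ snd x \<partial>N)"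
      by simp
  qed (use s t in auto)
  moreover have "index_kernel F n (nat \<lceil>real n * s\<rceil>) (nat \<lceil>real n * t\<rceil>) =
      (\<Sum>x\<in>F. ?r n s ^ fst x * ?r n t ^ fst x * (\<integral>\<omega>. ?Y n s \<omega> ^ snd x * ?Y n t \<omega> ^ snd x \<partial>M n))"
    if n: "n \<ge> 1" for n
  proof -
    have "index_kernel F n (nat \<lceil>real n * s\<rceil>) (nat \<lceil>real n * t\<rceil>) =
      (\<integral>\<omega>. (\<Sum>x\<in>F. ?r n s ^ fst x * ?r n t ^ fst x * (?Y n s \<omega> ^ snd x * ?Y n t \<omega> ^ snd x)) \<partial>M n)"
      unfolding index_kernel_def perm_process_def monomial_def by (simp add: mult_ac)
    also have "\<dots> = (\<Sum>x\<in>F. \<integral>\<omega>. ?r n s ^ fst x * ?r n t ^ fst x * (?Y n s \<omega> ^ snd x * ?Y n t \<omega> ^ snd x) \<partial>M n)"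
      by (intro Bochner_Integration.integral_sum integrable_perm[OF n, of "\<lambda>p. ?r n s ^ fst _ * ?r n t ^ fst _ *
            (perm_process n p s ^ snd _ * perm_process n p t ^ snd _)"])
    finally show ?thesis by simp
  qed
  ultimately show ?thesis
    by (intro Lim_transform_eventually[where g = "\<lambda>n. index_kernel F n (nat \<lceil>real n * s\<rceil>) (nat \<lceil>real n * t\<rceil>)" and
          f = "\<lambda>n. \<Sum>x\<in>F. ?r n s ^ fst x * ?r n t ^ fst x * (\<integral>\<omega>. ?Y n s \<omega> ^ snd x * ?Y n t \<omega> ^ snd x \<partial>M n)"]
          eventually_mono[OF eventually_ge_at_top[of 1]]) simp_all
qed

text \<open>The Hilbert space picture behind \<open>sampling_defect\<close>, with \<open>u s\<close> the random vector of the values of the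
monomials at the graph point above \<open>\<lceil>n s\<rceil>\<close>: its integral over \<open>s\<close> is the average over the graph.\<close>

lemma sampling_variance:
  assumes n: "n \<ge> 1"
  shows "(\<integral>\<omega>. (\<Sum>x\<in>F. ((\<Sum>l<m. monomial (fst x) (snd x)
             (real (nat \<lceil>real n * \<tau> l\<rceil>) / real n, Ypath n \<omega> (\<tau> l)))
           - real m * graph_average n (\<pi> n \<omega>) (monomial (fst x) (snd x)))\<^sup>2) \<partial>M n) =
     sampling_defect (\<lambda>s t. index_kernel F n (nat \<lceil>real n * s\<rceil>) (nat \<lceil>real n * t\<rceil>)) \<tau> m"
    (is "?lhs = ?rhs")
proof -
  define \<beta> where "\<beta> p x i = monomial (fst x) (snd x) (real i / real n, real (p i) / real n)"
    for p and x :: "nat \<times> nat" and i :: nat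
  define c where "c l = nat \<lceil>real n * \<tau> l\<rceil>" for l
  define G where "G i j \<omega> = (\<Sum>x\<in>F. \<beta> (\<pi> n \<omega>) x i * \<beta> (\<pi> n \<omega>) x j)" for i j \<omega>
  have k: "index_kernel F n i j = (\<integral>\<omega>. G i j \<omega> \<partial>M n)" for i j
    by (simp add: index_kernel_def \<beta>_def G_def)
  have G_int: "integrable (M n) (G i j)" for i j
    unfolding G_def by (rule integrable_perm[OF n, of "\<lambda>p. \<Sum>x\<in>F. \<beta> p x i * \<beta> p x j"])
  have "?lhs = (\<integral>\<omega>. (\<Sum>x\<in>F. ((\<Sum>l<m. \<beta> (\<pi> n \<omega>) x (c l)) - (real m / real n) * (\<Sum>i\<in>{1..n}. \<beta> (\<pi> n \<omega>) x i))\<^sup>2) \<partial>M n)"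
    by (simp add: \<beta>_def c_def perm_process_def graph_average_def)
  also have "\<dots> = (\<Sum>l<m. \<Sum>l'<m. index_kernel F n (c l) (c l'))
      - 2 * (real m / real n) * (\<Sum>l<m. \<Sum>i\<in>{1..n}. index_kernel F n (c l) i)
      + (real m / real n)\<^sup>2 * (\<Sum>i\<in>{1..n}. \<Sum>i'\<in>{1..n}. index_kernel F n i i')"
    unfolding sum_square_difference k G_def[symmetric] using G_int by simp
  also have "\<dots> = ?rhs"
  proof -
    have "(\<integral>t. \<integral>s. index_kernel F n (nat \<lceil>real n * t\<rceil>) (nat \<lceil>real n * s\<rceil>) \<partial>unit_lebesgue \<partial>unit_lebesgue) =
        (\<Sum>i\<in>{1..n}. (\<Sum>j\<in>{1..n}. index_kernel F n i j) / real n) / real n"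
      unfolding integral_ceiling_step[OF n, of "index_kernel F n _"]
      by (rule integral_ceiling_step[OF n, of "\<lambda>i. (\<Sum>j\<in>{1..n}. index_kernel F n i j) / real n"])
    then show ?thesis
      unfolding sampling_defect_def integral_ceiling_step[OF n, of "index_kernel F n _"] c_def
      by (simp add: power2_eq_square sum_divide_distrib[symmetric])
  qed
  finally show ?thesis .
qed

lemma index_kernel_measurable:
  "(\<lambda>(s, t). index_kernel F n (nat \<lceil>real n * s\<rceil>) (nat \<lceil>real n * t\<rceil>)) \<in>
     borel_measurable (unit_lebesgue \<Otimes>\<^sub>M unit_lebesgue)"
proof -
  have 1: "(\<lambda>s. nat \<lceil>real n * s\<rceil>) \<in> unit_lebesgue \<rightarrow>\<^sub>M count_space UNIV"
    by (rule measurable_restrict_space1) measurable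
  have "(\<lambda>z. (nat \<lceil>real n * fst z\<rceil>, nat \<lceil>real n * snd z\<rceil>)) \<in>
      unit_lebesgue \<Otimes>\<^sub>M unit_lebesgue \<rightarrow>\<^sub>M count_space UNIV \<Otimes>\<^sub>M count_space UNIV"
    by (intro measurable_Pair measurable_compose[OF measurable_fst 1] measurable_compose[OF measurable_snd 1])
  then have "(\<lambda>z. (nat \<lceil>real n * fst z\<rceil>, nat \<lceil>real n * snd z\<rceil>)) \<in>
      unit_lebesgue \<Otimes>\<^sub>M unit_lebesgue \<rightarrow>\<^sub>M count_space UNIV"
    by (simp add: pair_measure_countable)
  from measurable_compose[OF this, of "\<lambda>(i, j). index_kernel F n i j" borel]
  show ?thesis by (simp add: case_prod_unfold)
qed

text \<open>The times are chosen for the limit kernel; convergence of the kernels makes the same times good for all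
large \<open>n\<close>. A mean square error below \<open>\<delta>\<^sup>2 / 4\<close> bounds the mean absolute error by way of
\<open>\<bar>y\<bar> \<le> \<delta> / 4 + y\<^sup>2 / \<delta>\<close>, and replacing \<open>\<lceil>n s\<rceil>/n\<close> by \<open>s\<close> costs a deterministic error that vanishes.\<close>

lemma good_sample_exists:
  assumes F: "finite F" and \<delta>: "\<delta> > 0"
  shows "\<exists>\<tau> m. m > 0 \<and> (\<forall>l. \<tau> l \<in> {0<..1}) \<and> (\<forall>x\<in>F. \<forall>\<^sub>F n in sequentially.
     (\<integral>\<omega>. \<bar>sample_average \<tau> m (Ypath n \<omega>) (monomial (fst x) (snd x))
            - graph_average n (\<pi> n \<omega>) (monomial (fst x) (snd x))\<bar> \<partial>M n) \<le> \<delta>)"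
proof -
  define C where "C = real (card F)"
  define K where "K n s t = index_kernel F (Suc n) (nat \<lceil>real (Suc n) * s\<rceil>) (nat \<lceil>real (Suc n) * t\<rceil>)" for n s t
  have K_meas: "(\<lambda>(s, t). K n s t) \<in> borel_measurable (unit_lebesgue \<Otimes>\<^sub>M unit_lebesgue)" for n
    unfolding K_def by (rule index_kernel_measurable)
  have K_bound: "\<bar>K n s t\<bar> \<le> C" if "s \<in> {0<..1}" "t \<in> {0<..1}" for n s t
    unfolding K_def C_def using that by (intro index_kernel_bound ceiling_index) auto
  have K_lim: "(\<lambda>n. K n s t) \<longlonglongrightarrow> time_kernel F s t" if "s \<in> {0<..1}" "t \<in> {0<..1}" for s t
    unfolding K_def using index_kernel_tendsto[OF F that] by (rule LIMSEQ_Suc)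
  have lim: "(\<lambda>(s, t). time_kernel F s t) \<in> borel_measurable (unit_lebesgue \<Otimes>\<^sub>M unit_lebesgue)"
    "(\<lambda>n. sampling_defect (K n) \<tau> m) \<longlonglongrightarrow> sampling_defect (time_kernel F) \<tau> m"
    if "\<And>i. \<tau> i \<in> {0<..1}" for \<tau> m
    using sampling_defect_tendsto[where K = K and C = C and L = "time_kernel F" and \<tau> = \<tau>]
      K_meas K_bound K_lim that by blast+
  \<comment> \<open>Large enough that the greedy bound \<open>4 C m\<close> is less than \<open>\<delta>\<^sup>2 m\<^sup>2 / 4\<close>\<close>
  obtain m :: nat where m: "m > 0" "32 * C / \<delta>\<^sup>2 < real m"
    using reals_Archimedean2[of "max 0 (32 * C / \<delta>\<^sup>2)"] by auto
  have "\<exists>\<tau>. (\<forall>i. \<tau> i \<in> {0<..1}) \<and> sampling_defect (time_kernel F) \<tau> m \<le> 4 * C * real m"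
  proof (rule sampling_defect_small)
    show "(\<lambda>(s, t). time_kernel F s t) \<in> borel_measurable (unit_lebesgue \<Otimes>\<^sub>M unit_lebesgue)"
      by (rule lim(1)[where \<tau> = "\<lambda>_. 1"]) auto
    show "time_kernel F s t = time_kernel F t s" for s t
      by (simp add: time_kernel_def mult_ac)
    show "\<bar>time_kernel F s t\<bar> \<le> C" if "s \<in> {0<..1}" "t \<in> {0<..1}" for s t
      using K_bound[OF that] by (intro LIMSEQ_le_const2[OF tendsto_rabs[OF K_lim[OF that]]]) auto
  qed
  then obtain \<tau> where \<tau>: "\<And>l. \<tau> l \<in> {0<..1}" "sampling_defect (time_kernel F) \<tau> m \<le> 4 * C * real m"
    by blast
  have "4 * C * real m < \<delta>\<^sup>2 * (real m)\<^sup>2 / 4"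
    using m \<delta> by (auto simp: field_simps power2_eq_square) (smt (verit) C_def mult_left_mono of_nat_0_le_iff)
  then have "sampling_defect (time_kernel F) \<tau> m < \<delta>\<^sup>2 * (real m)\<^sup>2 / 4"
    using \<tau>(2) by simp
  note ev_K = order_tendstoD(2)[OF lim(2)[OF \<tau>(1)] this, unfolded K_def]
  have ev: "\<forall>\<^sub>F n in sequentially. sampling_defect (\<lambda>s t. index_kernel F n (nat \<lceil>real n * s\<rceil>) (nat \<lceil>real n * t\<rceil>)) \<tau> m
      < \<delta>\<^sup>2 * (real m)\<^sup>2 / 4"
    by (rule iffD1[OF eventually_sequentially_Suc]) (rule ev_K)
  have "\<forall>\<^sub>F n in sequentially.
     (\<integral>\<omega>. \<bar>sample_average \<tau> m (Ypath n \<omega>) (monomial (fst x) (snd x))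
            - graph_average n (\<pi> n \<omega>) (monomial (fst x) (snd x))\<bar> \<partial>M n) \<le> \<delta>"
    if x: "x \<in> F" for x
  proof -
    define d where "d n = (\<Sum>l<m. \<bar>\<tau> l ^ fst x - (real (nat \<lceil>real n * \<tau> l\<rceil>) / real n) ^ fst x\<bar>)" for n
    have "d \<longlonglongrightarrow> (\<Sum>l<m. \<bar>\<tau> l ^ fst x - \<tau> l ^ fst x\<bar>)"
      unfolding d_def using \<tau>(1)
      by (intro tendsto_intros ceiling_over_tendsto) (auto simp: less_imp_le)
    then have "\<forall>\<^sub>F n in sequentially. d n < \<delta> / 2"
      using \<delta> by (intro order_tendstoD(2)) auto
    with ev show ?thesis using eventually_ge_at_top[of 1]
    proof eventually_elim
      case (elim n)
      interpret prob_space "M n" by (rule prob_M[OF elim(3)])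
      define S where "S y p = (\<Sum>l<m. monomial (fst y) (snd y)
             (real (nat \<lceil>real n * \<tau> l\<rceil>) / real n, perm_process n p (\<tau> l)))" for y p
      define A where "A y p = graph_average n p (monomial (fst y) (snd y))" for y p
      have le: "(\<integral>\<omega>. (S x (\<pi> n \<omega>) - real m * A x (\<pi> n \<omega>))\<^sup>2 \<partial>M n) \<le> \<delta>\<^sup>2 * (real m)\<^sup>2 / 4"
      proof -
        have "(S x p - real m * A x p)\<^sup>2 \<le> (\<Sum>y\<in>F. (S y p - real m * A y p)\<^sup>2)" for p
          by (rule member_le_sum[OF x _ F]) simp
        then have "(\<integral>\<omega>. (S x (\<pi> n \<omega>) - real m * A x (\<pi> n \<omega>))\<^sup>2 \<partial>M n) \<le>
            (\<integral>\<omega>. (\<Sum>y\<in>F. (S y (\<pi> n \<omega>) - real m * A y (\<pi> n \<omega>))\<^sup>2) \<partial>M n)"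
          by (intro integral_mono integrable_perm[OF elim(3), of "\<lambda>p. (S x p - real m * A x p)\<^sup>2"]
              integrable_perm[OF elim(3), of "\<lambda>p. \<Sum>y\<in>F. (S y p - real m * A y p)\<^sup>2"])
        then show ?thesis
          using sampling_variance[OF elim(3), where F = F and m = m and \<tau> = \<tau>] elim(1) unfolding S_def A_def by linarith
      qed
      \<comment> \<open>\<open>\<delta> / 2\<close> pays for the rounding of the times, the rest for the sampling error.\<close>
      have pointwise: "\<bar>sample_average \<tau> m (perm_process n p) (monomial (fst x) (snd x)) - A x p\<bar> \<le>
          \<delta> / 2 + \<delta> / 4 + (S x p - real m * A x p)\<^sup>2 / (\<delta> * (real m)\<^sup>2)"
        if p: "p permutes {1..n}" for p
      proof -
        define y where "y = S x p / real m - A x p"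
        have "\<bar>y\<bar> \<le> \<delta> / 4 + y\<^sup>2 / \<delta>"
        proof -
          have "0 \<le> (\<bar>y\<bar> - \<delta> / 2)\<^sup>2" by simp
          then have "\<delta> * \<bar>y\<bar> \<le> \<delta>\<^sup>2 / 4 + y\<^sup>2"
            by (simp add: power2_diff power_divide mult.commute)
          then show ?thesis using \<delta> by (simp add: field_simps power2_eq_square)
        qed
        moreover have "y\<^sup>2 / \<delta> = (S x p - real m * A x p)\<^sup>2 / (\<delta> * (real m)\<^sup>2)"
        proof -
          have "S x p - real m * A x p = real m * y" using m(1) by (simp add: y_def right_diff_distrib)
          then show ?thesis using m(1) by (simp add: power_mult_distrib)
        qed
        moreover have "\<bar>sample_average \<tau> m (perm_process n p) (monomial (fst x) (snd x)) - S x p / real m\<bar> \<le> d n"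
        proof -
          have "\<bar>monomial (fst x) (snd x) (\<tau> l, perm_process n p (\<tau> l)) - monomial (fst x) (snd x)
             (real (nat \<lceil>real n * \<tau> l\<rceil>) / real n, perm_process n p (\<tau> l))\<bar> \<le>
             \<bar>\<tau> l ^ fst x - (real (nat \<lceil>real n * \<tau> l\<rceil>) / real n) ^ fst x\<bar>" for l
          proof -
            have "perm_process n p (\<tau> l) \<in> {0..1}" by (rule perm_process_unit[OF p elim(3) \<tau>(1)])
            then have "\<bar>perm_process n p (\<tau> l) ^ snd x\<bar> \<le> 1" by (auto intro: power_le_one)
            then show ?thesis
              by (simp add: monomial_def left_diff_distrib[symmetric] abs_mult mult_left_le)
          qed
          then have "\<bar>sample_average \<tau> m (perm_process n p) (monomial (fst x) (snd x)) - S x p / real m\<bar> \<le> d n / real m"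
            unfolding sample_average_def S_def d_def diff_divide_distrib[symmetric] sum_subtractf[symmetric] abs_divide
            by (auto intro!: divide_right_mono order_trans[OF sum_abs] sum_mono)
          also have "\<dots> \<le> d n" 
          proof -
            have "0 \<le> d n" by (auto simp: d_def intro: sum_nonneg)
            then show ?thesis using m(1) by (simp add: divide_le_eq mult_le_cancel_left1)
          qed
          finally show ?thesis .
        qed
        ultimately show ?thesis using elim(2) unfolding y_def by linarith
      qed
      have "(\<integral>\<omega>. \<bar>sample_average \<tau> m (Ypath n \<omega>) (monomial (fst x) (snd x)) - A x (\<pi> n \<omega>)\<bar> \<partial>M n) \<le>
          (\<integral>\<omega>. \<delta> / 2 + \<delta> / 4 + (S x (\<pi> n \<omega>) - real m * A x (\<pi> n \<omega>))\<^sup>2 / (\<delta> * (real m)\<^sup>2) \<partial>M n)"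
        by (intro integral_mono pointwise permutes elim(3)
            integrable_perm[OF elim(3), of "\<lambda>p. \<bar>sample_average \<tau> m (perm_process n p) (monomial (fst x) (snd x)) - A x p\<bar>"]
            integrable_perm[OF elim(3), of "\<lambda>p. \<delta> / 2 + \<delta> / 4 + (S x p - real m * A x p)\<^sup>2 / (\<delta> * (real m)\<^sup>2)"])
      also have "\<dots> = \<delta> / 2 + \<delta> / 4 + (\<integral>\<omega>. (S x (\<pi> n \<omega>) - real m * A x (\<pi> n \<omega>))\<^sup>2 \<partial>M n) / (\<delta> * (real m)\<^sup>2)"
        using integrable_perm[OF elim(3), of "\<lambda>p. (S x p - real m * A x p)\<^sup>2"]
        by (simp add: prob_space)
      also have "\<dots> \<le> \<delta> / 2 + \<delta> / 4 + (\<delta>\<^sup>2 * (real m)\<^sup>2 / 4) / (\<delta> * (real m)\<^sup>2)"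
        using le \<delta> m(1) by (intro add_left_mono divide_right_mono) auto
      also have "\<dots> = \<delta>" using \<delta> m(1) by (simp add: power2_eq_square field_simps)
      finally show ?case unfolding A_def .
    qed
  qed
  then show ?thesis using m(1) \<tau>(1) by blast
qed

end


section \<open>Tools for random measures\<close>

text \<open>The integral of a continuous step from \<open>x\<close> to \<open>y\<close> lies between the values of the distribution function at
\<open>x\<close> and \<open>y\<close>; let \<open>y\<close> decrease to \<open>x\<close> and use right continuity.\<close>

lemma real_distribution_eqI_cts_step:
  assumes M1: "real_distribution M1" and M2: "real_distribution M2"
    and eq: "\<And>x y. x < y \<Longrightarrow> integral\<^sup>L M1 (cts_step x y) = integral\<^sup>L M2 (cts_step x y)"
  shows "M1 = M2"
proof -
  have le: "cdf P x \<le> cdf Q x"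
    if P: "real_distribution P" and Q: "real_distribution Q"
      and *: "\<And>x y. x < y \<Longrightarrow> integral\<^sup>L P (cts_step x y) = integral\<^sup>L Q (cts_step x y)" for P Q x
  proof -
    interpret P: real_distribution P by fact
    interpret Q: real_distribution Q by fact
    have "(cdf Q \<longlongrightarrow> cdf Q x) (at_right x)"
      using Q.cdf_is_right_cont by (simp add: continuous_within)
    moreover have "\<forall>\<^sub>F y in at_right x. cdf P x \<le> cdf Q y"
      using P.cdf_cts_step(1) Q.cdf_cts_step(2) * unfolding eventually_at_filter
      by (intro always_eventually) (metis greaterThan_iff order_trans)
    ultimately show ?thesis by (rule tendsto_lowerbound) simp
  qed
  show ?thesis
    using le[OF M1 M2 eq] le[OF M2 M1 eq[symmetric]]
    by (intro cdf_unique M1 M2 ext antisym)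
qed

lemma sets_borel_square_closed:
  "sets borel_square = sigma_sets unit_square {C \<inter> unit_square | C. closed C}"
proof -
  have "closed unit_square" by (intro closed_Times) auto
  then have "unit_square \<in> sigma_sets UNIV (Collect closed)" by auto
  from sigma_sets_Int[OF this] have
    "(\<inter>) unit_square ` sigma_sets UNIV (Collect closed) = sigma_sets unit_square ((\<inter>) unit_square ` Collect closed)"
    by simp
  moreover have "sets (borel :: (real \<times> real) measure) = sigma_sets UNIV (Collect closed)"
    unfolding borel_eq_closed by simp
  moreover have "(\<inter>) unit_square ` Collect closed = {C \<inter> unit_square | C. closed C}" by auto
  ultimately show ?thesis unfolding sets_restrict_space by simp
qed

text \<open>The relatively closed sets form a generator that is stable under intersections, and the indicator of a
closed set \<open>C\<close> is the decreasing limit of the continuous functions \<open>max 0 (1 - k * infdist z C)\<close>.\<close>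

lemma random_measure_measurable:
  fixes \<mu> :: "'b \<Rightarrow> (real \<times> real) measure"
  assumes \<mu>: "\<And>\<omega>. \<omega> \<in> space N \<Longrightarrow> \<mu> \<omega> \<in> space (prob_algebra borel_square)"
    and int: "\<And>f :: real \<times> real \<Rightarrow> real. continuous_on unit_square f \<Longrightarrow> (\<lambda>\<omega>. \<integral>z. f z \<partial>\<mu> \<omega>) \<in> borel_measurable N"
  shows "\<mu> \<in> N \<rightarrow>\<^sub>M prob_algebra borel_square"
proof (rule measurable_prob_algebra_generated[OF sets_borel_square_closed])
  show "Int_stable {C \<inter> unit_square | C. closed C}"
  proof (rule Int_stableI)
    fix A B assume "A \<in> {C \<inter> unit_square | C. closed C}" "B \<in> {C \<inter> unit_square | C. closed C}"
    then obtain C D where "A = C \<inter> unit_square" "B = D \<inter> unit_square" "closed C" "closed D" by auto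
    then have "A \<inter> B = (C \<inter> D) \<inter> unit_square" "closed (C \<inter> D)" by auto
    then show "A \<inter> B \<in> {C \<inter> unit_square | C. closed C}" by blast
  qed
  fix A assume "A \<in> {C \<inter> unit_square | C. closed C}"
  then obtain C where C: "closed C" "A = C \<inter> unit_square" by auto
  \<comment> \<open>The empty set is a separate case because the distance to it is 0 by convention.\<close>
  show "(\<lambda>\<omega>. emeasure (\<mu> \<omega>) A) \<in> borel_measurable N"
  proof (cases "C = {}")
    case False
    define g where "g k z = max 0 (1 - real k * infdist z C)" for k and z :: "real \<times> real"
    have g_lim: "(\<lambda>k. g k z) \<longlonglongrightarrow> indicator C z" for z
    proof (cases "z \<in> C")
      case True then show ?thesis by (simp add: g_def)
    next
      case notin: False
      then have pos: "infdist z C > 0"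
        using C(1) False infdist_pos_not_in_closed by blast
      obtain K :: nat where K: "1 / infdist z C < real K" using reals_Archimedean2 by blast
      then have "g k z = 0" if "k \<ge> K" for k
      proof -
        have "1 < real K * infdist z C" using K pos by (simp add: field_simps)
        also have "\<dots> \<le> real k * infdist z C" using that pos by (intro mult_right_mono) auto
        finally show ?thesis by (simp add: g_def)
      qed
      then show ?thesis using notin by (auto intro!: tendsto_eventually eventually_sequentiallyI[of K])
    qed
    have cont: "continuous_on unit_square (g k)" for k
      unfolding g_def by (intro continuous_intros)
    have lim: "(\<lambda>k. \<integral>z. g k z \<partial>\<mu> \<omega>) \<longlonglongrightarrow> measure (\<mu> \<omega>) A" if \<omega>: "\<omega> \<in> space N" for \<omega>
    proof -
      have sets: "sets (\<mu> \<omega>) = sets borel_square" and "prob_space (\<mu> \<omega>)"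
        using \<mu>[OF \<omega>] by (auto simp: space_prob_algebra)
      interpret prob_space "\<mu> \<omega>" by fact
      have space: "space (\<mu> \<omega>) = unit_square"
        using sets_eq_imp_space_eq[OF sets] by (simp add: space_restrict_space)
      have A: "A \<in> sets (\<mu> \<omega>)" unfolding sets sets_borel_square_closed using C by blast
      have "(\<lambda>k. \<integral>z. g k z \<partial>\<mu> \<omega>) \<longlonglongrightarrow> (\<integral>z. indicator A z \<partial>\<mu> \<omega>)"
      proof (rule integral_dominated_convergence[where w = "\<lambda>_. 1"])
        show "AE z in \<mu> \<omega>. (\<lambda>k. g k z) \<longlonglongrightarrow> indicator A z"
        proof (rule AE_I2)
          fix z assume "z \<in> space (\<mu> \<omega>)"
          then have "indicator A z = (indicator C z :: real)" by (simp add: C(2) space indicator_def)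
          then show "(\<lambda>k. g k z) \<longlonglongrightarrow> indicator A z" using g_lim by simp
        qed
        show "g k \<in> borel_measurable (\<mu> \<omega>)" for k
          using continuous_square_measurable[OF cont] sets by (simp cong: measurable_cong_sets)
      qed (use A in \<open>auto simp: g_def infdist_nonneg\<close>)
      then show ?thesis using sets.sets_into_space[OF A] by (simp add: Int_absorb2)
    qed
    have "(\<lambda>\<omega>. measure (\<mu> \<omega>) A) \<in> borel_measurable N"
      by (rule borel_measurable_LIMSEQ_real[OF lim int[OF cont]])
    moreover have "emeasure (\<mu> \<omega>) A = ennreal (measure (\<mu> \<omega>) A)" if "\<omega> \<in> space N" for \<omega>
      using \<mu>[OF that] by (auto simp: space_prob_algebra prob_space_def intro!: finite_measure.emeasure_eq_measure)
    ultimately show ?thesis by (subst measurable_cong[where g = "\<lambda>\<omega>. ennreal (measure (\<mu> \<omega>) A)"]) auto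
  qed (use C in simp)
qed (use \<mu> in \<open>auto simp: space_prob_algebra\<close>)

text \<open>The expectation of the sum of the absolute values, from index \<open>K\<close> on, is finite by monotone convergence.\<close>

lemma AE_summable_of_geometric_expectation:
  fixes X :: "nat \<Rightarrow> 'b \<Rightarrow> real"
  assumes int: "\<And>k. integrable N (X k)"
    and bound: "\<And>k. k \<ge> K \<Longrightarrow> (\<integral>\<omega>. \<bar>X k \<omega>\<bar> \<partial>N) \<le> C * (1 / 2) ^ k"
  shows "AE \<omega> in N. summable (\<lambda>k. \<bar>X k \<omega>\<bar>)"
proof -
  have [measurable]: "X k \<in> borel_measurable N" for k using int by auto
  have summ: "summable (\<lambda>k. \<bar>C\<bar> * (1 / 2) ^ (k + K))"
    by (simp add: power_add summable_mult summable_mult2 summable_geometric)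
  have "(\<integral>\<^sup>+\<omega>. (\<Sum>k. ennreal \<bar>X (k + K) \<omega>\<bar>) \<partial>N) = (\<Sum>k. \<integral>\<^sup>+\<omega>. ennreal \<bar>X (k + K) \<omega>\<bar> \<partial>N)"
    by (intro nn_integral_suminf) measurable
  also have "\<dots> = (\<Sum>k. ennreal (\<integral>\<omega>. \<bar>X (k + K) \<omega>\<bar> \<partial>N))"
    using int by (subst nn_integral_eq_integral) auto
  also have "\<dots> \<le> (\<Sum>k. ennreal (\<bar>C\<bar> * (1 / 2) ^ (k + K)))"
  proof (intro suminf_le ennreal_leI)
    fix k
    have "(\<integral>\<omega>. \<bar>X (k + K) \<omega>\<bar> \<partial>N) \<le> C * (1 / 2) ^ (k + K)" by (rule bound) simp
    also have "\<dots> \<le> \<bar>C\<bar> * (1 / 2) ^ (k + K)" by (intro mult_right_mono) auto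
    finally show "(\<integral>\<omega>. \<bar>X (k + K) \<omega>\<bar> \<partial>N) \<le> \<bar>C\<bar> * (1 / 2) ^ (k + K)" .
  qed auto
  also have "\<dots> = ennreal (\<Sum>k. \<bar>C\<bar> * (1 / 2) ^ (k + K))"
    by (intro suminf_ennreal2 summ) auto
  finally have "(\<integral>\<^sup>+\<omega>. (\<Sum>k. ennreal \<bar>X (k + K) \<omega>\<bar>) \<partial>N) \<noteq> \<infinity>"
    by (auto simp: top_unique)
  then have "AE \<omega> in N. (\<Sum>k. ennreal \<bar>X (k + K) \<omega>\<bar>) \<noteq> \<infinity>"
    by (intro nn_integral_PInf_AE) measurable
  then show ?thesis
  proof eventually_elim
    case (elim \<omega>)
    then have "summable (\<lambda>k. \<bar>X (k + K) \<omega>\<bar>)" by (intro summable_suminf_not_top) auto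
    then show ?case by (subst (asm) summable_iff_shift)
  qed
qed


section \<open>Moments and uniform marginals\<close>

text \<open>The value that a linear functional takes on the polynomial \<open>\<lambda>w. poly3 xs (w, v)\<close> if it takes the value
\<open>L a b\<close> on the monomial \<open>x^a y^b\<close>.\<close>

definition poly3_moment :: "(nat \<Rightarrow> nat \<Rightarrow> real) \<Rightarrow> (real \<times> nat \<times> nat \<times> nat) list \<Rightarrow> real \<Rightarrow> real" where
  "poly3_moment L xs v = (\<Sum>(c, a, b, d)\<leftarrow>xs. c * L a b * v ^ d)"

lemma poly3_moment_simps:
  "poly3_moment L [] v = 0"
  "poly3_moment L ((c, a, b, d) # xs) v = c * L a b * v ^ d + poly3_moment L xs v"
  by (simp_all add: poly3_moment_def)

lemma poly3_Cons_monomial: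
  "poly3 ((c, a, b, d) # xs) (z, v) = c * v ^ d * monomial a b z + poly3 xs (z, v)"
  by (simp add: poly3_simps monomial_def)

lemma poly3_moment_tendsto:
  assumes "\<And>a b. (\<lambda>k. L k a b) \<longlonglongrightarrow> L' a b"
  shows "(\<lambda>k. poly3_moment (L k) xs v) \<longlonglongrightarrow> poly3_moment L' xs v"
  by (induction xs) (auto simp: poly3_moment_simps intro!: tendsto_intros assms)

lemma sample_average_linear:
  "sample_average \<tau> m z (\<lambda>w. c * f w + g w) = c * sample_average \<tau> m z f + sample_average \<tau> m z g"
  by (simp add: sample_average_def sum.distrib sum_distrib_left add_divide_distrib)

lemma graph_average_linear:
  "graph_average n p (\<lambda>w. c * f w + g w) = c * graph_average n p f + graph_average n p g"
  by (simp add: graph_average_def sum.distrib sum_distrib_left add_divide_distrib)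

lemma sample_average_poly3:
  "sample_average \<tau> m z (\<lambda>w. poly3 xs (w, v)) =
     poly3_moment (\<lambda>a b. sample_average \<tau> m z (monomial a b)) xs v"
proof (induction xs)
  case Nil
  show ?case by (simp add: poly3_simps poly3_moment_simps sample_average_def)
next
  case (Cons x xs)
  then show ?case
    by (cases x) (simp add: poly3_Cons_monomial poly3_moment_simps sample_average_linear)
qed

lemma graph_average_poly3:
  "graph_average n p (\<lambda>w. poly3 xs (w, v)) =
     poly3_moment (\<lambda>a b. graph_average n p (monomial a b)) xs v"
proof (induction xs)
  case Nil
  show ?case by (simp add: poly3_simps poly3_moment_simps graph_average_def)
next
  case (Cons x xs)
  then show ?case
    by (cases x) (simp add: poly3_Cons_monomial poly3_moment_simps graph_average_linear)
qed

lemma sample_average_le: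
  assumes "\<And>l. l < m \<Longrightarrow> \<bar>f (\<tau> l, z (\<tau> l)) - g (\<tau> l, z (\<tau> l))\<bar> \<le> e" "m > 0"
  shows "\<bar>sample_average \<tau> m z f - sample_average \<tau> m z g\<bar> \<le> e"
proof -
  have "\<bar>\<Sum>l<m. f (\<tau> l, z (\<tau> l)) - g (\<tau> l, z (\<tau> l))\<bar> \<le> (\<Sum>l<m. e)"
    using assms(1) by (intro order_trans[OF sum_abs] sum_mono) auto
  then show ?thesis
    using assms(2) by (simp add: sample_average_def sum_subtractf diff_divide_distrib[symmetric] abs_divide divide_le_eq mult.commute)
qed

lemma graph_average_le:
  assumes "\<And>i. i \<in> {1..n} \<Longrightarrow> \<bar>f (real i / real n, real (p i) / real n) - g (real i / real n, real (p i) / real n)\<bar> \<le> e"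
    "n > 0"
  shows "\<bar>graph_average n p f - graph_average n p g\<bar> \<le> e"
proof -
  have "\<bar>\<Sum>i\<in>{1..n}. f (real i / real n, real (p i) / real n) - g (real i / real n, real (p i) / real n)\<bar> \<le> (\<Sum>i\<in>{1..n}. e)"
    using assms(1) by (intro order_trans[OF sum_abs] sum_mono) auto
  then show ?thesis
    using assms(2) by (simp add: graph_average_def sum_subtractf diff_divide_distrib[symmetric] abs_divide divide_le_eq mult.commute)
qed

lemma continuous_square_integrable:
  assumes "\<mu> \<in> space (prob_algebra borel_square)" "continuous_on unit_square (f :: real \<times> real \<Rightarrow> real)"
  shows "integrable \<mu> f"
proof -
  from assms(1) have sets: "sets \<mu> = sets borel_square" and "prob_space \<mu>" by (auto simp: space_prob_algebra)
  interpret prob_space \<mu> by fact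
  obtain B where B: "\<forall>z\<in>unit_square. \<bar>f z\<bar> \<le> B" using continuous_square_bounded[OF assms(2)] by blast
  show ?thesis
    using B continuous_square_measurable[OF assms(2)] sets sets_eq_imp_space_eq[OF sets]
    by (intro integrable_const_bound[where B = B])
       (auto intro!: AE_I2 simp: space_restrict_space cong: measurable_cong_sets)
qed

lemma continuous_on_monomial: "continuous_on A (monomial a b)"
  unfolding monomial_def by (intro continuous_intros)

lemma continuous_on_poly3: "continuous_on A (\<lambda>w. poly3 xs w)"
proof (induction xs)
  case Nil show ?case by (simp add: poly3_simps)
next
  case (Cons x xs)
  then show ?case by (cases x) (simp add: poly3_simps continuous_intros)
qed

lemma uniform_unit_distr: "uniform_measure lborel {0..1} = distr unit_lebesgue borel (\<lambda>x. x)"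
proof (rule measure_eqI)
  fix A assume "A \<in> sets (uniform_measure lborel {0..1 :: real})"
  then have A[measurable]: "A \<in> sets borel" by simp
  have "emeasure lborel ({0..1} \<inter> A) = emeasure lborel ({0<..1} \<inter> A)"
    using AE_lborel_singleton[of 0] by (intro emeasure_eq_AE) (auto elim!: eventually_mono)
  moreover have "emeasure (distr unit_lebesgue borel (\<lambda>x. x)) A = emeasure lborel ({0<..1} \<inter> A)"
    by (subst emeasure_distr) (auto simp: emeasure_restrict_space Int_commute space_restrict_space
        intro!: measurable_restrict_space1)
  ultimately show "emeasure (uniform_measure lborel {0..1}) A = emeasure (distr unit_lebesgue borel (\<lambda>x. x)) A"
    by (subst emeasure_uniform_measure) (auto simp: divide_ennreal_def)
qed simp

text \<open>The moments determine the integrals of polynomials, hence of continuous functions by the Weierstrass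
theorem, hence the measure. The one-variable approximation is read off from the approximation of
\<open>\<lambda>w. h (fst (fst w))\<close> by a polynomial in three variables, evaluated at 0 in the other two.\<close>

lemma uniform_marginal_of_moments:
  assumes \<mu>: "\<mu> \<in> space (prob_algebra borel_square)"
    and proj: "continuous_on UNIV proj" "\<And>z. z \<in> unit_square \<Longrightarrow> proj z \<in> {0..1}"
    and moments: "\<And>a. (\<integral>z. proj z ^ a \<partial>\<mu>) = (\<integral>s. s ^ a \<partial>unit_lebesgue)"
  shows "distr \<mu> borel proj = uniform_measure lborel {0..1}"
proof -
  from \<mu> have sets: "sets \<mu> = sets borel_square" and "prob_space \<mu>" by (auto simp: space_prob_algebra)
  interpret \<mu>: prob_space \<mu> by fact
  interpret U: prob_space unit_lebesgue by (rule prob_space_unit_lebesgue)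
  have space: "space \<mu> = unit_square"
    using sets_eq_imp_space_eq[OF sets] by (simp add: space_restrict_space)
  have proj_meas[measurable]: "proj \<in> \<mu> \<rightarrow>\<^sub>M borel"
    using measurable_restrict_space1[OF borel_measurable_continuous_onI[OF proj(1)]] sets by (simp cong: measurable_cong_sets)
  have id_meas[measurable]: "(\<lambda>x. x) \<in> unit_lebesgue \<rightarrow>\<^sub>M borel"
    by (intro measurable_restrict_space1) simp
  have int\<mu>: "integrable \<mu> (\<lambda>z. h (proj z))" and intU: "integrable unit_lebesgue h"
    if h: "continuous_on UNIV h" for h :: "real \<Rightarrow> real"
  proof -
    have [measurable]: "h \<in> borel_measurable borel" using h by (rule borel_measurable_continuous_onI)
    have "bounded (h ` {0..1})"
      by (intro compact_imp_bounded compact_continuous_image continuous_on_subset[OF h]) auto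
    then obtain B where B: "\<And>x. x \<in> {0..1} \<Longrightarrow> norm (h x) \<le> B" unfolding bounded_iff by blast
    show "integrable \<mu> (\<lambda>z. h (proj z))"
      using B proj(2) by (intro \<mu>.integrable_const_bound[where B = B] AE_I2) (auto simp: space)
    show "integrable unit_lebesgue h"
      using B by (intro U.integrable_const_bound[where B = B] AE_I2) (auto intro: measurable_compose[OF id_meas])
  qed
  have poly: "(\<integral>z. poly3 xs ((proj z, 0), 0) \<partial>\<mu>) = (\<integral>s. poly3 xs ((s, 0), 0) \<partial>unit_lebesgue)" for xs
  proof (induction xs)
    case Nil show ?case by (simp add: poly3_simps)
  next
    case (Cons x xs)
    obtain c a b d where x: "x = (c, a, b, d)" by (cases x) auto
    have cont: "continuous_on UNIV (\<lambda>s. c * (s ^ a * 0 ^ b) * 0 ^ d)" "continuous_on UNIV (\<lambda>s. poly3 xs ((s, 0), 0))"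
      by (intro continuous_intros continuous_on_compose2[OF continuous_on_poly3[of UNIV xs]]; auto)+
    show ?case
      unfolding x poly3_simps
      using int\<mu>[OF cont(1)] int\<mu>[OF cont(2)] intU[OF cont(1)] intU[OF cont(2)] Cons
      by (simp add: moments)
  qed
  have eq: "(\<integral>z. h (proj z) \<partial>\<mu>) = (\<integral>s. h s \<partial>unit_lebesgue)"
    if h: "continuous_on UNIV h" for h :: "real \<Rightarrow> real"
  proof -
    have "\<bar>(\<integral>z. h (proj z) \<partial>\<mu>) - (\<integral>s. h s \<partial>unit_lebesgue)\<bar> \<le> e" if e: "e > 0" for e
    proof -
      have "continuous_on (unit_square \<times> {0..1}) (\<lambda>w. h (fst (fst w)))"
        by (intro continuous_on_compose2[OF h] continuous_intros) auto
      from poly3_approx[OF this, of "e / 2"] e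
      obtain xs where xs: "\<And>w. w \<in> unit_square \<times> {0..1} \<Longrightarrow> \<bar>h (fst (fst w)) - poly3 xs w\<bar> < e / 2"
        by auto
      have close: "\<bar>h s - poly3 xs ((s, 0), 0)\<bar> \<le> e / 2" if "s \<in> {0..1}" for s
        using xs[of "((s, 0), 0)"] that by auto
      have cont: "continuous_on UNIV (\<lambda>s. poly3 xs ((s, 0), 0))"
        by (intro continuous_intros continuous_on_compose2[OF continuous_on_poly3[of UNIV xs]]) auto
      have "\<bar>\<integral>z. h (proj z) - poly3 xs ((proj z, 0), 0) \<partial>\<mu>\<bar> \<le> (\<integral>z. e / 2 \<partial>\<mu>)"
        using close proj(2) int\<mu>[OF h] int\<mu>[OF cont]
        by (intro order_trans[OF integral_abs_bound] integral_mono) (auto simp: space)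
      moreover have "\<bar>\<integral>s. h s - poly3 xs ((s, 0), 0) \<partial>unit_lebesgue\<bar> \<le> (\<integral>s. e / 2 \<partial>unit_lebesgue)"
        using close intU[OF h] intU[OF cont]
        by (intro order_trans[OF integral_abs_bound] integral_mono) auto
      moreover have "(\<integral>z. e / 2 \<partial>\<mu>) = e / 2" "(\<integral>s. e / 2 \<partial>unit_lebesgue) = e / 2"
        by (simp_all add: \<mu>.prob_space U.prob_space[simplified])
      ultimately show ?thesis
        unfolding Bochner_Integration.integral_diff[OF int\<mu>[OF h] int\<mu>[OF cont]]
          Bochner_Integration.integral_diff[OF intU[OF h] intU[OF cont]] poly[of xs]
        by linarith
    qed
    from field_le_epsilon[of "\<bar>(\<integral>z. h (proj z) \<partial>\<mu>) - (\<integral>s. h s \<partial>unit_lebesgue)\<bar>" 0] this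
    show ?thesis by simp
  qed
  show ?thesis unfolding uniform_unit_distr
  proof (rule real_distribution_eqI_cts_step)
    show "real_distribution (distr \<mu> borel proj)" "real_distribution (distr unit_lebesgue borel (\<lambda>x. x))"
      by (auto simp: real_distribution_def real_distribution_axioms_def
          intro!: \<mu>.prob_space_distr U.prob_space_distr)
    fix x y :: real assume "x < y"
    then have cont: "continuous_on UNIV (cts_step x y)"
      by (intro uniformly_continuous_imp_continuous cts_step_uniformly_continuous)
    show "integral\<^sup>L (distr \<mu> borel proj) (cts_step x y) = integral\<^sup>L (distr unit_lebesgue borel (\<lambda>x. x)) (cts_step x y)"
      using eq[OF cont] borel_measurable_continuous_onI[OF cont]
      by (subst (1 2) integral_distr) auto
  qed
qed


section \<open>Sample averages of the limit process\<close>

text \<open>Convergence of the moments makes the averages of every continuous function converge, by polynomial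
approximation. Weak compactness supplies a measure along a subsequence, and its integrals must then be the
full limits.\<close>

lemma permuton_of_moment_limits:
  fixes T :: "nat \<Rightarrow> nat \<Rightarrow> real" and m :: "nat \<Rightarrow> nat" and z :: "real \<Rightarrow> real"
  assumes m: "\<And>k. m k > 0" and T: "\<And>k l. T k l \<in> {0<..1}" and z: "\<And>s. s \<in> {0<..1} \<Longrightarrow> z s \<in> {0..1}"
    and conv: "\<And>a b. convergent (\<lambda>k. sample_average (T k) (m k) z (monomial a b))"
    and fst_moments: "\<And>a. (\<lambda>k. sample_average (T k) (m k) z (monomial a 0)) \<longlonglongrightarrow> (\<integral>s. s ^ a \<partial>unit_lebesgue)"
    and snd_moments: "\<And>b. (\<lambda>k. sample_average (T k) (m k) z (monomial 0 b)) \<longlonglongrightarrow> (\<integral>s. s ^ b \<partial>unit_lebesgue)"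
  shows "\<exists>\<mu>\<in>permutons. \<forall>f :: real \<times> real \<Rightarrow> real. continuous_on unit_square f \<longrightarrow>
           (\<lambda>k. sample_average (T k) (m k) z f) \<longlonglongrightarrow> (\<integral>w. f w \<partial>\<mu>)"
proof -
  have in_sq: "(T k l, z (T k l)) \<in> unit_square" for k l
    using T[of k l] z[OF T[of k l]] by auto
  have conv_f: "convergent (\<lambda>k. sample_average (T k) (m k) z f)" if f: "continuous_on unit_square f" for f
  proof (rule Cauchy_convergent, rule metric_CauchyI)
    fix e :: real assume e: "e > 0"
    have "continuous_on (unit_square \<times> {0..1}) (\<lambda>w. f (fst w))"
      by (intro continuous_on_compose2[OF f] continuous_intros) auto
    from poly3_approx[OF this, of "e / 3"] e
    obtain xs where xs: "\<And>w. w \<in> unit_square \<times> {0..1} \<Longrightarrow> \<bar>f (fst w) - poly3 xs w\<bar> < e / 3"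
      by auto
    have close: "\<bar>sample_average (T k) (m k) z f - sample_average (T k) (m k) z (\<lambda>w. poly3 xs (w, 0))\<bar> \<le> e / 3" for k
    proof (rule sample_average_le[OF _ m])
      fix l
      show "\<bar>f (T k l, z (T k l)) - poly3 xs ((T k l, z (T k l)), 0)\<bar> \<le> e / 3"
        using xs[of "((T k l, z (T k l)), 0)"] in_sq[of k l] by simp
    qed
    have "convergent (\<lambda>k. sample_average (T k) (m k) z (\<lambda>w. poly3 xs (w, 0)))"
      unfolding sample_average_poly3
      by (rule convergentI, rule poly3_moment_tendsto[where L' =
            "\<lambda>a b. lim (\<lambda>k. sample_average (T k) (m k) z (monomial a b))"])
         (use conv in \<open>simp add: convergent_LIMSEQ_iff\<close>)
    then have Cauchy: "Cauchy (\<lambda>k. sample_average (T k) (m k) z (\<lambda>w. poly3 xs (w, 0)))"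
      by (rule convergent_Cauchy)
    obtain K where K: "\<And>k l. k \<ge> K \<Longrightarrow> l \<ge> K \<Longrightarrow> dist (sample_average (T k) (m k) z (\<lambda>w. poly3 xs (w, 0)))
        (sample_average (T l) (m l) z (\<lambda>w. poly3 xs (w, 0))) < e / 3"
      using metric_CauchyD[OF Cauchy, of "e / 3"] e by auto
    show "\<exists>K. \<forall>k\<ge>K. \<forall>l\<ge>K. dist (sample_average (T k) (m k) z f) (sample_average (T l) (m l) z f) < e"
    proof (intro exI[of _ K] allI impI)
      fix k l assume "k \<ge> K" "l \<ge> K"
      from K[OF this] close[of k] close[of l]
      show "dist (sample_average (T k) (m k) z f) (sample_average (T l) (m l) z f) < e"
        unfolding dist_real_def by linarith
    qed
  qed
  have "\<exists>r \<mu>. strict_mono (r :: nat \<Rightarrow> nat) \<and> \<mu> \<in> space (prob_algebra borel_square) \<and>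
      (\<forall>f :: real \<times> real \<Rightarrow> real. continuous_on unit_square f \<longrightarrow>
       (\<lambda>k. sample_average (T (r k)) (m (r k)) z f) \<longlonglongrightarrow> (\<integral>w. f w \<partial>\<mu>))"
  proof (rule empirical_measures_subsequence[of m "\<lambda>k l. (T k l, z (T k l))", OF m in_sq])
    fix r :: "nat \<Rightarrow> nat" and \<mu> :: "(real \<times> real) measure"
    assume "strict_mono r" "\<mu> \<in> space (prob_algebra borel_square)"
      "\<And>f :: real \<times> real \<Rightarrow> real. continuous_on unit_square f \<Longrightarrow>
       (\<lambda>k. (\<Sum>l<m (r k). f (T (r k) l, z (T (r k) l))) / m (r k)) \<longlonglongrightarrow> (\<integral>w. f w \<partial>\<mu>)"
    then show ?thesis unfolding sample_average_def by blast
  qed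
  then obtain r \<mu> where r: "strict_mono (r :: nat \<Rightarrow> nat)" and \<mu>: "\<mu> \<in> space (prob_algebra borel_square)"
    and sub: "\<And>f :: real \<times> real \<Rightarrow> real. continuous_on unit_square f \<Longrightarrow>
       (\<lambda>k. sample_average (T (r k)) (m (r k)) z f) \<longlonglongrightarrow> (\<integral>w. f w \<partial>\<mu>)"
    by blast
  have lim: "(\<lambda>k. sample_average (T k) (m k) z f) \<longlonglongrightarrow> (\<integral>w. f w \<partial>\<mu>)"
    if f: "continuous_on unit_square f" for f
  proof -
    obtain L where L: "(\<lambda>k. sample_average (T k) (m k) z f) \<longlonglongrightarrow> L"
      using conv_f[OF f] by (auto simp: convergent_def)
    from LIMSEQ_subseq_LIMSEQ[OF this r] sub[OF f] have "L = (\<integral>w. f w \<partial>\<mu>)"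
      by (auto simp: comp_def intro: LIMSEQ_unique)
    with L show ?thesis by simp
  qed
  have "distr \<mu> borel fst = uniform_measure lborel {0..1}"
  proof (rule uniform_marginal_of_moments[OF \<mu>])
    fix a show "(\<integral>w. fst w ^ a \<partial>\<mu>) = (\<integral>s. s ^ a \<partial>unit_lebesgue)"
      using LIMSEQ_unique[OF lim[OF continuous_on_monomial] fst_moments[of a]] by (simp add: monomial_def)
  qed (auto intro!: continuous_intros)
  moreover have "distr \<mu> borel snd = uniform_measure lborel {0..1}"
  proof (rule uniform_marginal_of_moments[OF \<mu>])
    fix a show "(\<integral>w. snd w ^ a \<partial>\<mu>) = (\<integral>s. s ^ a \<partial>unit_lebesgue)"
      using LIMSEQ_unique[OF lim[OF continuous_on_monomial] snd_moments[of a]] by (simp add: monomial_def)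
  qed (auto intro!: continuous_intros)
  ultimately have "\<mu> \<in> permutons" using \<mu> by (simp add: permutons_def)
  with lim show ?thesis by blast
qed

lemma sample_average_restrict:
  assumes "\<And>l. l < m \<Longrightarrow> \<tau> l \<in> J"
  shows "sample_average \<tau> m (restrict z J) f = sample_average \<tau> m z f"
  using assms by (simp add: sample_average_def)

text \<open>This is why sampled averages are useful: in contrast to averages over the whole graph they depend on
finitely many times, so convergence of the finite dimensional distributions applies to them.\<close>

lemma continuous_map_sample_average:
  assumes "\<And>s. continuous_on UNIV (\<lambda>y. f (s, y))" "\<And>l. l < m \<Longrightarrow> \<tau> l \<in> J"
  shows "continuous_map (powertop_real J) euclideanreal (\<lambda>x. sample_average \<tau> m x f)"
proof -
  have "continuous_map (powertop_real J) euclideanreal (\<lambda>x. f (\<tau> l, x (\<tau> l)))"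
    if "l < m" for l
    using continuous_map_coordinate[OF assms(1)[of "\<tau> l"] assms(2)[OF that]] .
  then show ?thesis
    unfolding sample_average_def divide_inverse
    by (intro continuous_map_real_mult continuous_map_sum) auto
qed

text \<open>A permutation takes every value once, so the graph has the same distribution in both coordinates.\<close>

lemma graph_average_monomial_swap:
  assumes "p permutes {1..n}"
  shows "graph_average n p (monomial 0 b) = graph_average n p (monomial b 0)"
proof -
  have "(\<Sum>i\<in>{1..n}. (real (p i) / real n) ^ b) = (\<Sum>i\<in>{1..n}. (real i / real n) ^ b)"
    by (rule sum.permute[OF assms, unfolded comp_def, symmetric])
  then show ?thesis by (simp add: graph_average_def monomial_def)
qed

lemma graph_average_monomial_tendsto:
  "(\<lambda>n. graph_average n (p n) (monomial a 0)) \<longlonglongrightarrow> (\<integral>s. s ^ a \<partial>unit_lebesgue)"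
proof -
  interpret U: prob_space unit_lebesgue by (rule prob_space_unit_lebesgue)
  have "(\<lambda>n. \<integral>s. (real (nat \<lceil>real (Suc n) * s\<rceil>) / real (Suc n)) ^ a \<partial>unit_lebesgue) \<longlonglongrightarrow> (\<integral>s. s ^ a \<partial>unit_lebesgue)"
  proof (rule integral_dominated_convergence[where w = "\<lambda>_. 1"])
    show "AE s in unit_lebesgue. (\<lambda>n. (real (nat \<lceil>real (Suc n) * s\<rceil>) / real (Suc n)) ^ a) \<longlonglongrightarrow> s ^ a"
      by (intro AE_I2 tendsto_power LIMSEQ_Suc ceiling_over_tendsto) auto
    show "AE s in unit_lebesgue. norm ((real (nat \<lceil>real (Suc n) * s\<rceil>) / real (Suc n)) ^ a) \<le> 1" for n
    proof (rule AE_I2)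
      fix s assume "s \<in> space unit_lebesgue"
      then have "nat \<lceil>real (Suc n) * s\<rceil> \<in> {1..Suc n}" by (intro ceiling_index) auto
      then have "real (nat \<lceil>real (Suc n) * s\<rceil>) \<le> real (Suc n)"
        unfolding atLeastAtMost_iff of_nat_le_iff by blast
      then have "real (nat \<lceil>real (Suc n) * s\<rceil>) / real (Suc n) \<le> 1" by (simp add: divide_le_eq)
      then show "norm ((real (nat \<lceil>real (Suc n) * s\<rceil>) / real (Suc n)) ^ a) \<le> 1"
        by (simp add: power_le_one)
    qed
  qed (auto intro!: measurable_restrict_space1)
  then have "(\<lambda>n. graph_average (Suc n) (p (Suc n)) (monomial a 0)) \<longlonglongrightarrow> (\<integral>s. s ^ a \<partial>unit_lebesgue)"
    by (subst (asm) integral_ceiling_step) (auto simp: graph_average_def monomial_def)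
  then show ?thesis by (rule LIMSEQ_imp_Suc)
qed

lemma monomial_unit: "z \<in> unit_square \<Longrightarrow> monomial a b z \<in> {0..1}"
  by (auto simp: monomial_def intro!: mult_le_one power_le_one)

lemma sample_monomial_bound:
  assumes "q > 0" "\<And>l. (\<tau> l, z (\<tau> l)) \<in> unit_square"
  shows "\<bar>sample_average \<tau> q z (monomial a b)\<bar> \<le> 1"
proof -
  have "\<bar>sample_average \<tau> q z (monomial a b) - sample_average \<tau> q z (\<lambda>_. 0)\<bar> \<le> 1"
    using monomial_unit[OF assms(2)] by (intro sample_average_le assms(1)) auto
  then show ?thesis by (simp add: sample_average_def)
qed

lemma continuous_map_sample_monomial:
  assumes "\<And>l. l < q \<Longrightarrow> \<tau> l \<in> J"
  shows "continuous_map (powertop_real J) euclideanreal (\<lambda>x. sample_average \<tau> q x (monomial a b))"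
  by (intro continuous_map_sample_average assms) (auto simp: monomial_def intro!: continuous_intros)

text \<open>Lists \<open>T k\<close> of \<open>m k\<close> fixed times such that averaging over the \<open>k\<close>-th list reproduces the graph averages of
all monomials with exponents at most \<open>k\<close>, with mean error \<open>2^-k\<close> for all large \<open>n\<close>.\<close>

locale sampled_permutation_limit = permutation_limit +
  fixes T :: "nat \<Rightarrow> nat \<Rightarrow> real" and m :: "nat \<Rightarrow> nat"
  assumes m_pos: "m k > 0" and T_unit: "T k l \<in> {0<..1}"
    and T_good: "a \<le> k \<Longrightarrow> b \<le> k \<Longrightarrow> \<forall>\<^sub>F n in sequentially.
      (\<integral>\<omega>. \<bar>sample_average (T k) (m k) (perm_process n (\<pi> n \<omega>)) (monomial a b)
            - graph_average n (\<pi> n \<omega>) (monomial a b)\<bar> \<partial>M n) \<le> (1 / 2) ^ k"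
begin

abbreviation Zpath :: "'b \<Rightarrow> real \<Rightarrow> real" where "Zpath \<omega> \<equiv> \<lambda>t. Z t \<omega>"

abbreviation sampled :: "nat \<Rightarrow> (real \<Rightarrow> real) \<Rightarrow> (real \<times> real \<Rightarrow> real) \<Rightarrow> real" where
  "sampled k \<equiv> sample_average (T k) (m k)"

lemma sample_Z_measurable:
  assumes "\<And>l. continuous_on {0..1} (\<lambda>y. f (\<tau> l, y))" "\<And>l. \<tau> l \<in> {0<..1}"
  shows "(\<lambda>\<omega>. sample_average \<tau> q (Zpath \<omega>) f) \<in> borel_measurable N"
proof -
  have "(\<lambda>\<omega>. f (\<tau> l, Z (\<tau> l) \<omega>)) \<in> borel_measurable N" for l
  proof (rule measurable_compose[of "Z (\<tau> l)" _ "restrict_space borel {0..1}" "\<lambda>y. f (\<tau> l, y)"])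
    show "Z (\<tau> l) \<in> N \<rightarrow>\<^sub>M restrict_space borel {0..1}"
      using Z_measurable Z_unit assms(2) by (intro measurable_restrict_space2) auto
    show "(\<lambda>y. f (\<tau> l, y)) \<in> borel_measurable (restrict_space borel {0..1})"
      by (rule borel_measurable_continuous_on_restrict[OF assms(1)])
  qed
  then show ?thesis unfolding sample_average_def by measurable
qed

lemma sample_Z_integrable: "integrable N (\<lambda>\<omega>. sampled k (Zpath \<omega>) (monomial a b))"
proof -
  interpret prob_space N by (rule prob_N)
  have "continuous_on {0..1} (\<lambda>y. monomial a b (T k l, y))" for l
    unfolding monomial_def by (intro continuous_intros)
  from sample_Z_measurable[of "monomial a b" "T k", OF this T_unit] show ?thesis
    using T_unit Z_unit
    by (intro integrable_const_bound[where B = 1] AE_I2) (auto intro!: sample_monomial_bound m_pos simp: less_imp_le)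
qed

text \<open>For large \<open>n\<close> both sampled averages of the permutation process are close to the same graph average, hence to
each other, and their distance is a continuous function of finitely many values of the process.\<close>

lemma sample_difference_expectation:
  assumes ab: "a \<le> k" "b \<le> k" and kl: "k \<le> l"
  shows "(\<integral>\<omega>. \<bar>sampled k (Zpath \<omega>) (monomial a b)
            - sampled l (Zpath \<omega>) (monomial a b)\<bar> \<partial>N) \<le> 2 * (1 / 2) ^ k"
proof -
  define J where "J = T k ` {..<m k} \<union> T l ` {..<m l}"
  have J: "finite J" "J \<subseteq> {0<..1}" "\<And>i. i < m k \<Longrightarrow> T k i \<in> J" "\<And>i. i < m l \<Longrightarrow> T l i \<in> J"
    using T_unit by (auto simp: J_def)
  define h where "h x = \<bar>sampled k x (monomial a b) - sampled l x (monomial a b)\<bar>" for x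
  have "continuous_map (powertop_real J) euclideanreal h"
    unfolding h_def using J(3,4)
    by (intro continuous_map_real_abs continuous_map_diff continuous_map_sample_monomial)
  from fdd_expectation_tendsto[OF J(1,2) this]
  have lim: "(\<lambda>n. \<integral>\<omega>. h (Ypath n \<omega>) \<partial>M n) \<longlonglongrightarrow> (\<integral>\<omega>. h (Zpath \<omega>) \<partial>N)"
    using J(3,4) by (simp add: h_def sample_average_restrict cong: if_cong)
  have "\<forall>\<^sub>F n in sequentially. (\<integral>\<omega>. h (Ypath n \<omega>) \<partial>M n) \<le> 2 * (1 / 2) ^ k"
    using T_good[OF ab] T_good[OF order_trans[OF ab(1) kl] order_trans[OF ab(2) kl]] eventually_ge_at_top[of 1]
  proof eventually_elim
    case (elim n)
    define A where "A p = graph_average n p (monomial a b)" for p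
    define S where "S k p = sampled k (perm_process n p) (monomial a b)" for k p
    have "(\<integral>\<omega>. h (Ypath n \<omega>) \<partial>M n) \<le> (\<integral>\<omega>. \<bar>S k (\<pi> n \<omega>) - A (\<pi> n \<omega>)\<bar> + \<bar>S l (\<pi> n \<omega>) - A (\<pi> n \<omega>)\<bar> \<partial>M n)"
      by (intro integral_mono integrable_perm[OF elim(3), of "\<lambda>p. h (perm_process n p)"]
          integrable_perm[OF elim(3), of "\<lambda>p. \<bar>S k p - A p\<bar> + \<bar>S l p - A p\<bar>"]) (auto simp: h_def S_def)
    also have "\<dots> = (\<integral>\<omega>. \<bar>S k (\<pi> n \<omega>) - A (\<pi> n \<omega>)\<bar> \<partial>M n) + (\<integral>\<omega>. \<bar>S l (\<pi> n \<omega>) - A (\<pi> n \<omega>)\<bar> \<partial>M n)"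
      by (intro Bochner_Integration.integral_add integrable_perm[OF elim(3), of "\<lambda>p. \<bar>S k p - A p\<bar>"]
          integrable_perm[OF elim(3), of "\<lambda>p. \<bar>S l p - A p\<bar>"])
    also have "\<dots> \<le> (1 / 2) ^ k + (1 / 2) ^ l"
      using elim(1,2) by (simp add: S_def A_def)
    also have "\<dots> \<le> 2 * (1 / 2) ^ k"
      using power_decreasing[OF kl, of "1 / 2 :: real"] by simp
    finally show ?case .
  qed
  with lim have "(\<integral>\<omega>. h (Zpath \<omega>) \<partial>N) \<le> 2 * (1 / 2) ^ k"
    by (intro tendsto_upperbound[where F = sequentially]) auto
  then show ?thesis by (simp add: h_def)
qed

text \<open>If one of the exponents is 0, the graph average does not depend on the permutation and is a Riemann sum.\<close>

lemma sample_marginal_expectation: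
  assumes ab: "a \<le> k" "b \<le> k" "a = 0 \<or> b = 0"
  shows "(\<integral>\<omega>. \<bar>sampled k (Zpath \<omega>) (monomial a b)
            - (\<integral>s. s ^ (a + b) \<partial>unit_lebesgue)\<bar> \<partial>N) \<le> 2 * (1 / 2) ^ k"
proof -
  define J where "J = T k ` {..<m k}"
  have J: "finite J" "J \<subseteq> {0<..1}" "\<And>i. i < m k \<Longrightarrow> T k i \<in> J"
    using T_unit by (auto simp: J_def)
  define c where "c = (\<integral>s. s ^ (a + b) \<partial>unit_lebesgue)"
  define h where "h x = \<bar>sampled k x (monomial a b) - c\<bar>" for x
  have "continuous_map (powertop_real J) euclideanreal h"
    unfolding h_def using J(3)
    by (intro continuous_map_real_abs continuous_map_diff continuous_map_sample_monomial) auto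
  from fdd_expectation_tendsto[OF J(1,2) this]
  have lim: "(\<lambda>n. \<integral>\<omega>. h (Ypath n \<omega>) \<partial>M n) \<longlonglongrightarrow> (\<integral>\<omega>. h (Zpath \<omega>) \<partial>N)"
    using J(3) by (simp add: h_def sample_average_restrict cong: if_cong)
  define G where "G n = graph_average n id (monomial (a + b) 0)" for n
  have G: "graph_average n p (monomial a b) = G n" if "p permutes {1..n}" for n p
    using ab(3) graph_average_monomial_swap[OF that, of b]
    by (auto simp: G_def graph_average_def monomial_def)
  have "G \<longlonglongrightarrow> c" unfolding G_def c_def by (rule graph_average_monomial_tendsto)
  from tendstoD[OF this, of "(1 / 2) ^ k"]
  have "\<forall>\<^sub>F n in sequentially. dist (G n) c < (1 / 2) ^ k" by simp
  with T_good[OF ab(1,2)] eventually_ge_at_top[of 1]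
  have "\<forall>\<^sub>F n in sequentially. (\<integral>\<omega>. h (Ypath n \<omega>) \<partial>M n) \<le> 2 * (1 / 2) ^ k"
  proof eventually_elim
    case (elim n)
    interpret prob_space "M n" by (rule prob_M[OF elim(2)])
    define A where "A p = graph_average n p (monomial a b)" for p
    define S where "S p = sampled k (perm_process n p) (monomial a b)" for p
    have "(\<integral>\<omega>. h (Ypath n \<omega>) \<partial>M n) \<le> (\<integral>\<omega>. \<bar>S (\<pi> n \<omega>) - A (\<pi> n \<omega>)\<bar> + (1 / 2) ^ k \<partial>M n)"
    proof (intro integral_mono integrable_perm[OF elim(2), of "\<lambda>p. h (perm_process n p)"]
          integrable_perm[OF elim(2), of "\<lambda>p. \<bar>S p - A p\<bar> + (1 / 2) ^ k"])
      fix \<omega> assume "\<omega> \<in> space (M n)"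
      then have "A (\<pi> n \<omega>) = G n" unfolding A_def by (intro G permutes elim(2))
      then show "h (Ypath n \<omega>) \<le> \<bar>S (\<pi> n \<omega>) - A (\<pi> n \<omega>)\<bar> + (1 / 2) ^ k"
        using elim(3) by (simp add: h_def S_def dist_real_def)
    qed
    also have "\<dots> = (\<integral>\<omega>. \<bar>S (\<pi> n \<omega>) - A (\<pi> n \<omega>)\<bar> \<partial>M n) + (1 / 2) ^ k"
      using integrable_perm[OF elim(2), of "\<lambda>p. \<bar>S p - A p\<bar>"] by (simp add: prob_space)
    also have "\<dots> \<le> 2 * (1 / 2) ^ k" using elim(1) by (simp add: S_def A_def)
    finally show ?case .
  qed
  with lim have "(\<integral>\<omega>. h (Zpath \<omega>) \<partial>N) \<le> 2 * (1 / 2) ^ k"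
    by (intro tendsto_upperbound[where F = sequentially]) auto
  then show ?thesis by (simp add: h_def c_def)
qed

end


section \<open>The limit permuton\<close>

context sampled_permutation_limit begin

text \<open>The expected differences of successive sampled averages decay geometrically, and so do the expected
distances from the moments of the uniform distribution.\<close>

lemma AE_sample_moments:
  "AE \<omega> in N. (\<forall>a b. convergent (\<lambda>k. sampled k (Zpath \<omega>) (monomial a b))) \<and>
     (\<forall>a. (\<lambda>k. sampled k (Zpath \<omega>) (monomial a 0)) \<longlonglongrightarrow> (\<integral>s. s ^ a \<partial>unit_lebesgue)) \<and>
     (\<forall>b. (\<lambda>k. sampled k (Zpath \<omega>) (monomial 0 b)) \<longlonglongrightarrow> (\<integral>s. s ^ b \<partial>unit_lebesgue))"
proof -
  interpret prob_space N by (rule prob_N)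
  have conv: "AE \<omega> in N. convergent (\<lambda>k. sampled k (Zpath \<omega>) (monomial a b))" for a b
  proof -
    define X where "X k \<omega> = sample_average (T (Suc k)) (m (Suc k)) (Zpath \<omega>) (monomial a b)
        - sampled k (Zpath \<omega>) (monomial a b)" for k \<omega>
    have "AE \<omega> in N. summable (\<lambda>k. \<bar>X k \<omega>\<bar>)"
    proof (rule AE_summable_of_geometric_expectation[where K = "max a b" and C = 2])
      show "integrable N (X k)" for k
        unfolding X_def by (intro Bochner_Integration.integrable_diff sample_Z_integrable)
      show "(\<integral>\<omega>. \<bar>X k \<omega>\<bar> \<partial>N) \<le> 2 * (1 / 2) ^ k" if "k \<ge> max a b" for k
        using sample_difference_expectation[of a k b "Suc k"] that
        by (simp add: X_def abs_minus_commute)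
    qed
    then show ?thesis
    proof eventually_elim
      case (elim \<omega>)
      have "convergent (\<lambda>n. \<Sum>k<n. X k \<omega>)"
        using summable_rabs_cancel[OF elim] by (simp add: summable_iff_convergent)
      then have "convergent (\<lambda>n. sample_average (T n) (m n) (Zpath \<omega>) (monomial a b)
          - sample_average (T 0) (m 0) (Zpath \<omega>) (monomial a b))"
        by (simp only: X_def sum_lessThan_telescope[of "\<lambda>k. sampled k (Zpath \<omega>) (monomial a b)"])
      then show ?case by (simp add: convergent_diff_const_right_iff)
    qed
  qed
  have lim: "AE \<omega> in N. (\<lambda>k. sampled k (Zpath \<omega>) (monomial a b)) \<longlonglongrightarrow> (\<integral>s. s ^ (a + b) \<partial>unit_lebesgue)"
    if ab: "a = 0 \<or> b = 0" for a b
  proof -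
    define X where "X k \<omega> = sampled k (Zpath \<omega>) (monomial a b) - (\<integral>s. s ^ (a + b) \<partial>unit_lebesgue)" for k \<omega>
    have "AE \<omega> in N. summable (\<lambda>k. \<bar>X k \<omega>\<bar>)"
    proof (rule AE_summable_of_geometric_expectation[where K = "max a b" and C = 2])
      show "integrable N (X k)" for k
        unfolding X_def by (intro Bochner_Integration.integrable_diff sample_Z_integrable) simp
      show "(\<integral>\<omega>. \<bar>X k \<omega>\<bar> \<partial>N) \<le> 2 * (1 / 2) ^ k" if "k \<ge> max a b" for k
        unfolding X_def using that ab by (intro sample_marginal_expectation) auto
    qed
    then show ?thesis
    proof eventually_elim
      case (elim \<omega>)
      have "(\<lambda>k. X k \<omega>) \<longlonglongrightarrow> 0"
        by (rule summable_LIMSEQ_zero[OF summable_rabs_cancel[OF elim]])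
      then show ?case unfolding X_def by (simp add: LIM_zero_iff)
    qed
  qed
  have "AE \<omega> in N. \<forall>a. (\<lambda>k. sampled k (Zpath \<omega>) (monomial a 0)) \<longlonglongrightarrow> (\<integral>s. s ^ a \<partial>unit_lebesgue)"
    using lim[of _ 0] by (simp add: AE_all_countable)
  moreover have "AE \<omega> in N. \<forall>b. (\<lambda>k. sampled k (Zpath \<omega>) (monomial 0 b)) \<longlonglongrightarrow> (\<integral>s. s ^ b \<partial>unit_lebesgue)"
    using lim[of 0] by (simp add: AE_all_countable)
  moreover have "AE \<omega> in N. \<forall>a b. convergent (\<lambda>k. sampled k (Zpath \<omega>) (monomial a b))"
    using conv by (simp add: AE_all_countable)
  ultimately show ?thesis by eventually_elim simp
qed

text \<open>The relation that singles out the limit permuton: the sampled points \<open>(t, Z t \<omega>)\<close> converge weakly to it.\<close>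

definition samples_converge_to :: "'b \<Rightarrow> (real \<times> real) measure \<Rightarrow> bool" where
  "samples_converge_to \<omega> \<mu> \<longleftrightarrow> (\<forall>f :: real \<times> real \<Rightarrow> real. continuous_on unit_square f \<longrightarrow>
     (\<lambda>k. sampled k (Zpath \<omega>) f) \<longlonglongrightarrow> (\<integral>w. f w \<partial>\<mu>))"

text \<open>Outside a null set the limit measure is chosen pointwise; its integrals are limits of measurable functions,
which makes the choice measurable. On the null set any fixed permuton will do, and one exists because the
complement of the null set is nonempty.\<close>

lemma limit_permuton_exists:
  "\<exists>\<mu>. random_permuton N \<mu> \<and> (AE \<omega> in N. samples_converge_to \<omega> (\<mu> \<omega>))"
proof -
  interpret prob_space N by (rule prob_N)
  have "AE \<omega> in N. \<exists>\<nu>\<in>permutons. samples_converge_to \<omega> \<nu>"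
    using AE_sample_moments AE_space
  proof eventually_elim
    case (elim \<omega>)
    show ?case unfolding samples_converge_to_def
      by (rule permuton_of_moment_limits) (use elim m_pos T_unit Z_unit in auto)
  qed
  then obtain E where E: "{\<omega> \<in> space N. \<not> (\<exists>\<nu>\<in>permutons. samples_converge_to \<omega> \<nu>)} \<subseteq> E"
    "emeasure N E = 0" "E \<in> sets N"
    by (rule AE_E)
  define G where "G = space N - E"
  have G[measurable]: "G \<in> sets N" using E(3) by (simp add: G_def)
  have AE_G: "AE \<omega> in N. \<omega> \<in> G"
    using E(2,3) by (auto simp: G_def intro!: AE_I[where N = E])
  have G_ex: "\<exists>\<nu>\<in>permutons. samples_converge_to \<omega> \<nu>" if "\<omega> \<in> G" for \<omega>
    using that E(1) by (auto simp: G_def)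
  have "G \<noteq> {}"
  proof
    assume "G = {}"
    then have "AE \<omega> in N. False" using AE_G by simp
    then show False by simp
  qed
  then obtain \<mu>0 where \<mu>0: "\<mu>0 \<in> permutons" using G_ex by blast
  obtain sel where sel: "\<And>\<omega>. \<omega> \<in> G \<Longrightarrow> sel \<omega> \<in> permutons \<and> samples_converge_to \<omega> (sel \<omega>)"
    using G_ex by metis
  define \<mu> where "\<mu> \<omega> = (if \<omega> \<in> G then sel \<omega> else \<mu>0)" for \<omega>
  have perm: "\<mu> \<omega> \<in> permutons" for \<omega>
    using sel \<mu>0 by (simp add: \<mu>_def)
  have "\<mu> \<in> N \<rightarrow>\<^sub>M prob_algebra borel_square"
  proof (rule random_measure_measurable)
    show "\<mu> \<omega> \<in> space (prob_algebra borel_square)" for \<omega>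
      using perm[of \<omega>] by (simp add: permutons_def)
    fix f :: "real \<times> real \<Rightarrow> real" assume f: "continuous_on unit_square f"
    define S where "S k \<omega> = (if \<omega> \<in> G then sampled k (Zpath \<omega>) f else (\<integral>w. f w \<partial>\<mu>0))" for k \<omega>
    show "(\<lambda>\<omega>. \<integral>w. f w \<partial>\<mu> \<omega>) \<in> borel_measurable N"
    proof (rule borel_measurable_LIMSEQ_real)
      show "(\<lambda>k. S k \<omega>) \<longlonglongrightarrow> (\<integral>w. f w \<partial>\<mu> \<omega>)" for \<omega>
        using sel[of \<omega>] f by (auto simp: S_def \<mu>_def samples_converge_to_def)
      fix k
      have "continuous_on {0..1} (\<lambda>y. f (T k l, y))" for l
        using T_unit[of k l] by (intro continuous_on_compose2[OF f] continuous_intros) (auto simp: less_imp_le)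
      then have "(\<lambda>\<omega>. sampled k (Zpath \<omega>) f) \<in> borel_measurable N"
        using T_unit by (rule sample_Z_measurable)
      then show "S k \<in> borel_measurable N"
        unfolding S_def using G by (intro measurable_If_set) auto
    qed
  qed
  then have "random_permuton N \<mu>"
    using perm prob_N by (simp add: random_permuton_def)
  moreover have "AE \<omega> in N. samples_converge_to \<omega> (\<mu> \<omega>)"
    using AE_G by eventually_elim (simp add: \<mu>_def sel)
  ultimately show ?thesis by blast
qed

end


section \<open>Approximation of finite dimensional distributions\<close>

text \<open>A form of uniform continuity that can be integrated: the error is linear in the distances of the
coordinates. For \<open>x \<noteq> y\<close> the gap \<open>\<bar>\<phi> x - \<phi> y\<bar> - n * (distance)\<close> becomes negative for large \<open>n\<close>, and on the
diagonal it is 0. So the open sets where it is less than \<open>\<epsilon>\<close> cover the square of the cube, and they increase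
with \<open>n\<close>; by compactness one of them is everything.\<close>

lemma affine_modulus_on_cube:
  assumes J: "finite J"
    and \<phi>: "continuous_map (powertop_real J) euclideanreal \<phi>"
    and \<epsilon>: "\<epsilon> > 0"
  shows "\<exists>L\<ge>0. \<forall>x\<in>PiE J (\<lambda>_. {- c..c}). \<forall>y\<in>PiE J (\<lambda>_. {- c..c}).
           \<bar>\<phi> x - \<phi> y\<bar> \<le> \<epsilon> + L * (\<Sum>j\<in>J. \<bar>x j - y j\<bar>)"
proof -
  let ?T = "powertop_real J"
  let ?K = "PiE J (\<lambda>_. {- c..c}) \<times> PiE J (\<lambda>_. {- c..c})"
  define gap where "gap n w = \<bar>\<phi> (fst w) - \<phi> (snd w)\<bar> - real n * (\<Sum>j\<in>J. \<bar>fst w j - snd w j\<bar>)"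
    for n :: nat and w
  define V where "V n = {w \<in> topspace (prod_topology ?T ?T). gap n w \<in> {..<\<epsilon>}}" for n
  have "compactin ?T (PiE J (\<lambda>_. {- c..c}))" by (simp add: compactin_PiE)
  then have K: "compactin (prod_topology ?T ?T) ?K" by (simp add: compactin_Times)
  have "continuous_map (prod_topology ?T ?T) euclideanreal (gap n)" for n
  proof -
    have "continuous_map (prod_topology ?T ?T) euclideanreal (\<lambda>w. \<phi> (fst w))"
      "continuous_map (prod_topology ?T ?T) euclideanreal (\<lambda>w. \<phi> (snd w))"
      using continuous_map_compose[OF continuous_map_fst \<phi>] continuous_map_compose[OF continuous_map_snd \<phi>]
      by (auto simp: comp_def)
    moreover have "continuous_map (prod_topology ?T ?T) euclideanreal (\<lambda>w. fst w j)"
      "continuous_map (prod_topology ?T ?T) euclideanreal (\<lambda>w. snd w j)" if "j \<in> J" for j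
      using continuous_map_compose[OF continuous_map_fst continuous_map_product_projection[OF that]]
        continuous_map_compose[OF continuous_map_snd continuous_map_product_projection[OF that]]
      by (auto simp: comp_def)
    ultimately show ?thesis
      unfolding gap_def using J
      by (intro continuous_map_diff continuous_map_real_abs continuous_map_real_mult continuous_map_sum) auto
  qed
  then have V_open: "openin (prod_topology ?T ?T) (V n)" for n
    unfolding V_def by (rule openin_continuous_map_preimage) (simp add: open_openin[symmetric])
  have V_cover: "?K \<subseteq> \<Union> (range V)"
  proof
    fix w assume w: "w \<in> ?K"
    then have top: "w \<in> topspace (prod_topology ?T ?T)" by (auto simp: PiE_iff)
    define S where "S = (\<Sum>j\<in>J. \<bar>fst w j - snd w j\<bar>)"
    show "w \<in> \<Union> (range V)"
    proof (cases "S = 0")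
      case True
      then have "\<forall>j\<in>J. fst w j = snd w j" using J by (simp add: S_def sum_nonneg_eq_0_iff)
      then have "fst w = snd w" using w by (intro PiE_ext[where k = J]) auto
      then have "gap 0 w = 0" by (simp add: gap_def)
      then have "w \<in> V 0" using top \<epsilon> by (simp add: V_def)
      then show ?thesis by blast
    next
      case False
      moreover have "0 \<le> S" unfolding S_def by (intro sum_nonneg) simp
      ultimately have "S > 0" by simp
      obtain n :: nat where "\<bar>\<phi> (fst w) - \<phi> (snd w)\<bar> / S < real n" using reals_Archimedean2 by blast
      then have "gap n w < \<epsilon>" using \<open>S > 0\<close> \<epsilon> by (simp add: gap_def S_def[symmetric] field_simps)
      then show ?thesis using top by (auto simp: V_def)
    qed
  qed
  obtain F where F: "finite F" "?K \<subseteq> \<Union> (V ` F)"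
  proof -
    have "\<exists>\<F>. finite \<F> \<and> \<F> \<subseteq> range V \<and> ?K \<subseteq> \<Union> \<F>"
      using conjunct2[OF K[unfolded compactin_def], rule_format, of "range V"] V_open V_cover by auto
    then show ?thesis using that by (metis finite_subset_image)
  qed
  define n where "n = Max (insert 0 F)"
  have "\<bar>\<phi> x - \<phi> y\<bar> \<le> \<epsilon> + real n * (\<Sum>j\<in>J. \<bar>x j - y j\<bar>)"
    if "x \<in> PiE J (\<lambda>_. {- c..c})" "y \<in> PiE J (\<lambda>_. {- c..c})" for x y
  proof -
    have "(x, y) \<in> \<Union> (V ` F)" using that F(2) by blast
    then obtain i where i: "i \<in> F" "(x, y) \<in> V i" by blast
    then have "i \<le> n" using F(1) by (simp add: n_def)
    then have "real i * (\<Sum>j\<in>J. \<bar>x j - y j\<bar>) \<le> real n * (\<Sum>j\<in>J. \<bar>x j - y j\<bar>)"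
      by (intro mult_right_mono sum_nonneg) auto
    then show ?thesis using i(2) by (auto simp: V_def gap_def)
  qed
  then show ?thesis by (intro exI[of _ "real n"]) auto
qed

text \<open>Vectors indexed by the finite set \<open>J\<close> are rewritten as sequences, since on sequences the Borel sets of the
product topology are known to be generated by the coordinates.\<close>

lemma continuous_function_of_vector_measurable:
  assumes J: "finite J"
    and \<phi>: "continuous_map (powertop_real J) euclideanreal \<phi>"
    and X: "\<And>t. t \<in> J \<Longrightarrow> X t \<in> borel_measurable N"
  shows "(\<lambda>\<omega>. \<phi> (\<lambda>t\<in>J. X t \<omega>)) \<in> borel_measurable N"
proof -
  obtain idx :: "'a \<Rightarrow> nat" where idx: "inj_on idx J"
    using finite_imp_inj_to_nat_seg[OF J] by blast
  define \<Psi> where "\<Psi> u = (\<lambda>t\<in>J. u (idx t))" for u :: "nat \<Rightarrow> real"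
  have "continuous_map euclidean (powertop_real J) \<Psi>"
    unfolding continuous_map_componentwise \<Psi>_def by auto
  from continuous_map_compose[OF this \<phi>] have "continuous_on UNIV (\<phi> \<circ> \<Psi>)"
    by simp
  then have \<phi>\<Psi>: "(\<phi> \<circ> \<Psi>) \<in> borel_measurable borel" by (rule borel_measurable_continuous_onI)
  define Y where "Y \<omega> i = (if i \<in> idx ` J then X (the_inv_into J idx i) \<omega> else 0)" for \<omega> and i :: nat
  have "Y \<in> borel_measurable N"
  proof (rule measurable_coordinatewise_then_product)
    fix i
    show "(\<lambda>\<omega>. Y \<omega> i) \<in> borel_measurable N"
    proof (cases "i \<in> idx ` J")
      case True
      then have "the_inv_into J idx i \<in> J" using the_inv_into_into[OF idx] by blast
      then show ?thesis using X True by (simp add: Y_def)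
    qed (simp add: Y_def)
  qed
  from measurable_compose[OF this \<phi>\<Psi>]
  have "(\<lambda>\<omega>. \<phi> (\<Psi> (Y \<omega>))) \<in> borel_measurable N" by simp
  moreover have "\<Psi> (Y \<omega>) = (\<lambda>t\<in>J. X t \<omega>)" for \<omega>
    using the_inv_into_f_f[OF idx] by (auto simp: \<Psi>_def Y_def)
  ultimately show ?thesis by simp
qed

lemma expectation_difference_le:
  assumes N: "prob_space N" and J: "finite J"
    and \<phi>: "continuous_map (powertop_real J) euclideanreal \<phi>"
    and modulus: "\<forall>x\<in>PiE J (\<lambda>_. {- c..c}). \<forall>y\<in>PiE J (\<lambda>_. {- c..c}).
           \<bar>\<phi> x - \<phi> y\<bar> \<le> \<epsilon> + L * (\<Sum>j\<in>J. \<bar>x j - y j\<bar>)"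
    and X: "\<And>t. t \<in> J \<Longrightarrow> X t \<in> borel_measurable N" "\<And>t \<omega>. t \<in> J \<Longrightarrow> \<omega> \<in> space N \<Longrightarrow> \<bar>X t \<omega>\<bar> \<le> c"
    and Y: "\<And>t. t \<in> J \<Longrightarrow> Y t \<in> borel_measurable N" "\<And>t \<omega>. t \<in> J \<Longrightarrow> \<omega> \<in> space N \<Longrightarrow> \<bar>Y t \<omega>\<bar> \<le> c"
  shows "\<bar>(\<integral>\<omega>. \<phi> (\<lambda>t\<in>J. X t \<omega>) \<partial>N) - (\<integral>\<omega>. \<phi> (\<lambda>t\<in>J. Y t \<omega>) \<partial>N)\<bar>
           \<le> \<epsilon> + L * (\<Sum>t\<in>J. \<integral>\<omega>. \<bar>X t \<omega> - Y t \<omega>\<bar> \<partial>N)"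
proof -
  interpret prob_space N by fact
  have "compactin (powertop_real J) (PiE J (\<lambda>_. {- c..c}))"
    by (simp add: compactin_PiE)
  from image_compactin[OF this \<phi>] have "bounded (\<phi> ` PiE J (\<lambda>_. {- c..c}))"
    by (simp add: compact_imp_bounded)
  then obtain B where B: "\<And>x. x \<in> PiE J (\<lambda>_. {- c..c}) \<Longrightarrow> norm (\<phi> x) \<le> B"
    unfolding bounded_iff by blast
  have in_cube: "(\<lambda>t\<in>J. X t \<omega>) \<in> PiE J (\<lambda>_. {- c..c})" "(\<lambda>t\<in>J. Y t \<omega>) \<in> PiE J (\<lambda>_. {- c..c})"
    if "\<omega> \<in> space N" for \<omega>
  proof -
    have "x \<in> {- c..c}" if "\<bar>x\<bar> \<le> c" for x :: real
      unfolding atLeastAtMost_iff using that by linarith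
    then show "(\<lambda>t\<in>J. X t \<omega>) \<in> PiE J (\<lambda>_. {- c..c})" "(\<lambda>t\<in>J. Y t \<omega>) \<in> PiE J (\<lambda>_. {- c..c})"
      using X(2) Y(2) that by auto
  qed
  have int: "integrable N (\<lambda>\<omega>. \<phi> (\<lambda>t\<in>J. X t \<omega>))" "integrable N (\<lambda>\<omega>. \<phi> (\<lambda>t\<in>J. Y t \<omega>))"
    using continuous_function_of_vector_measurable[OF J \<phi> X(1)]
      continuous_function_of_vector_measurable[OF J \<phi> Y(1)] B[OF in_cube(1)] B[OF in_cube(2)]
    by (auto intro!: integrable_const_bound[where B = B] AE_I2)
  have int_diff: "integrable N (\<lambda>\<omega>. \<bar>X t \<omega> - Y t \<omega>\<bar>)" if "t \<in> J" for t
  proof (rule integrable_const_bound[where B = "2 * c"])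
    show "(\<lambda>\<omega>. \<bar>X t \<omega> - Y t \<omega>\<bar>) \<in> borel_measurable N"
      using X(1)[OF that] Y(1)[OF that] by measurable
    show "AE \<omega> in N. norm \<bar>X t \<omega> - Y t \<omega>\<bar> \<le> 2 * c"
    proof (rule AE_I2)
      fix \<omega> assume "\<omega> \<in> space N"
      from X(2)[OF that this] Y(2)[OF that this] show "norm \<bar>X t \<omega> - Y t \<omega>\<bar> \<le> 2 * c"
        unfolding real_norm_def by linarith
    qed
  qed
  have "\<bar>(\<integral>\<omega>. \<phi> (\<lambda>t\<in>J. X t \<omega>) \<partial>N) - (\<integral>\<omega>. \<phi> (\<lambda>t\<in>J. Y t \<omega>) \<partial>N)\<bar> =
      \<bar>\<integral>\<omega>. \<phi> (\<lambda>t\<in>J. X t \<omega>) - \<phi> (\<lambda>t\<in>J. Y t \<omega>) \<partial>N\<bar>"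
    using int by simp
  also have "\<dots> \<le> (\<integral>\<omega>. \<bar>\<phi> (\<lambda>t\<in>J. X t \<omega>) - \<phi> (\<lambda>t\<in>J. Y t \<omega>)\<bar> \<partial>N)"
    by (rule integral_abs_bound)
  also have "\<dots> \<le> (\<integral>\<omega>. \<epsilon> + L * (\<Sum>t\<in>J. \<bar>X t \<omega> - Y t \<omega>\<bar>) \<partial>N)"
  proof (rule integral_mono)
    fix \<omega> assume "\<omega> \<in> space N"
    from bspec[OF bspec[OF modulus in_cube(1)[OF this]] in_cube(2)[OF this]]
    show "\<bar>\<phi> (\<lambda>t\<in>J. X t \<omega>) - \<phi> (\<lambda>t\<in>J. Y t \<omega>)\<bar> \<le> \<epsilon> + L * (\<Sum>t\<in>J. \<bar>X t \<omega> - Y t \<omega>\<bar>)"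
      by (simp cong: sum.cong)
  qed (use int int_diff in auto)
  also have "\<dots> = \<epsilon> + L * (\<Sum>t\<in>J. \<integral>\<omega>. \<bar>X t \<omega> - Y t \<omega>\<bar> \<partial>N)"
    using int_diff by (simp add: prob_space)
  finally show ?thesis .
qed

text \<open>Convergence in distribution passes through approximations: if \<open>X'\<close> is close to \<open>X\<close> for large \<open>n\<close>, its limit
\<open>D'\<close> is close to \<open>D\<close>, and \<open>X'\<close> converges to \<open>D'\<close> for each \<open>k\<close>, then \<open>X\<close> converges to \<open>D\<close>. Closeness is in
mean and for each time separately, which suffices by the affine modulus of continuity.\<close>

lemma expectation_tendsto_by_approximation:
  assumes M: "\<And>n. n \<ge> 1 \<Longrightarrow> prob_space (M n)" and N: "prob_space N" and J: "finite J"
    and \<phi>: "continuous_map (powertop_real J) euclideanreal \<phi>"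
    and X: "\<And>n t. n \<ge> 1 \<Longrightarrow> t \<in> J \<Longrightarrow> X n t \<in> borel_measurable (M n)"
      "\<And>n t \<omega>. n \<ge> 1 \<Longrightarrow> t \<in> J \<Longrightarrow> \<omega> \<in> space (M n) \<Longrightarrow> \<bar>X n t \<omega>\<bar> \<le> c"
    and X': "\<And>k n t. n \<ge> 1 \<Longrightarrow> t \<in> J \<Longrightarrow> X' k n t \<in> borel_measurable (M n)"
      "\<And>k n t \<omega>. n \<ge> 1 \<Longrightarrow> t \<in> J \<Longrightarrow> \<omega> \<in> space (M n) \<Longrightarrow> \<bar>X' k n t \<omega>\<bar> \<le> c"
    and D: "\<And>t. t \<in> J \<Longrightarrow> D t \<in> borel_measurable N" "\<And>t \<omega>. t \<in> J \<Longrightarrow> \<omega> \<in> space N \<Longrightarrow> \<bar>D t \<omega>\<bar> \<le> c"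
    and D': "\<And>k t. t \<in> J \<Longrightarrow> D' k t \<in> borel_measurable N"
      "\<And>k t \<omega>. t \<in> J \<Longrightarrow> \<omega> \<in> space N \<Longrightarrow> \<bar>D' k t \<omega>\<bar> \<le> c"
    and approx: "\<And>k. (\<lambda>n. \<integral>\<omega>. \<phi> (\<lambda>t\<in>J. X' k n t \<omega>) \<partial>M n) \<longlonglongrightarrow> (\<integral>\<omega>. \<phi> (\<lambda>t\<in>J. D' k t \<omega>) \<partial>N)"
    and close_n: "\<And>t e. t \<in> J \<Longrightarrow> e > 0 \<Longrightarrow>
      \<forall>\<^sub>F k in sequentially. \<forall>\<^sub>F n in sequentially. (\<integral>\<omega>. \<bar>X' k n t \<omega> - X n t \<omega>\<bar> \<partial>M n) \<le> e"
    and close_lim: "\<And>t. t \<in> J \<Longrightarrow> (\<lambda>k. \<integral>\<omega>. \<bar>D' k t \<omega> - D t \<omega>\<bar> \<partial>N) \<longlonglongrightarrow> 0"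
  shows "(\<lambda>n. \<integral>\<omega>. \<phi> (\<lambda>t\<in>J. X n t \<omega>) \<partial>M n) \<longlonglongrightarrow> (\<integral>\<omega>. \<phi> (\<lambda>t\<in>J. D t \<omega>) \<partial>N)"
proof (rule tendstoI)
  fix \<epsilon> :: real assume \<epsilon>: "\<epsilon> > 0"
  obtain L where L: "L \<ge> 0" "\<forall>x\<in>PiE J (\<lambda>_. {- c..c}). \<forall>y\<in>PiE J (\<lambda>_. {- c..c}).
           \<bar>\<phi> x - \<phi> y\<bar> \<le> \<epsilon> / 8 + L * (\<Sum>j\<in>J. \<bar>x j - y j\<bar>)"
    using affine_modulus_on_cube[OF J \<phi>, of "\<epsilon> / 8" c] \<epsilon> by auto
  \<comment> \<open>This \<open>e\<close> gives \<open>\<epsilon> / 8 + L * (card J * e) \<le> \<epsilon> / 4\<close>; adding 1 avoids dividing by zero.\<close>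
  define e where "e = \<epsilon> / (8 * (L + 1) * (real (card J) + 1))"
  have e: "e > 0" using \<epsilon> L(1) by (simp add: e_def)
  have small: "\<epsilon> / 8 + L * S \<le> \<epsilon> / 4" if "S \<le> real (card J) * e" for S
  proof -
    have "L * S \<le> L * (real (card J) * e)" using that L(1) by (rule mult_left_mono)
    also have "\<dots> \<le> (L + 1) * ((real (card J) + 1) * e)"
      using L(1) e by (intro mult_mono) auto
    also have "\<dots> = \<epsilon> / 8"
    proof -
      have "a * (b * (\<epsilon> / (8 * a * b))) = \<epsilon> / 8" if "a \<noteq> 0" "b \<noteq> 0" for a b
        using that by (simp add: field_simps)
      moreover have "L + 1 \<noteq> 0" "real (card J) + 1 \<noteq> 0" using L(1) by auto
      ultimately show ?thesis unfolding e_def by blast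
    qed
    finally show ?thesis by simp
  qed
  have "\<forall>\<^sub>F k in sequentially. \<forall>t\<in>J. \<forall>\<^sub>F n in sequentially. (\<integral>\<omega>. \<bar>X' k n t \<omega> - X n t \<omega>\<bar> \<partial>M n) \<le> e"
    using close_n e J by (intro eventually_ball_finite) auto
  moreover have "\<forall>\<^sub>F k in sequentially. \<forall>t\<in>J. (\<integral>\<omega>. \<bar>D' k t \<omega> - D t \<omega>\<bar> \<partial>N) < e"
    using order_tendstoD(2)[OF close_lim e] J by (intro eventually_ball_finite) auto
  ultimately have "\<forall>\<^sub>F k in sequentially. (\<forall>t\<in>J. \<forall>\<^sub>F n in sequentially. (\<integral>\<omega>. \<bar>X' k n t \<omega> - X n t \<omega>\<bar> \<partial>M n) \<le> e)
      \<and> (\<forall>t\<in>J. (\<integral>\<omega>. \<bar>D' k t \<omega> - D t \<omega>\<bar> \<partial>N) < e)"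
    by (rule eventually_conj)
  from eventually_happens'[OF sequentially_bot this]
  obtain k where k: "\<And>t. t \<in> J \<Longrightarrow> \<forall>\<^sub>F n in sequentially. (\<integral>\<omega>. \<bar>X' k n t \<omega> - X n t \<omega>\<bar> \<partial>M n) \<le> e"
    "\<And>t. t \<in> J \<Longrightarrow> (\<integral>\<omega>. \<bar>D' k t \<omega> - D t \<omega>\<bar> \<partial>N) < e"
    by auto
  have "(\<Sum>t\<in>J. \<integral>\<omega>. \<bar>D' k t \<omega> - D t \<omega>\<bar> \<partial>N) \<le> real (card J) * e"
    using k(2) by (intro sum_bounded_above) (auto intro: less_imp_le)
  note sum_lim = this
  have "\<bar>(\<integral>\<omega>. \<phi> (\<lambda>t\<in>J. D' k t \<omega>) \<partial>N) - (\<integral>\<omega>. \<phi> (\<lambda>t\<in>J. D t \<omega>) \<partial>N)\<bar> \<le>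
      \<epsilon> / 8 + L * (\<Sum>t\<in>J. \<integral>\<omega>. \<bar>D' k t \<omega> - D t \<omega>\<bar> \<partial>N)"
    by (intro expectation_difference_le[OF N J \<phi> L(2)] D D')
  also note small[OF sum_lim]
  finally have lim_close: "\<bar>(\<integral>\<omega>. \<phi> (\<lambda>t\<in>J. D' k t \<omega>) \<partial>N) - (\<integral>\<omega>. \<phi> (\<lambda>t\<in>J. D t \<omega>) \<partial>N)\<bar> \<le> \<epsilon> / 4"
    .
  have "\<forall>\<^sub>F n in sequentially. \<forall>t\<in>J. (\<integral>\<omega>. \<bar>X' k n t \<omega> - X n t \<omega>\<bar> \<partial>M n) \<le> e"
    using k(1) J by (intro eventually_ball_finite) auto
  moreover have "\<forall>\<^sub>F n in sequentially. dist (\<integral>\<omega>. \<phi> (\<lambda>t\<in>J. X' k n t \<omega>) \<partial>M n) (\<integral>\<omega>. \<phi> (\<lambda>t\<in>J. D' k t \<omega>) \<partial>N) < \<epsilon> / 4"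
    using approx \<epsilon> by (intro tendstoD) auto
  ultimately show "\<forall>\<^sub>F n in sequentially. dist (\<integral>\<omega>. \<phi> (\<lambda>t\<in>J. X n t \<omega>) \<partial>M n) (\<integral>\<omega>. \<phi> (\<lambda>t\<in>J. D t \<omega>) \<partial>N) < \<epsilon>"
    using eventually_ge_at_top[of 1]
  proof eventually_elim
    case (elim n)
    have "(\<Sum>t\<in>J. \<integral>\<omega>. \<bar>X' k n t \<omega> - X n t \<omega>\<bar> \<partial>M n) \<le> real (card J) * e"
      using elim(1) by (intro sum_bounded_above) auto
    note sum_n = this
    have "\<bar>(\<integral>\<omega>. \<phi> (\<lambda>t\<in>J. X' k n t \<omega>) \<partial>M n) - (\<integral>\<omega>. \<phi> (\<lambda>t\<in>J. X n t \<omega>) \<partial>M n)\<bar> \<le>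
        \<epsilon> / 8 + L * (\<Sum>t\<in>J. \<integral>\<omega>. \<bar>X' k n t \<omega> - X n t \<omega>\<bar> \<partial>M n)"
      using X[OF elim(3)] X'[OF elim(3)] by (intro expectation_difference_le[OF M[OF elim(3)] J \<phi> L(2)])
    also note small[OF sum_n]
    finally show ?case
      using lim_close elim(2) \<epsilon> unfolding dist_real_def by linarith
  qed
qed


section \<open>Joint convergence of values and graph averages\<close>

text \<open>The image of the kernel under \<open>f \<omega>\<close> is a kernel on the reals, whose mean is measurable in \<open>\<omega>\<close>.\<close>

lemma kernel_integral_measurable:
  fixes f :: "'b \<Rightarrow> 'c \<Rightarrow> real"
  assumes f: "(\<lambda>(\<omega>, w). f \<omega> w) \<in> borel_measurable (N \<Otimes>\<^sub>M S)" and K: "K \<in> N \<rightarrow>\<^sub>M prob_algebra S"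
  shows "(\<lambda>\<omega>. \<integral>w. f \<omega> w \<partial>K \<omega>) \<in> borel_measurable N"
proof -
  have K': "K \<in> N \<rightarrow>\<^sub>M subprob_algebra S" using K by (rule measurable_prob_algebraD)
  have "(\<lambda>\<omega>. distr (K \<omega>) borel (f \<omega>)) \<in> N \<rightarrow>\<^sub>M subprob_algebra borel"
    by (rule measurable_distr2[OF f K'])
  then have "(\<lambda>\<omega>. \<integral>x. x \<partial>distr (K \<omega>) borel (f \<omega>)) \<in> borel_measurable N"
    by (rule measurable_compose) (rule integral_measurable_subprob_algebra, simp)
  moreover have "(\<integral>x. x \<partial>distr (K \<omega>) borel (f \<omega>)) = (\<integral>w. f \<omega> w \<partial>K \<omega>)" if \<omega>: "\<omega> \<in> space N" for \<omega>
  proof -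
    have "sets (K \<omega>) = sets S" using sets_kernel[OF K' \<omega>] .
    moreover have "f \<omega> \<in> borel_measurable S"
      using measurable_compose[OF measurable_Pair1'[OF \<omega>] f] by simp
    ultimately have "f \<omega> \<in> borel_measurable (K \<omega>)" by (simp cong: measurable_cong_sets)
    then show ?thesis by (subst integral_distr) auto
  qed
  ultimately show ?thesis by (simp cong: measurable_cong)
qed

lemma measurable_test_function:
  fixes g :: "(real \<times> real) \<times> real \<Rightarrow> real"
  assumes g: "continuous_on UNIV g" and V: "V \<in> borel_measurable N"
  shows "(\<lambda>(\<omega>, w). g (w, V \<omega>)) \<in> borel_measurable (N \<Otimes>\<^sub>M borel_square)"
proof -
  have "(\<lambda>w. w) \<in> borel_square \<rightarrow>\<^sub>M borel" by (intro measurable_restrict_space1) simp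
  then have "(\<lambda>x. snd x) \<in> N \<Otimes>\<^sub>M borel_square \<rightarrow>\<^sub>M borel"
    by (rule measurable_compose[OF measurable_snd])
  moreover have "(\<lambda>x. V (fst x)) \<in> N \<Otimes>\<^sub>M borel_square \<rightarrow>\<^sub>M borel"
    using V by (rule measurable_compose[OF measurable_fst])
  ultimately have "(\<lambda>x. (snd x, V (fst x))) \<in> N \<Otimes>\<^sub>M borel_square \<rightarrow>\<^sub>M borel"
    by (rule borel_measurable_Pair)
  from measurable_compose[OF this borel_measurable_continuous_onI[OF g]]
  show ?thesis by (simp add: case_prod_unfold)
qed

lemma graph_point_in_square:
  assumes "p permutes {1..n}" "i \<in> {1..n}"
  shows "(real i / real n, real (p i) / real n) \<in> unit_square"
proof -
  have "p i \<in> {1..n}" using permutes_in_image[OF assms(1)] assms(2) by blast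
  then show ?thesis using assms(2) by auto
qed

lemma continuous_map_sample_test:
  assumes g: "continuous_on UNIV (g :: (real \<times> real) \<times> real \<Rightarrow> real)" and "t \<in> J" "\<And>l. l < q \<Longrightarrow> \<tau> l \<in> J"
  shows "continuous_map (powertop_real J) euclideanreal
    (\<lambda>x. sample_average \<tau> q x (\<lambda>w. g (w, x t)))"
proof -
  let ?P = "powertop_real J"
  have "continuous_map ?P euclideanreal (\<lambda>x. g ((\<tau> l, x (\<tau> l)), x t))" if "l < q" for l
  proof -
    have "continuous_map ?P (prod_topology (prod_topology euclideanreal euclideanreal) euclideanreal)
        (\<lambda>x. ((\<tau> l, x (\<tau> l)), x t))"
      using assms(2) assms(3)[OF that]
      by (intro continuous_map_pairedI continuous_map_product_projection) auto
    then have "continuous_map ?P euclidean (\<lambda>x. ((\<tau> l, x (\<tau> l)), x t))" by simp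
    from continuous_map_compose[OF this, of euclideanreal g] g show ?thesis by (simp add: comp_def)
  qed
  then show ?thesis
    unfolding sample_average_def divide_inverse
    by (intro continuous_map_real_mult continuous_map_sum) auto
qed

context sampled_permutation_limit begin

text \<open>The estimate for single monomials extends to polynomials whose last variable takes the random value
\<open>Y t\<close>: its powers are bounded by 1 and factor out of both averages.\<close>

lemma polynomial_sample_error:
  assumes t: "t \<in> {0<..1}" and k: "\<forall>(c, a, b, d)\<in>set xs. a \<le> k \<and> b \<le> k"
  shows "\<forall>\<^sub>F n in sequentially. (\<integral>\<omega>. \<bar>poly3_moment (\<lambda>a b. sampled k (Ypath n \<omega>) (monomial a b)) xs (Ypath n \<omega> t)
      - poly3_moment (\<lambda>a b. graph_average n (\<pi> n \<omega>) (monomial a b)) xs (Ypath n \<omega> t)\<bar> \<partial>M n)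
      \<le> (\<Sum>x\<leftarrow>xs. \<bar>fst x\<bar>) * (1 / 2) ^ k"
  using k
proof (induction xs)
  case Nil
  show ?case by (simp add: poly3_moment_simps)
next
  case (Cons x xs)
  obtain c a b d where x: "x = (c, a, b, d)" by (cases x) auto
  have ab: "a \<le> k" "b \<le> k" and IH: "\<forall>\<^sub>F n in sequentially. (\<integral>\<omega>. \<bar>poly3_moment (\<lambda>a b. sampled k (Ypath n \<omega>) (monomial a b)) xs (Ypath n \<omega> t)
      - poly3_moment (\<lambda>a b. graph_average n (\<pi> n \<omega>) (monomial a b)) xs (Ypath n \<omega> t)\<bar> \<partial>M n)
      \<le> (\<Sum>x\<leftarrow>xs. \<bar>fst x\<bar>) * (1 / 2) ^ k"
    using Cons by (auto simp: x)
  show ?case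
    using IH T_good[OF ab] eventually_ge_at_top[of 1]
  proof eventually_elim
    case (elim n)
    define S where "S p a b = sampled k (perm_process n p) (monomial a b)" for p a b
    define A where "A p a b = graph_average n p (monomial a b)" for p a b
    define v where "v p = perm_process n p t" for p
    define R where "R xs p = \<bar>poly3_moment (S p) xs (v p) - poly3_moment (A p) xs (v p)\<bar>" for xs p
    have "(\<integral>\<omega>. R (x # xs) (\<pi> n \<omega>) \<partial>M n) \<le> (\<integral>\<omega>. \<bar>c\<bar> * \<bar>S (\<pi> n \<omega>) a b - A (\<pi> n \<omega>) a b\<bar> + R xs (\<pi> n \<omega>) \<partial>M n)"
    proof (intro integral_mono integrable_perm[OF elim(3), of "R (x # xs)"]
        integrable_perm[OF elim(3), of "\<lambda>p. \<bar>c\<bar> * \<bar>S p a b - A p a b\<bar> + R xs p"])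
      fix \<omega> assume "\<omega> \<in> space (M n)"
      then have "v (\<pi> n \<omega>) \<in> {0..1}" unfolding v_def by (intro perm_process_unit permutes elim(3) t)
      then have "\<bar>v (\<pi> n \<omega>) ^ d\<bar> \<le> 1" by (simp add: power_le_one)
      then have "\<bar>c * (S (\<pi> n \<omega>) a b - A (\<pi> n \<omega>) a b) * v (\<pi> n \<omega>) ^ d\<bar> \<le> \<bar>c\<bar> * \<bar>S (\<pi> n \<omega>) a b - A (\<pi> n \<omega>) a b\<bar>"
        unfolding abs_mult by (intro mult_right_le_one_le) auto
      moreover have "R (x # xs) (\<pi> n \<omega>) \<le> \<bar>c * (S (\<pi> n \<omega>) a b - A (\<pi> n \<omega>) a b) * v (\<pi> n \<omega>) ^ d\<bar> + R xs (\<pi> n \<omega>)"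
        unfolding R_def x poly3_moment_simps right_diff_distrib left_diff_distrib by linarith
      ultimately show "R (x # xs) (\<pi> n \<omega>) \<le> \<bar>c\<bar> * \<bar>S (\<pi> n \<omega>) a b - A (\<pi> n \<omega>) a b\<bar> + R xs (\<pi> n \<omega>)"
        by linarith
    qed
    also have "\<dots> = \<bar>c\<bar> * (\<integral>\<omega>. \<bar>S (\<pi> n \<omega>) a b - A (\<pi> n \<omega>) a b\<bar> \<partial>M n) + (\<integral>\<omega>. R xs (\<pi> n \<omega>) \<partial>M n)"
      using integrable_perm[OF elim(3), of "\<lambda>p. \<bar>S p a b - A p a b\<bar>"] integrable_perm[OF elim(3), of "R xs"] by simp
    also have "\<dots> \<le> \<bar>c\<bar> * (1 / 2) ^ k + (\<Sum>x\<leftarrow>xs. \<bar>fst x\<bar>) * (1 / 2) ^ k"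
      using elim(1,2) by (intro add_mono mult_left_mono) (simp_all add: S_def[abs_def] A_def[abs_def] R_def v_def)
    finally show ?case
      by (simp add: R_def S_def[abs_def] A_def[abs_def] v_def x distrib_right)
  qed
qed

text \<open>The sampled averages serve as the approximations. For large \<open>n\<close> they are close to the graph averages
because \<open>g t\<close> is uniformly close to a polynomial on the cube; uniformity in the last variable takes care of
the random argument \<open>Y t\<close>. In the limit they converge to the integrals against \<open>\<mu>\<close> for almost every \<open>\<omega>\<close>,
as \<open>Z t \<omega>\<close> is then just a number.\<close>

theorem joint_convergence:
  assumes \<mu>: "random_permuton N \<mu>" and conv_\<mu>: "AE \<omega> in N. samples_converge_to \<omega> (\<mu> \<omega>)"
    and J: "finite J" "J \<subseteq> {0<..1}"
    and g: "\<And>t. t \<in> J \<Longrightarrow> continuous_on UNIV (g t :: (real \<times> real) \<times> real \<Rightarrow> real)"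
    and \<phi>: "continuous_map (powertop_real J) euclideanreal \<phi>"
  shows "(\<lambda>n. \<integral>\<omega>. \<phi> (\<lambda>t\<in>J. graph_average n (\<pi> n \<omega>) (\<lambda>w. g t (w, Ypath n \<omega> t))) \<partial>M n)
    \<longlonglongrightarrow> (\<integral>\<omega>. \<phi> (\<lambda>t\<in>J. \<integral>w. g t (w, Z t \<omega>) \<partial>\<mu> \<omega>) \<partial>N)"
proof -
  interpret prob_space N by (rule prob_N)
  have \<mu>_meas: "\<mu> \<in> N \<rightarrow>\<^sub>M prob_algebra borel_square"
    and \<mu>_space: "\<And>\<omega>. \<omega> \<in> space N \<Longrightarrow> \<mu> \<omega> \<in> space (prob_algebra borel_square)"
    using \<mu> by (auto simp: random_permuton_def permutons_def)
  have "bounded (\<Union>t\<in>J. g t ` (unit_square \<times> {0..1}))"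
    by (intro bounded_UN ballI J(1) compact_imp_bounded compact_continuous_image continuous_on_subset[OF g]
        compact_Times) auto
  then obtain c where c: "\<And>t w. t \<in> J \<Longrightarrow> w \<in> unit_square \<times> {0..1} \<Longrightarrow> \<bar>g t w\<bar> \<le> c"
    unfolding bounded_iff real_norm_def by blast
  have sample_bound: "\<bar>sampled k z (\<lambda>w. g t (w, v))\<bar> \<le> c"
    if "t \<in> J" "\<And>s. s \<in> {0<..1} \<Longrightarrow> z s \<in> {0..1}" "v \<in> {0..1}" for k z t v
  proof -
    have "\<bar>sampled k z (\<lambda>w. g t (w, v)) - sampled k z (\<lambda>_. 0)\<bar> \<le> c"
    proof (rule sample_average_le[OF _ m_pos])
      fix l show "\<bar>g t ((T k l, z (T k l)), v) - 0\<bar> \<le> c"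
        using c[OF that(1), of "((T k l, z (T k l)), v)"] that(2)[OF T_unit[of k l]] T_unit[of k l] that(3)
        by auto
    qed
    then show ?thesis by (simp add: sample_average_def)
  qed
  have g_borel: "g t \<in> borel_measurable borel" if "t \<in> J" for t
    by (rule borel_measurable_continuous_onI[OF g[OF that]])
  have g_slice: "continuous_on unit_square (\<lambda>w. g t (w, v))" if "t \<in> J" for t v
    by (intro continuous_on_compose2[OF g[OF that]] continuous_intros) auto
  have sample_meas: "(\<lambda>\<omega>. sampled k (Zpath \<omega>) (\<lambda>w. g t (w, Z t \<omega>))) \<in> borel_measurable N"
    if t: "t \<in> J" for k t
  proof -
    have [measurable]: "Z t \<in> borel_measurable N" "Z (T k l) \<in> borel_measurable N" for l
      using t J(2) T_unit by (auto intro!: Z_measurable)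
    note [measurable] = g_borel[OF t]
    show ?thesis unfolding sample_average_def by measurable
  qed
  have integral_bound: "\<bar>\<integral>w. g t (w, Z t \<omega>) \<partial>\<mu> \<omega>\<bar> \<le> c" if t: "t \<in> J" and \<omega>: "\<omega> \<in> space N" for t \<omega>
  proof -
    interpret \<nu>: prob_space "\<mu> \<omega>" using \<mu>_space[OF \<omega>] by (simp add: space_prob_algebra)
    have "space (\<mu> \<omega>) = unit_square"
      using \<mu>_space[OF \<omega>] sets_eq_imp_space_eq[of "\<mu> \<omega>" borel_square]
      by (simp add: space_prob_algebra space_restrict_space)
    moreover have "Z t \<omega> \<in> {0..1}" using Z_unit[OF _ \<omega>] t J(2) by blast
    ultimately have "\<bar>g t (w, Z t \<omega>)\<bar> \<le> c" if "w \<in> space (\<mu> \<omega>)" for w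
      using that by (intro c t) auto
    then have "(\<integral>w. \<bar>g t (w, Z t \<omega>)\<bar> \<partial>\<mu> \<omega>) \<le> (\<integral>w. c \<partial>\<mu> \<omega>)"
      using continuous_square_integrable[OF \<mu>_space[OF \<omega>] g_slice[OF t]] by (intro integral_mono) auto
    then have "(\<integral>w. \<bar>g t (w, Z t \<omega>)\<bar> \<partial>\<mu> \<omega>) \<le> c" by (simp add: \<nu>.prob_space)
    then show ?thesis by (rule order_trans[OF integral_abs_bound])
  qed
  have integral_meas: "(\<lambda>\<omega>. \<integral>w. g t (w, Z t \<omega>) \<partial>\<mu> \<omega>) \<in> borel_measurable N" if t: "t \<in> J" for t
    using t J(2) by (intro kernel_integral_measurable[OF measurable_test_function \<mu>_meas] g Z_measurable) auto
  show ?thesis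
  proof (rule expectation_tendsto_by_approximation[where c = c and
        X' = "\<lambda>k n t \<omega>. sampled k (Ypath n \<omega>) (\<lambda>w. g t (w, Ypath n \<omega> t))" and
        D' = "\<lambda>k t \<omega>. sampled k (Zpath \<omega>) (\<lambda>w. g t (w, Z t \<omega>))",
        OF prob_M prob_N J(1) \<phi>])
    fix n t assume n: "(n :: nat) \<ge> 1" and t: "t \<in> J"
    show "(\<lambda>\<omega>. graph_average n (\<pi> n \<omega>) (\<lambda>w. g t (w, Ypath n \<omega> t))) \<in> borel_measurable (M n)"
      by (rule borel_measurable_integrable)
         (rule integrable_perm[OF n, of "\<lambda>p. graph_average n p (\<lambda>w. g t (w, perm_process n p t))"])
    show "(\<lambda>\<omega>. sampled k (Ypath n \<omega>) (\<lambda>w. g t (w, Ypath n \<omega> t)))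
        \<in> borel_measurable (M n)" for k
      by (rule borel_measurable_integrable)
         (rule integrable_perm[OF n, of "\<lambda>p. sampled k (perm_process n p) (\<lambda>w. g t (w, perm_process n p t))"])
    fix \<omega> assume \<omega>: "\<omega> \<in> space (M n)"
    have p: "\<pi> n \<omega> permutes {1..n}" by (rule permutes[OF n \<omega>])
    have v: "Ypath n \<omega> t \<in> {0..1}" using perm_process_unit[OF p n] t J(2) by blast
    show "\<bar>sampled k (Ypath n \<omega>) (\<lambda>w. g t (w, Ypath n \<omega> t))\<bar> \<le> c" for k
      by (rule sample_bound[OF t perm_process_unit[OF p n] v])
    have "\<bar>graph_average n (\<pi> n \<omega>) (\<lambda>w. g t (w, Ypath n \<omega> t)) - graph_average n (\<pi> n \<omega>) (\<lambda>_. 0)\<bar> \<le> c"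
    proof (rule graph_average_le)
      fix i assume "i \<in> {1..n}"
      from graph_point_in_square[OF p this] v
      show "\<bar>g t ((real i / real n, real (\<pi> n \<omega> i) / real n), Ypath n \<omega> t) - 0\<bar> \<le> c"
        using c[OF t] by simp
    qed (use n in simp)
    then show "\<bar>graph_average n (\<pi> n \<omega>) (\<lambda>w. g t (w, Ypath n \<omega> t))\<bar> \<le> c"
      by (simp add: graph_average_def)
  next
    fix t assume t: "t \<in> J"
    show "(\<lambda>\<omega>. \<integral>w. g t (w, Z t \<omega>) \<partial>\<mu> \<omega>) \<in> borel_measurable N" by (rule integral_meas[OF t])
    show "(\<lambda>\<omega>. sampled k (Zpath \<omega>) (\<lambda>w. g t (w, Z t \<omega>))) \<in> borel_measurable N" for k
      by (rule sample_meas[OF t])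
    show "\<bar>\<integral>w. g t (w, Z t \<omega>) \<partial>\<mu> \<omega>\<bar> \<le> c" if "\<omega> \<in> space N" for \<omega>
      by (rule integral_bound[OF t that])
    show "\<bar>sampled k (Zpath \<omega>) (\<lambda>w. g t (w, Z t \<omega>))\<bar> \<le> c" if "\<omega> \<in> space N" for k \<omega>
      using Z_unit[OF _ that] t J(2) by (intro sample_bound) auto
    show "(\<lambda>k. \<integral>\<omega>. \<bar>sampled k (Zpath \<omega>) (\<lambda>w. g t (w, Z t \<omega>)) - (\<integral>w. g t (w, Z t \<omega>) \<partial>\<mu> \<omega>)\<bar> \<partial>N)
        \<longlonglongrightarrow> 0"
    proof -
      have "(\<lambda>k. \<integral>\<omega>. \<bar>sampled k (Zpath \<omega>) (\<lambda>w. g t (w, Z t \<omega>)) - (\<integral>w. g t (w, Z t \<omega>) \<partial>\<mu> \<omega>)\<bar> \<partial>N)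
        \<longlonglongrightarrow> (\<integral>\<omega>. 0 \<partial>N)"
      proof (rule integral_dominated_convergence[where w = "\<lambda>_. 2 * c"])
        show "AE \<omega> in N. (\<lambda>k. \<bar>sampled k (Zpath \<omega>) (\<lambda>w. g t (w, Z t \<omega>)) - (\<integral>w. g t (w, Z t \<omega>) \<partial>\<mu> \<omega>)\<bar>) \<longlonglongrightarrow> 0"
          using conv_\<mu>
        proof eventually_elim
          case (elim \<omega>)
          then have "(\<lambda>k. sampled k (Zpath \<omega>) (\<lambda>w. g t (w, Z t \<omega>))) \<longlonglongrightarrow> (\<integral>w. g t (w, Z t \<omega>) \<partial>\<mu> \<omega>)"
            using g_slice[OF t] by (auto simp: samples_converge_to_def)
          then show ?case by (intro tendsto_rabs_zero) (simp add: LIM_zero_iff)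
        qed
        show "AE \<omega> in N. norm \<bar>sampled k (Zpath \<omega>) (\<lambda>w. g t (w, Z t \<omega>)) - (\<integral>w. g t (w, Z t \<omega>) \<partial>\<mu> \<omega>)\<bar> \<le> 2 * c" for k
        proof (rule AE_I2)
          fix \<omega> assume \<omega>: "\<omega> \<in> space N"
          have "\<bar>sampled k (Zpath \<omega>) (\<lambda>w. g t (w, Z t \<omega>))\<bar> \<le> c"
            using Z_unit[OF _ \<omega>] t J(2) by (intro sample_bound) auto
          with integral_bound[OF t \<omega>]
          show "norm \<bar>sampled k (Zpath \<omega>) (\<lambda>w. g t (w, Z t \<omega>)) - (\<integral>w. g t (w, Z t \<omega>) \<partial>\<mu> \<omega>)\<bar> \<le> 2 * c"
            unfolding real_norm_def by linarith
        qed
      qed (use sample_meas[OF t] integral_meas[OF t] in measurable)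
      then show ?thesis by simp
    qed
    fix e :: real assume e: "e > 0"
    have t': "t \<in> {0<..1}" using t J(2) by blast
    from poly3_approx[OF continuous_on_subset[OF g[OF t]], of "e / 4"] e
    obtain xs where xs: "\<And>w. w \<in> unit_square \<times> {0..1} \<Longrightarrow> \<bar>g t w - poly3 xs w\<bar> < e / 4"
      by auto
    define K where "K = Max (insert 0 ((\<lambda>(c, a, b, d). max a b) ` set xs))"
    have K: "\<forall>(c, a, b, d)\<in>set xs. a \<le> k \<and> b \<le> k" if "k \<ge> K" for k
    proof clarify
      fix c a b d assume "(c, a, b, d) \<in> set xs"
      then have "max a b \<le> K" unfolding K_def by (intro Max_ge) force+
      then show "a \<le> k \<and> b \<le> k" using that by simp
    qed
    have "(\<lambda>k. (\<Sum>x\<leftarrow>xs. \<bar>fst x\<bar>) * (1 / 2) ^ k) \<longlonglongrightarrow> (\<Sum>x\<leftarrow>xs. \<bar>fst x\<bar>) * 0"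
      by (intro tendsto_mult_left LIMSEQ_realpow_zero) auto
    then have "\<forall>\<^sub>F k in sequentially. (\<Sum>x\<leftarrow>xs. \<bar>fst x\<bar>) * (1 / 2) ^ k < e / 2"
      using e by (intro order_tendstoD(2)) auto
    with eventually_ge_at_top[of K]
    show "\<forall>\<^sub>F k in sequentially. \<forall>\<^sub>F n in sequentially. (\<integral>\<omega>. \<bar>sampled k (Ypath n \<omega>) (\<lambda>w. g t (w, Ypath n \<omega> t))
        - graph_average n (\<pi> n \<omega>) (\<lambda>w. g t (w, Ypath n \<omega> t))\<bar> \<partial>M n) \<le> e"
    proof eventually_elim
      case (elim k)
      show ?case
        using polynomial_sample_error[OF t' K[OF elim(1)]] eventually_ge_at_top[of 1]
      proof eventually_elim
        case (elim n)
        interpret Mn: prob_space "M n" by (rule prob_M[OF elim(2)])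
        define v where "v p = perm_process n p t" for p
        define S where "S p f = sampled k (perm_process n p) f" for p f
        define R where "R p = \<bar>poly3_moment (\<lambda>a b. S p (monomial a b)) xs (v p)
            - poly3_moment (\<lambda>a b. graph_average n p (monomial a b)) xs (v p)\<bar>" for p
        have "(\<integral>\<omega>. \<bar>S (\<pi> n \<omega>) (\<lambda>w. g t (w, v (\<pi> n \<omega>))) - graph_average n (\<pi> n \<omega>) (\<lambda>w. g t (w, v (\<pi> n \<omega>)))\<bar> \<partial>M n)
            \<le> (\<integral>\<omega>. e / 2 + R (\<pi> n \<omega>) \<partial>M n)"
        proof (intro integral_mono integrable_perm[OF elim(2), of "\<lambda>p. e / 2 + R p"]
            integrable_perm[OF elim(2), of "\<lambda>p. \<bar>S p (\<lambda>w. g t (w, v p)) - graph_average n p (\<lambda>w. g t (w, v p))\<bar>"])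
          fix \<omega> assume \<omega>: "\<omega> \<in> space (M n)"
          define p where "p = \<pi> n \<omega>"
          have p: "p permutes {1..n}" unfolding p_def by (rule permutes[OF elim(2) \<omega>])
          have vp: "v p \<in> {0..1}" unfolding v_def by (rule perm_process_unit[OF p elim(2) t'])
          have "\<bar>S p (\<lambda>w. g t (w, v p)) - S p (\<lambda>w. poly3 xs (w, v p))\<bar> \<le> e / 4"
            unfolding S_def
          proof (rule sample_average_le[OF _ m_pos])
            fix l
            have "((T k l, perm_process n p (T k l)), v p) \<in> unit_square \<times> {0..1}"
              using T_unit[of k l] perm_process_unit[OF p elim(2) T_unit[of k l]] vp by auto
            from xs[OF this] show "\<bar>g t ((T k l, perm_process n p (T k l)), v p) - poly3 xs ((T k l, perm_process n p (T k l)), v p)\<bar> \<le> e / 4"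
              by simp
          qed
          moreover have "\<bar>graph_average n p (\<lambda>w. g t (w, v p)) - graph_average n p (\<lambda>w. poly3 xs (w, v p))\<bar> \<le> e / 4"
          proof (rule graph_average_le)
            fix i assume "i \<in> {1..n}"
            from xs[of "((real i / real n, real (p i) / real n), v p)"] graph_point_in_square[OF p this] vp
            show "\<bar>g t ((real i / real n, real (p i) / real n), v p) - poly3 xs ((real i / real n, real (p i) / real n), v p)\<bar> \<le> e / 4"
              by simp
          qed (use elim(2) in simp)
          moreover have "R p = \<bar>S p (\<lambda>w. poly3 xs (w, v p)) - graph_average n p (\<lambda>w. poly3 xs (w, v p))\<bar>"
            unfolding R_def S_def sample_average_poly3 graph_average_poly3 ..
          ultimately show "\<bar>S (\<pi> n \<omega>) (\<lambda>w. g t (w, v (\<pi> n \<omega>))) - graph_average n (\<pi> n \<omega>) (\<lambda>w. g t (w, v (\<pi> n \<omega>)))\<bar>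
              \<le> e / 2 + R (\<pi> n \<omega>)"
            unfolding p_def by linarith
        qed
        also have "\<dots> = e / 2 + (\<integral>\<omega>. R (\<pi> n \<omega>) \<partial>M n)"
          using integrable_perm[OF elim(2), of R] by (simp add: Mn.prob_space)
        also have "\<dots> \<le> e"
          using elim(1) \<open>(\<Sum>x\<leftarrow>xs. \<bar>fst x\<bar>) * (1 / 2) ^ k < e / 2\<close>
          unfolding R_def S_def v_def by linarith
        finally show ?case unfolding S_def v_def .
      qed
    qed
  next
    fix k
    define J' where "J' = J \<union> T k ` {..<m k}"
    have J': "finite J'" "J' \<subseteq> {0<..1}" "\<And>t. t \<in> J \<Longrightarrow> t \<in> J'" "\<And>l. l < m k \<Longrightarrow> T k l \<in> J'"
      using J T_unit by (auto simp: J'_def)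
    define W where "W x = (\<lambda>t\<in>J. sampled k x (\<lambda>w. g t (w, x t)))" for x
    have "continuous_map (powertop_real J') (powertop_real J) W"
      unfolding continuous_map_componentwise
    proof (intro conjI ballI)
      fix t assume t: "t \<in> J"
      then show "continuous_map (powertop_real J') euclideanreal (\<lambda>x. W x t)"
        using continuous_map_sample_test[OF g[OF t] J'(3)[OF t], of "m k" "T k"] J'(4) by (simp add: W_def)
    qed (auto simp: W_def)
    from fdd_expectation_tendsto[OF J'(1,2) continuous_map_compose[OF this \<phi>]]
    show "(\<lambda>n. \<integral>\<omega>. \<phi> (\<lambda>t\<in>J. sampled k (Ypath n \<omega>) (\<lambda>w. g t (w, Ypath n \<omega> t))) \<partial>M n)
       \<longlonglongrightarrow> (\<integral>\<omega>. \<phi> (\<lambda>t\<in>J. sampled k (Zpath \<omega>) (\<lambda>w. g t (w, Z t \<omega>))) \<partial>N)"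
      using J'(3,4) by (simp add: W_def sample_average_restrict cong: restrict_cong)
  qed
qed

end


section \<open>Degrees as distribution functions\<close>

lemma perm_graph_degree_eq_card:
  assumes i: "i \<in> {1..n}"
  shows "perm_graph_degree n p i = card {j \<in> {1..n}. (int i - int j) * (int (p i) - int (p j)) < 0}"
proof -
  let ?B = "{j \<in> {1..n}. (int i - int j) * (int (p i) - int (p j)) < 0}"
  have "{e \<in> perm_graph_edges n p. i \<in> e} = (\<lambda>j. {i, j}) ` ?B"
  proof (intro equalityI subsetI)
    fix e assume "e \<in> {e \<in> perm_graph_edges n p. i \<in> e}"
    then obtain a b where ab: "e = {a, b}" "a \<in> {1..n}" "b \<in> {1..n}"
      "(int a - int b) * (int (p a) - int (p b)) < 0" "i = a \<or> i = b"
      by (auto simp: perm_graph_edges_def)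
    then show "e \<in> (\<lambda>j. {i, j}) ` ?B"
    proof (cases "i = a")
      case False
      then have "i = b" using ab(5) by simp
      moreover have "(int b - int a) * (int (p b) - int (p a)) < 0"
        using ab(4) by (simp add: algebra_simps)
      ultimately show ?thesis using ab(1,2) by auto
    qed auto
  next
    fix e assume "e \<in> (\<lambda>j. {i, j}) ` ?B"
    then show "e \<in> {e \<in> perm_graph_edges n p. i \<in> e}"
      using i by (auto simp: perm_graph_edges_def)
  qed
  moreover have "inj_on (\<lambda>j. {i, j}) ?B" by (auto simp: inj_on_def doubleton_eq_iff)
  ultimately show ?thesis by (simp add: perm_graph_degree_def card_image)
qed

text \<open>Let \<open>A\<close>, \<open>B\<close> and \<open>L\<close> be the vertices to the upper left, to the lower right and to the lower left of \<open>i\<close>,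
the last including \<open>i\<close> itself. The neighbours of \<open>i\<close> are \<open>A \<union> B\<close>, while \<open>A \<union> L\<close> consists of all \<open>j \<le> i\<close> and
\<open>B \<union> L\<close> of all \<open>j\<close> with \<open>p j \<le> p i\<close>, which are \<open>p i\<close> many.\<close>

lemma perm_graph_degree_formula:
  assumes p: "p permutes {1..n}" and i: "i \<in> {1..n}"
  shows "real (perm_graph_degree n p i) =
     real i + real (p i) - 2 * real (card {j \<in> {1..n}. j \<le> i \<and> p j \<le> p i})"
proof -
  have inj: "inj p" by (rule permutes_inj[OF p])
  define A where "A = {j \<in> {1..n}. j < i \<and> p j > p i}"
  define B where "B = {j \<in> {1..n}. j > i \<and> p j < p i}"
  define L where "L = {j \<in> {1..n}. j \<le> i \<and> p j \<le> p i}"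
  have fin: "finite A" "finite B" "finite L" by (auto simp: A_def B_def L_def)
  have "{j \<in> {1..n}. (int i - int j) * (int (p i) - int (p j)) < 0} = A \<union> B"
    by (auto simp: A_def B_def mult_less_0_iff)
  moreover have "A \<inter> B = {}" by (auto simp: A_def B_def)
  ultimately have deg: "perm_graph_degree n p i = card A + card B"
    using perm_graph_degree_eq_card[OF i] card_Un_disjoint[OF fin(1,2)] by simp
  have "{1..i} = A \<union> L"
  proof (intro equalityI subsetI)
    fix j assume j: "j \<in> {1..i}"
    show "j \<in> A \<union> L"
    proof (cases "p j > p i")
      case True
      then have "j \<noteq> i" by auto
      then show ?thesis using True i j by (simp add: A_def)
    qed (use i j in \<open>simp add: L_def\<close>)
  qed (auto simp: A_def L_def)
  moreover have "A \<inter> L = {}" by (auto simp: A_def L_def)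
  ultimately have iA: "i = card A + card L" using card_Un_disjoint[OF fin(1,3)] card_atLeastAtMost[of 1 i] by simp
  have pi: "p i \<in> {1..n}" using permutes_in_image[OF p] i by blast
  have "B \<union> L = {j \<in> {1..n}. p j \<le> p i}"
  proof (intro equalityI subsetI)
    fix j assume j: "j \<in> {j \<in> {1..n}. p j \<le> p i}"
    show "j \<in> B \<union> L"
    proof (cases "j > i")
      case True
      then have "p j \<noteq> p i" using inj by (auto simp: inj_eq)
      then show ?thesis using True j by (simp add: B_def)
    qed (use j in \<open>simp add: L_def\<close>)
  qed (auto simp: B_def L_def)
  moreover have "p ` {j \<in> {1..n}. p j \<le> p i} = {1..p i}"
  proof (intro equalityI subsetI)
    fix y assume y: "y \<in> {1..p i}"
    then have "y \<in> p ` {1..n}" using permutes_image[OF p] pi by auto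
    then show "y \<in> p ` {j \<in> {1..n}. p j \<le> p i}" using y by auto
  next
    fix y assume "y \<in> p ` {j \<in> {1..n}. p j \<le> p i}"
    then obtain j where "j \<in> {1..n}" "y = p j" "p j \<le> p i" by blast
    moreover from this(1) have "p j \<in> {1..n}" using permutes_in_image[OF p] by blast
    ultimately show "y \<in> {1..p i}" by simp
  qed
  moreover have "card (p ` {j \<in> {1..n}. p j \<le> p i}) = card {j \<in> {1..n}. p j \<le> p i}"
    by (intro card_image inj_on_subset[OF inj]) auto
  moreover have "B \<inter> L = {}" by (auto simp: B_def L_def)
  ultimately have "p i = card B + card L" using card_Un_disjoint[OF fin(2,3)] by simp
  with iA deg show ?thesis unfolding L_def[symmetric] by linarith
qed

lemma degree_process_eq:
  assumes p: "p permutes {1..n}" and n: "n \<ge> 1" and t: "t \<in> {0<..1}"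
  shows "degree_process n p t = real (nat \<lceil>real n * t\<rceil>) / real n + perm_process n p t
     - 2 * graph_average n p (indicator ({..real (nat \<lceil>real n * t\<rceil>) / real n} \<times> {..perm_process n p t}))"
proof -
  define i where "i = nat \<lceil>real n * t\<rceil>"
  have i: "i \<in> {1..n}" unfolding i_def by (rule ceiling_index[OF n t])
  have "(\<Sum>j\<in>{1..n}. indicator ({..real i / real n} \<times> {..real (p i) / real n}) (real j / real n, real (p j) / real n) :: real)
      = (\<Sum>j\<in>{1..n}. if j \<le> i \<and> p j \<le> p i then 1 else 0)"
    using n by (intro sum.cong refl) (simp add: indicator_def divide_le_cancel)
  also have "\<dots> = real (card {j \<in> {1..n}. j \<le> i \<and> p j \<le> p i})"
    by (simp add: sum.inter_filter[symmetric])
  finally have "graph_average n p (indicator ({..real i / real n} \<times> {..real (p i) / real n})) =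
      real (card {j \<in> {1..n}. j \<le> i \<and> p j \<le> p i}) / real n"
    by (simp add: graph_average_def)
  then show ?thesis
    unfolding degree_process_def perm_process_def i_def[symmetric] perm_graph_degree_formula[OF p i]
    by (simp add: add_divide_distrib diff_divide_distrib)
qed

text \<open>A continuous majorant of the indicator of \<open>{..0}\<close>, falling linearly to 0 on \<open>[0, e]\<close>.\<close>

definition ramp :: "real \<Rightarrow> real \<Rightarrow> real" where
  "ramp e x = max 0 (min 1 (1 - x / e))"

lemma ramp_bounds: "0 \<le> ramp e x" "ramp e x \<le> 1"
  by (auto simp: ramp_def)

lemma ramp_eq:
  assumes "e > 0"
  shows "x \<le> 0 \<Longrightarrow> ramp e x = 1" "x > e \<Longrightarrow> ramp e x = 0"
  using assms by (auto simp: ramp_def divide_nonpos_pos)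

lemma continuous_on_ramp [continuous_intros]:
  "continuous_on A f \<Longrightarrow> continuous_on A (\<lambda>x. ramp e (f x))"
  unfolding ramp_def divide_inverse by (intro continuous_intros)

text \<open>A continuous majorant of the indicator of the quadrant to the lower left of \<open>(t, v)\<close>, as a function of the
pair of a point and \<open>v\<close>.\<close>

definition ramp_quadrant :: "real \<Rightarrow> real \<Rightarrow> (real \<times> real) \<times> real \<Rightarrow> real" where
  "ramp_quadrant e t w = ramp e (fst (fst w) - t) * ramp e (snd (fst w) - snd w)"

lemma ramp_quadrant_bounds: "0 \<le> ramp_quadrant e t w" "ramp_quadrant e t w \<le> 1"
  using ramp_bounds by (auto simp: ramp_quadrant_def intro: mult_le_one)

lemma continuous_on_ramp_quadrant: "continuous_on A (ramp_quadrant e t)"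
  unfolding ramp_quadrant_def by (intro continuous_intros)

lemma ramp_quadrant_error:
  assumes "e > 0"
  shows "\<bar>ramp_quadrant e t (w, v) - indicator ({..t} \<times> {..v}) w\<bar> \<le>
     indicator {t<..t + e} (fst w) + indicator {v<..v + e} (snd w)"
proof -
  consider "fst w \<le> t" "snd w \<le> v" | "fst w > t + e" | "snd w > v + e"
    | "fst w \<in> {t<..t + e}" | "snd w \<in> {v<..v + e}" by fastforce
  then show ?thesis
  proof cases
    case 1
    then have "ramp_quadrant e t (w, v) = 1" using ramp_eq(1)[OF assms] by (simp add: ramp_quadrant_def)
    then show ?thesis using 1 by (simp add: indicator_def mem_Times_iff)
  next
    case 2
    then have "ramp_quadrant e t (w, v) = 0" using ramp_eq(2)[OF assms] by (simp add: ramp_quadrant_def)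
    then show ?thesis using 2 assms by (simp add: indicator_def mem_Times_iff)
  next
    case 3
    then have "ramp_quadrant e t (w, v) = 0" using ramp_eq(2)[OF assms] by (simp add: ramp_quadrant_def)
    then show ?thesis using 3 assms by (simp add: indicator_def mem_Times_iff)
  next
    case 4
    then show ?thesis using ramp_quadrant_bounds[of e t "(w, v)"] by (auto simp: indicator_def)
  next
    case 5
    then show ?thesis using ramp_quadrant_bounds[of e t "(w, v)"] by (auto simp: indicator_def)
  qed
qed

text \<open>Among the points \<open>j/n\<close>, a half-open interval of length \<open>l\<close> contains at most \<open>n l + 1\<close>.\<close>

lemma grid_fraction_in_interval_le:
  assumes n: "n \<ge> 1" and ab: "0 \<le> a" "a \<le> b"
  shows "(\<Sum>j\<in>{1..n}. indicator {a<..b} (real j / real n)) / real n \<le> b - a + 1 / real n"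
proof -
  have "{j \<in> {1..n}. real j / real n \<in> {a<..b}} \<subseteq> {nat \<lfloor>real n * a\<rfloor> <.. nat \<lfloor>real n * b\<rfloor>}"
  proof clarify
    fix j assume "j \<in> {1..n}" "real j / real n \<in> {a<..b}"
    then have *: "real n * a < real j" "real j \<le> real n * b" using n by (auto simp: field_simps)
    have "0 \<le> real n * a" using ab(1) by simp
    then have "\<lfloor>real n * a\<rfloor> < int j" "int j \<le> \<lfloor>real n * b\<rfloor>" using * by linarith+
    moreover have "0 \<le> \<lfloor>real n * a\<rfloor>" using \<open>0 \<le> real n * a\<close> by simp
    ultimately show "j \<in> {nat \<lfloor>real n * a\<rfloor> <.. nat \<lfloor>real n * b\<rfloor>}"
      by (simp add: nat_less_iff le_nat_iff)
  qed
  then have "card {j \<in> {1..n}. real j / real n \<in> {a<..b}} \<le> card {nat \<lfloor>real n * a\<rfloor> <.. nat \<lfloor>real n * b\<rfloor>}"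
    by (intro card_mono) auto
  then have "real (card {j \<in> {1..n}. real j / real n \<in> {a<..b}}) \<le> real (nat \<lfloor>real n * b\<rfloor> - nat \<lfloor>real n * a\<rfloor>)"
    by simp
  also have "\<dots> \<le> real n * b - real n * a + 1"
  proof -
    have "0 \<le> real n * a" "real n * a \<le> real n * b" using ab by (auto intro: mult_left_mono)
    then show ?thesis by linarith
  qed
  finally have *: "real (card {j \<in> {1..n}. real j / real n \<in> {a<..b}}) \<le> real n * (b - a) + 1"
    by (simp add: algebra_simps)
  have "(\<Sum>j\<in>{1..n}. indicator {a<..b} (real j / real n) :: real) = real (card {j \<in> {1..n}. real j / real n \<in> {a<..b}})"
  proof -
    have "(\<Sum>j\<in>{1..n}. indicator {a<..b} (real j / real n) :: real) =
        (\<Sum>j\<in>{1..n}. if real j / real n \<in> {a<..b} then 1 else 0)"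
      by (intro sum.cong refl) (simp add: indicator_def)
    then show ?thesis by (simp only: sum.inter_filter[symmetric] finite_atLeastAtMost card_eq_sum of_nat_sum of_nat_1)
  qed
  then have "(\<Sum>j\<in>{1..n}. indicator {a<..b} (real j / real n)) / real n \<le> (real n * (b - a) + 1) / real n"
    using * by (intro divide_right_mono) simp_all
  also have "\<dots> = b - a + 1 / real n" using n by (simp add: add_divide_distrib)
  finally show ?thesis .
qed

text \<open>The ramp differs from the indicator of the quadrant only in two strips of width \<open>e\<close>, and rounding \<open>t\<close> up to
\<open>\<lceil>n t\<rceil>/n\<close> moves the quadrant by a strip of width at most \<open>1/n\<close>. The three strips have mass at most
\<open>2 e + 4/n\<close>, for the vertical coordinate because the permutation only reorders the heights. This counts twice,
and the summand \<open>t\<close> itself is off by at most \<open>1/n\<close>.\<close>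

lemma degree_process_ramp_error:
  assumes p: "p permutes {1..n}" and n: "n \<ge> 1" and t: "t \<in> {0<..1}" and e: "e > 0"
  shows "\<bar>graph_average n p (\<lambda>w. t + perm_process n p t - 2 * ramp_quadrant e t (w, perm_process n p t))
            - degree_process n p t\<bar> \<le> 4 * e + 9 * (1 / real n)"
proof -
  define r where "r = real (nat \<lceil>real n * t\<rceil>) / real n"
  define v where "v = perm_process n p t"
  have v: "v \<ge> 0" using perm_process_unit[OF p n t] by (simp add: v_def)
  have r: "t \<le> r" "r \<le> t + 1 / real n"
  proof -
    have "real n * t \<le> real (nat \<lceil>real n * t\<rceil>)" by linarith
    moreover have "0 \<le> real n * t" using t by simp
    then have "real (nat \<lceil>real n * t\<rceil>) \<le> real n * t + 1" by linarith
    ultimately show "t \<le> r" "r \<le> t + 1 / real n" using n by (auto simp: r_def field_simps)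
  qed
  define a where "a f = (\<Sum>j\<in>{1..n}. f (real j / real n, real (p j) / real n)) / real n" for f :: "real \<times> real \<Rightarrow> real"
  have avg: "graph_average n p f = a f" for f by (simp add: graph_average_def a_def)
  define err where "err w = indicator {t<..t + e} (fst w) + indicator {v<..v + e} (snd w) + (indicator {t<..t + 1 / real n} (fst w) :: real)"
    for w :: "real \<times> real"
  have pointwise: "\<bar>ramp_quadrant e t (w, v) - indicator ({..r} \<times> {..v}) w\<bar> \<le> err w" for w
  proof -
    have "\<bar>indicator ({..t} \<times> {..v}) w - (indicator ({..r} \<times> {..v}) w :: real)\<bar> \<le> indicator {t<..t + 1 / real n} (fst w)"
      using r by (auto simp: indicator_def mem_Times_iff)
    with ramp_quadrant_error[OF e, where t = t and w = w and v = v] show ?thesis unfolding err_def by linarith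
  qed
  have "\<bar>a (\<lambda>w. ramp_quadrant e t (w, v)) - a (indicator ({..r} \<times> {..v}))\<bar> \<le> a err"
    unfolding a_def diff_divide_distrib[symmetric] sum_subtractf[symmetric] abs_divide
    using pointwise by (auto intro!: divide_right_mono order_trans[OF sum_abs] sum_mono)
  also have "a err = (\<Sum>j\<in>{1..n}. indicator {t<..t + e} (real j / real n)) / real n
      + (\<Sum>j\<in>{1..n}. indicator {v<..v + e} (real (p j) / real n)) / real n
      + (\<Sum>j\<in>{1..n}. indicator {t<..t + 1 / real n} (real j / real n)) / real n"
    by (simp add: a_def err_def sum.distrib add_divide_distrib)
  also have "(\<Sum>j\<in>{1..n}. indicator {v<..v + e} (real (p j) / real n) :: real) =
      (\<Sum>j\<in>{1..n}. indicator {v<..v + e} (real j / real n))"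
    by (rule sum.permute[OF p, unfolded comp_def, symmetric])
  also have "(\<Sum>j\<in>{1..n}. indicator {t<..t + e} (real j / real n)) / real n
      + (\<Sum>j\<in>{1..n}. indicator {v<..v + e} (real j / real n)) / real n
      + (\<Sum>j\<in>{1..n}. indicator {t<..t + 1 / real n} (real j / real n)) / real n \<le> (e + 1 / real n) + (e + 1 / real n) + (1 / real n + 1 / real n)"
    using grid_fraction_in_interval_le[OF n, of t "t + e"] grid_fraction_in_interval_le[OF n, of v "v + e"]
      grid_fraction_in_interval_le[OF n, of t "t + 1 / real n"] t v e by simp
  finally have main: "\<bar>a (\<lambda>w. ramp_quadrant e t (w, v)) - a (indicator ({..r} \<times> {..v}))\<bar> \<le> 2 * e + 4 * (1 / real n)"
    by simp
  have "a (\<lambda>w. t + v - 2 * ramp_quadrant e t (w, v)) = t + v - 2 * a (\<lambda>w. ramp_quadrant e t (w, v))"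
    using n by (simp add: a_def sum_subtractf sum_distrib_left[symmetric] diff_divide_distrib)
  then show ?thesis
    using main r unfolding avg degree_process_eq[OF p n t] v_def[symmetric] r_def[symmetric] by linarith
qed

text \<open>As for graphs of permutations, with strips of mass at most \<open>e\<close> by the uniformity of the marginals.\<close>

lemma bivariate_cdf_ramp_error:
  assumes \<mu>: "\<mu> \<in> permutons" and t: "t \<in> {0..1}" and v: "v \<in> {0..1}" and e: "e > 0"
  shows "\<bar>(\<integral>w. t + v - 2 * ramp_quadrant e t (w, v) \<partial>\<mu>) - (t + v - 2 * bivariate_cdf \<mu> t v)\<bar> \<le> 4 * e"
proof -
  from \<mu> have \<mu>_alg: "\<mu> \<in> space (prob_algebra borel_square)"
    and fst_unif: "distr \<mu> borel fst = uniform_measure lborel {0..1}"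
    and snd_unif: "distr \<mu> borel snd = uniform_measure lborel {0..1}"
    by (auto simp: permutons_def)
  from \<mu>_alg have sets: "sets \<mu> = sets borel_square" and "prob_space \<mu>" by (auto simp: space_prob_algebra)
  interpret prob_space \<mu> by fact
  have space: "space \<mu> = unit_square"
    using sets_eq_imp_space_eq[OF sets] by (simp add: space_restrict_space)
  have id: "(\<lambda>w. w) \<in> \<mu> \<rightarrow>\<^sub>M borel"
    using measurable_restrict_space1[OF measurable_ident_sets[OF refl]] sets by (simp cong: measurable_cong_sets)
  have [measurable]: "fst \<in> \<mu> \<rightarrow>\<^sub>M borel" "snd \<in> \<mu> \<rightarrow>\<^sub>M borel"
    using measurable_compose[OF id, of fst borel] measurable_compose[OF id, of snd borel]
    by (simp_all add: borel_prod[symmetric])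
  have strip: "measure \<mu> {w \<in> space \<mu>. proj w \<in> {x<..x + e}} \<le> e"
    if "distr \<mu> borel proj = uniform_measure lborel {0..1}" and [measurable]: "proj \<in> \<mu> \<rightarrow>\<^sub>M borel" for proj and x
  proof -
    have "measure \<mu> {w \<in> space \<mu>. proj w \<in> {x<..x + e}} = measure (distr \<mu> borel proj) {x<..x + e}"
      by (subst measure_distr) (auto intro!: arg_cong[of _ _ "measure \<mu>"])
    also have "\<dots> = measure lborel ({0..1} \<inter> {x<..x + e}) / measure lborel {0..1 :: real}"
      unfolding that(1) by (intro measure_uniform_measure) auto
    also have "\<dots> \<le> measure lborel {x<..x + e}"
    proof -
      have "measure lborel ({0..1} \<inter> {x<..x + e}) \<le> measure lborel {x<..x + e}"
        by (rule measure_mono_fmeasurable) (auto simp: fmeasurable_def emeasure_lborel_Ioc e less_imp_le)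
      then show ?thesis by simp
    qed
    also have "\<dots> = e" using e by simp
    finally show ?thesis .
  qed
  define A where "A = {w \<in> space \<mu>. fst w \<in> {t<..t + e}}"
  define B where "B = {w \<in> space \<mu>. snd w \<in> {v<..v + e}}"
  have AB[measurable]: "A \<in> sets \<mu>" "B \<in> sets \<mu>" unfolding A_def B_def by measurable
  define Q where "Q = {0..t} \<times> {0..v}"
  have Q: "Q \<in> sets \<mu>"
  proof -
    have "Q = space \<mu> \<inter> ({..t} \<times> {..v})" using t v by (auto simp: Q_def space)
    moreover have "{..t} \<times> {..v} \<in> sets (borel :: (real \<times> real) measure)"
      by (intro borel_closed closed_Times) auto
    ultimately show ?thesis unfolding sets sets_restrict_space space by blast
  qed
  have ramp_int: "integrable \<mu> (\<lambda>w. ramp_quadrant e t (w, v))"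
    by (intro continuous_square_integrable[OF \<mu>_alg] continuous_on_compose2[OF continuous_on_ramp_quadrant[of UNIV]]
        continuous_intros) auto
  have Q_int: "integrable \<mu> (indicator Q :: _ \<Rightarrow> real)"
    using Q by (intro integrable_real_indicator) (auto simp: emeasure_finite less_top[symmetric])
  have "\<bar>\<integral>w. ramp_quadrant e t (w, v) - indicator Q w \<partial>\<mu>\<bar> \<le> (\<integral>w. \<bar>ramp_quadrant e t (w, v) - indicator Q w\<bar> \<partial>\<mu>)"
    by (rule integral_abs_bound)
  also have "\<dots> \<le> (\<integral>w. indicator A w + indicator B w \<partial>\<mu>)"
  proof (rule integral_mono)
    fix w assume w: "w \<in> space \<mu>"
    have "(indicator Q w :: real) = indicator ({..t} \<times> {..v}) w"
      using w by (auto simp: Q_def space indicator_def)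
    moreover have "(indicator {t<..t + e} (fst w) :: real) = indicator A w" "(indicator {v<..v + e} (snd w) :: real) = indicator B w"
      using w by (auto simp: A_def B_def indicator_def)
    ultimately show "\<bar>ramp_quadrant e t (w, v) - indicator Q w\<bar> \<le> indicator A w + indicator B w"
      using ramp_quadrant_error[OF e, where t = t and w = w and v = v] by simp
  qed (use ramp_int Q_int AB in \<open>auto intro!: integrable_real_indicator simp: emeasure_finite less_top[symmetric]\<close>)
  also have "\<dots> = measure \<mu> A + measure \<mu> B"
    using AB by (subst Bochner_Integration.integral_add)
      (auto intro!: integrable_real_indicator simp: emeasure_finite less_top[symmetric] Int_absorb2 sets.sets_into_space)
  also have "\<dots> \<le> e + e"
    unfolding A_def B_def using strip[OF fst_unif] strip[OF snd_unif] by (intro add_mono) auto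
  finally have "\<bar>(\<integral>w. ramp_quadrant e t (w, v) \<partial>\<mu>) - bivariate_cdf \<mu> t v\<bar> \<le> 2 * e"
    using ramp_int Q_int Q sets.sets_into_space[OF Q]
    by (simp add: bivariate_cdf_def Q_def[symmetric] Int_absorb2)
  moreover have "(\<integral>w. t + v - 2 * ramp_quadrant e t (w, v) \<partial>\<mu>) = t + v - 2 * (\<integral>w. ramp_quadrant e t (w, v) \<partial>\<mu>)"
    using ramp_int by (simp add: prob_space)
  ultimately show ?thesis by linarith
qed


section \<open>The permuton of a permutation and its graph averages\<close>

lemma lborel_cell:
  assumes "a < b" "c < d"
  shows "emeasure lborel ({a<..b} \<times> {c<..d} :: (real \<times> real) set) = ennreal ((b - a) * (d - c))"
proof -
  have "emeasure (lborel \<Otimes>\<^sub>M lborel) ({a<..b} \<times> {c<..d}) = emeasure lborel {a<..b} * emeasure lborel {c<..d}"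
    by (intro lborel.emeasure_pair_measure_Times) auto
  then show ?thesis using assms by (simp add: lborel_prod ennreal_mult')
qed

text \<open>Each cell has mass \<open>1/n\<close>, and all its points are within \<open>2/n\<close> of its upper right corner, which is the
corresponding point of the graph.\<close>

lemma permuton_of_perm_integral:
  fixes f :: "real \<times> real \<Rightarrow> real"
  assumes p: "p permutes {1..n}" and n: "n \<ge> 1" and f: "continuous_on unit_square f"
    and osc: "\<And>w w'. w \<in> unit_square \<Longrightarrow> w' \<in> unit_square \<Longrightarrow> dist w w' \<le> 2 / real n \<Longrightarrow> \<bar>f w - f w'\<bar> \<le> e"
  shows "\<bar>(\<integral>w. f w \<partial>permuton_of_perm n p) - graph_average n p f\<bar> \<le> e"
proof -
  define cell where "cell i = {(real i - 1) / real n <.. real i / real n} \<times>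
      {(real (p i) - 1) / real n <.. real (p i) / real n}" for i
  define Q where "Q = restrict_space lborel unit_square"
  have p_in: "p i \<in> {1..n}" if "i \<in> {1..n}" for i
    using permutes_in_image[OF p] that by blast
  have cell_sub: "cell i \<subseteq> unit_square" if "i \<in> {1..n}" for i
  proof -
    have strip: "{(real j - 1) / real n <.. real j / real n} \<subseteq> {0..1}" if "j \<in> {1..n}" for j
    proof
      fix s assume s: "s \<in> {(real j - 1) / real n <.. real j / real n}"
      have "0 \<le> (real j - 1) / real n" "real j / real n \<le> 1" using that n by auto
      with s show "s \<in> {0..1}" by auto
    qed
    from strip[OF that] strip[OF p_in[OF that]] show ?thesis
      unfolding cell_def by (rule Sigma_mono)
  qed
  have square_borel: "unit_square \<in> sets borel" by (intro borel_closed closed_Times) auto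
  have space_Q: "space Q = unit_square" by (simp add: Q_def space_restrict_space)
  have cell_borel: "cell i \<in> sets borel" for i
    unfolding cell_def borel_prod[symmetric] by (intro pair_measureI) auto
  have cell_sets: "cell i \<in> sets Q" if "i \<in> {1..n}" for i
    using cell_sub[OF that] square_borel cell_borel by (simp add: Q_def sets_restrict_space_iff)
  have cell_emeasure: "emeasure Q (cell i) = ennreal (1 / (real n)\<^sup>2)" if "i \<in> {1..n}" for i
  proof -
    have "emeasure Q (cell i) = emeasure lborel (cell i)"
      unfolding Q_def using cell_sub[OF that] square_borel by (intro emeasure_restrict_space) auto
    also have "\<dots> = ennreal (1 / (real n)\<^sup>2)"
      unfolding cell_def using n
      by (subst lborel_cell) (auto simp: diff_divide_distrib power2_eq_square divide_strict_right_mono)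
    finally show ?thesis .
  qed
  have cell_measure: "measure Q (cell i) = 1 / (real n)\<^sup>2" if "i \<in> {1..n}" for i
    using cell_emeasure[OF that] by (simp add: measure_def)
  have cell_int: "integrable Q (indicator (cell i) :: _ \<Rightarrow> real)" if "i \<in> {1..n}" for i
    using cell_sets[OF that] cell_emeasure[OF that] by (intro integrable_real_indicator) auto
  obtain B where B: "\<forall>w\<in>unit_square. \<bar>f w\<bar> \<le> B" using continuous_square_bounded[OF f] by blast
  have f_meas: "f \<in> borel_measurable Q"
  proof -
    have "sets Q = sets borel_square" by (simp add: Q_def sets_restrict_space)
    then show ?thesis
      unfolding measurable_cong_sets[OF \<open>sets Q = sets borel_square\<close> refl]
      by (intro continuous_square_measurable f)
  qed
  have cell_f_int: "integrable Q (\<lambda>w. indicator (cell i) w * f w)" if "i \<in> {1..n}" for i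
  proof (rule Bochner_Integration.integrable_bound[of Q "\<lambda>w. B * indicator (cell i) w"])
    show "integrable Q (\<lambda>w. B * indicator (cell i) w)" using cell_int[OF that] by simp
    show "(\<lambda>w. indicator (cell i) w * f w) \<in> borel_measurable Q"
      using f_meas cell_sets[OF that] by (intro borel_measurable_times borel_measurable_indicator)
    show "AE w in Q. norm (indicator (cell i) w * f w) \<le> norm (B * indicator (cell i) w)"
      using B by (intro AE_I2) (auto simp: indicator_def space_Q intro: order_trans[OF _ abs_ge_self])
  qed
  define G where "G w = (if \<exists>i\<in>{1..n}. w \<in> cell i then real n else 0)" for w
  have G_sum: "G w = (\<Sum>i\<in>{1..n}. real n * indicator (cell i) w)" for w
  proof (cases "\<exists>i\<in>{1..n}. w \<in> cell i")
    case True
    then obtain i where i: "i \<in> {1..n}" "w \<in> cell i" by blast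
    have "indicator (cell j) w = (if j = i then 1 else 0 :: real)" if "j \<in> {1..n}" for j
    proof -
      have "j = i" if "w \<in> cell j"
      proof -
        have "real j - 1 < real n * fst w" "real n * fst w \<le> real j"
          "real i - 1 < real n * fst w" "real n * fst w \<le> real i"
          using that i(2) n by (auto simp: cell_def field_simps)
        then show ?thesis by linarith
      qed
      then have "w \<in> cell j \<longleftrightarrow> j = i" using i(2) by blast
      then show ?thesis by (simp only: indicator_def of_bool_def)
    qed
    then have "(\<Sum>j\<in>{1..n}. real n * indicator (cell j) w) = (\<Sum>j\<in>{1..n}. if j = i then real n else 0)"
      by (intro sum.cong refl) simp
    then show ?thesis using True i(1) by (simp add: G_def)
  qed (simp add: G_def)
  have G_meas: "G \<in> borel_measurable Q"
    unfolding G_sum[abs_def] using cell_sets by (intro borel_measurable_sum borel_measurable_times borel_measurable_indicator) auto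
  have density: "permuton_of_perm n p = density Q (\<lambda>w. ennreal (G w))"
    unfolding permuton_of_perm_def Q_def G_def cell_def by (intro arg_cong[where f = "density _"] ext) simp
  have "(\<integral>w. f w \<partial>permuton_of_perm n p) = (\<integral>w. G w *\<^sub>R f w \<partial>Q)"
    unfolding density by (rule integral_density[OF f_meas G_meas]) (simp add: G_def)
  also have "\<dots> = (\<integral>w. (\<Sum>i\<in>{1..n}. real n * (indicator (cell i) w * f w)) \<partial>Q)"
    by (simp only: G_sum real_scaleR_def sum_distrib_right mult.assoc)
  also have "\<dots> = (\<Sum>i\<in>{1..n}. \<integral>w. real n * (indicator (cell i) w * f w) \<partial>Q)"
    using cell_f_int by (intro Bochner_Integration.integral_sum integrable_mult_right)
  finally have integral_eq: "(\<integral>w. f w \<partial>permuton_of_perm n p) = (\<Sum>i\<in>{1..n}. real n * (\<integral>w. indicator (cell i) w * f w \<partial>Q))"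
    by simp
  have "\<bar>real n * (\<integral>w. indicator (cell i) w * f w \<partial>Q) - f (real i / real n, real (p i) / real n) / real n\<bar> \<le> e / real n"
    if i: "i \<in> {1..n}" for i
  proof -
    define c where "c = f (real i / real n, real (p i) / real n)"
    have cint: "(\<integral>w. indicator (cell i) w * c \<partial>Q) = c / (real n)\<^sup>2"
      using cell_int[OF i] cell_measure[OF i] sets.sets_into_space[OF cell_sets[OF i]]
      by (simp add: Int_absorb2)
    have eint: "(\<integral>w. indicator (cell i) w * e \<partial>Q) = e / (real n)\<^sup>2"
      using cell_int[OF i] cell_measure[OF i] sets.sets_into_space[OF cell_sets[OF i]]
      by (simp add: Int_absorb2)
    have "\<bar>(\<integral>w. indicator (cell i) w * f w \<partial>Q) - c / (real n)\<^sup>2\<bar> =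
        \<bar>\<integral>w. indicator (cell i) w * f w - indicator (cell i) w * c \<partial>Q\<bar>"
      unfolding cint[symmetric]
      by (subst Bochner_Integration.integral_diff[OF cell_f_int[OF i] integrable_mult_left[OF cell_int[OF i]]]) simp
    also have "\<dots> \<le> (\<integral>w. indicator (cell i) w * e \<partial>Q)"
    proof (rule order_trans[OF integral_abs_bound], rule integral_mono)
      fix w assume "w \<in> space Q"
      show "\<bar>indicator (cell i) w * f w - indicator (cell i) w * c\<bar> \<le> indicator (cell i) w * e"
      proof (cases "w \<in> cell i")
        case True
        then have "\<bar>fst w - real i / real n\<bar> \<le> 1 / real n" "\<bar>snd w - real (p i) / real n\<bar> \<le> 1 / real n"
          using n by (auto simp: cell_def abs_le_iff diff_divide_distrib)
        then have "dist w (real i / real n, real (p i) / real n) \<le> 1 / real n + 1 / real n"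
          unfolding dist_prod_def dist_real_def
          by (intro order_trans[OF sqrt_sum_squares_le_sum_abs] add_mono) auto
        then have "\<bar>f w - c\<bar> \<le> e"
          unfolding c_def using cell_sub[OF i] True graph_point_in_square[OF p i] by (intro osc) auto
        then show ?thesis using True by simp
      qed simp
    qed (use cell_f_int[OF i] cell_int[OF i] in auto)
    finally have "\<bar>(\<integral>w. indicator (cell i) w * f w \<partial>Q) - c / (real n)\<^sup>2\<bar> \<le> e / (real n)\<^sup>2"
      by (simp only: eint)
    then have "real n * \<bar>(\<integral>w. indicator (cell i) w * f w \<partial>Q) - c / (real n)\<^sup>2\<bar> \<le> real n * (e / (real n)\<^sup>2)"
      by (rule mult_left_mono) simp
    then have "\<bar>real n * ((\<integral>w. indicator (cell i) w * f w \<partial>Q) - c / (real n)\<^sup>2)\<bar> \<le> real n * (e / (real n)\<^sup>2)"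
      by (simp add: abs_mult)
    then show ?thesis using n
      by (simp add: c_def[symmetric] right_diff_distrib power2_eq_square)
  qed
  then have "\<bar>\<Sum>i\<in>{1..n}. real n * (\<integral>w. indicator (cell i) w * f w \<partial>Q) - f (real i / real n, real (p i) / real n) / real n\<bar>
      \<le> (\<Sum>i\<in>{1..n}. e / real n)"
    by (intro order_trans[OF sum_abs] sum_mono) auto
  then show ?thesis
    using n unfolding integral_eq graph_average_def by (simp add: sum_subtractf sum_divide_distrib)
qed

lemma permuton_of_perm_close:
  fixes f :: "real \<times> real \<Rightarrow> real"
  assumes f: "continuous_on unit_square f" and e: "e > 0"
  shows "\<forall>\<^sub>F n in sequentially. \<forall>p. p permutes {1..n} \<longrightarrow>
           \<bar>(\<integral>w. f w \<partial>permuton_of_perm n p) - graph_average n p f\<bar> \<le> e"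
proof -
  have "uniformly_continuous_on unit_square f"
    by (intro compact_uniformly_continuous f compact_Times) auto
  then obtain d where d: "d > 0" "\<And>w w'. w \<in> unit_square \<Longrightarrow> w' \<in> unit_square \<Longrightarrow> dist w' w < d \<Longrightarrow> dist (f w') (f w) < e"
    using e unfolding uniformly_continuous_on_def by metis
  have "(\<lambda>n. 2 * (1 / real n)) \<longlonglongrightarrow> 2 * 0" by (intro tendsto_mult_left lim_1_over_n)
  then have "\<forall>\<^sub>F n in sequentially. 2 * (1 / real n) < d" using d(1) by (intro order_tendstoD(2)) auto
  with eventually_ge_at_top[of 1] show ?thesis
  proof eventually_elim
    case (elim n)
    show ?case
    proof (intro allI impI permuton_of_perm_integral[OF _ elim(1) f])
      fix w w' :: "real \<times> real"
      assume w: "w \<in> unit_square" "w' \<in> unit_square" "dist w w' \<le> 2 / real n"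
      then have "dist w w' < d" using elim(2) by simp
      from d(2)[OF w(2,1) this] show "\<bar>f w - f w'\<bar> \<le> e" by (simp add: dist_real_def)
    qed
  qed
qed


section \<open>Convergence of degrees and permutons\<close>

text \<open>Its average over the graph, at \<open>v = Y t\<close>, approximates the degree process, and its integral against the
limit permuton, at \<open>v = Z t\<close>, approximates the limit of the degree process.\<close>

definition degree_test :: "real \<Rightarrow> real \<Rightarrow> (real \<times> real) \<times> real \<Rightarrow> real" where
  "degree_test e t x = t + snd x - 2 * ramp_quadrant e t x"

lemma continuous_on_degree_test: "continuous_on A (degree_test e t)"
  unfolding degree_test_def by (intro continuous_intros continuous_on_ramp_quadrant)

lemma degree_test_bound:
  assumes "t \<in> {0..1}" "snd x \<in> {0..1}"
  shows "\<bar>degree_test e t x\<bar> \<le> 4"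
  using assms ramp_quadrant_bounds[of e t x] by (auto simp: degree_test_def abs_le_iff)

lemma degree_test_error:
  assumes Z: "unit_process N Z" and \<mu>: "random_permuton N \<mu>" and t: "t \<in> {0<..1}" and \<omega>: "\<omega> \<in> space N"
    and e: "e > 0"
  shows "\<bar>(\<integral>w. degree_test e t (w, Z t \<omega>) \<partial>\<mu> \<omega>) - (t + Z t \<omega> - 2 * bivariate_cdf (\<mu> \<omega>) t (Z t \<omega>))\<bar> \<le> 4 * e"
proof -
  have "\<mu> \<omega> \<in> permutons" using \<mu> \<omega> by (simp add: random_permuton_def)
  moreover have "Z t \<omega> \<in> {0..1}" using Z t \<omega> by (simp add: unit_process_def)
  ultimately show ?thesis
    using bivariate_cdf_ramp_error[of "\<mu> \<omega>" t "Z t \<omega>" e] t e by (simp add: degree_test_def)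
qed

lemma degree_test_measurable:
  assumes Z: "unit_process N Z" and \<mu>: "random_permuton N \<mu>" and t: "t \<in> {0<..1}"
  shows "(\<lambda>\<omega>. \<integral>w. degree_test e t (w, Z t \<omega>) \<partial>\<mu> \<omega>) \<in> borel_measurable N"
  using Z \<mu> t
  by (intro kernel_integral_measurable[OF measurable_test_function] continuous_on_degree_test)
     (auto simp: unit_process_def random_permuton_def)

lemma lim_4_over_Suc: "(\<lambda>k. 4 * (1 / real (Suc k))) \<longlonglongrightarrow> 0"
  using tendsto_mult_left[OF LIMSEQ_Suc[OF lim_1_over_n], of 4] by simp

text \<open>The distribution function at a random point is a limit of integrals of the ramps.\<close>

lemma degree_limit_measurable:
  assumes Z: "unit_process N Z" and \<mu>: "random_permuton N \<mu>" and t: "t \<in> {0<..1}"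
  shows "(\<lambda>\<omega>. t + Z t \<omega> - 2 * bivariate_cdf (\<mu> \<omega>) t (Z t \<omega>)) \<in> borel_measurable N"
proof (rule borel_measurable_LIMSEQ_real)
  show "(\<lambda>\<omega>. \<integral>w. degree_test (1 / real (Suc k)) t (w, Z t \<omega>) \<partial>\<mu> \<omega>) \<in> borel_measurable N" for k
    by (rule degree_test_measurable[OF assms])
  fix \<omega> assume \<omega>: "\<omega> \<in> space N"
  show "(\<lambda>k. \<integral>w. degree_test (1 / real (Suc k)) t (w, Z t \<omega>) \<partial>\<mu> \<omega>) \<longlonglongrightarrow> t + Z t \<omega> - 2 * bivariate_cdf (\<mu> \<omega>) t (Z t \<omega>)"
  proof (rule LIM_zero_cancel, rule Lim_null_comparison[OF _ lim_4_over_Suc])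
    show "\<forall>\<^sub>F k in sequentially. norm ((\<integral>w. degree_test (1 / real (Suc k)) t (w, Z t \<omega>) \<partial>\<mu> \<omega>) -
        (t + Z t \<omega> - 2 * bivariate_cdf (\<mu> \<omega>) t (Z t \<omega>))) \<le> 4 * (1 / real (Suc k))"
      unfolding real_norm_def by (intro always_eventually allI degree_test_error[OF Z \<mu> t \<omega>]) simp
  qed
qed

lemma bivariate_cdf_bounds:
  assumes "\<mu> \<in> permutons"
  shows "0 \<le> bivariate_cdf \<mu> x y" "bivariate_cdf \<mu> x y \<le> 1"
proof -
  interpret prob_space \<mu> using assms by (simp add: permutons_def space_prob_algebra)
  show "0 \<le> bivariate_cdf \<mu> x y" "bivariate_cdf \<mu> x y \<le> 1"
    by (simp_all add: bivariate_cdf_def)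
qed

lemma degree_limit_bound:
  assumes Z: "unit_process N Z" and \<mu>: "random_permuton N \<mu>" and t: "t \<in> {0<..1}" and \<omega>: "\<omega> \<in> space N"
  shows "\<bar>t + Z t \<omega> - 2 * bivariate_cdf (\<mu> \<omega>) t (Z t \<omega>)\<bar> \<le> 4"
proof -
  have "\<mu> \<omega> \<in> permutons" using \<mu> \<omega> by (simp add: random_permuton_def)
  moreover have "Z t \<omega> \<in> {0..1}" using Z t \<omega> by (simp add: unit_process_def)
  ultimately show ?thesis
    using bivariate_cdf_bounds[of "\<mu> \<omega>" t "Z t \<omega>"] t by (auto simp: abs_le_iff)
qed

context sampled_permutation_limit begin

text \<open>Joint convergence for the ramps of width \<open>e k\<close>, and then \<open>k\<close> tends to infinity: by the ramp errors this is
again an instance of the approximation principle.\<close>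

theorem degree_convergence:
  assumes \<mu>: "random_permuton N \<mu>" and conv_\<mu>: "AE \<omega> in N. samples_converge_to \<omega> (\<mu> \<omega>)"
    and J: "finite J" "J \<subseteq> {0<..1}"
    and \<phi>: "continuous_map (powertop_real J) euclideanreal \<phi>"
  shows "(\<lambda>n. \<integral>\<omega>. \<phi> (\<lambda>t\<in>J. degree_process n (\<pi> n \<omega>) t) \<partial>M n)
    \<longlonglongrightarrow> (\<integral>\<omega>. \<phi> (\<lambda>t\<in>J. t + Z t \<omega> - 2 * bivariate_cdf (\<mu> \<omega>) t (Z t \<omega>)) \<partial>N)"
proof -
  define e where "e k = 1 / real (Suc k)" for k
  have e: "e k > 0" "e k \<le> 1" for k by (simp_all add: e_def)
  have e_lim: "(\<lambda>k. 4 * e k) \<longlonglongrightarrow> 0" unfolding e_def by (rule lim_4_over_Suc)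
  let ?X' = "\<lambda>k n t \<omega>. graph_average n (\<pi> n \<omega>) (\<lambda>w. degree_test (e k) t (w, Ypath n \<omega> t))"
  let ?D' = "\<lambda>k t \<omega>. \<integral>w. degree_test (e k) t (w, Z t \<omega>) \<partial>\<mu> \<omega>"
  let ?D = "\<lambda>t \<omega>. t + Z t \<omega> - 2 * bivariate_cdf (\<mu> \<omega>) t (Z t \<omega>)"
  have X'_bound: "\<bar>?X' k n t \<omega>\<bar> \<le> 4" if "n \<ge> 1" "t \<in> J" "\<omega> \<in> space (M n)" for k n t \<omega>
  proof -
    have "Ypath n \<omega> t \<in> {0..1}"
      using perm_process_unit[OF permutes[OF that(1,3)] that(1)] J(2) that(2) by blast
    then have "\<bar>?X' k n t \<omega> - graph_average n (\<pi> n \<omega>) (\<lambda>_. 0)\<bar> \<le> 4"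
      using that J(2) by (intro graph_average_le) (auto intro!: degree_test_bound)
    then show ?thesis by (simp add: graph_average_def)
  qed
  have X_close: "\<bar>?X' k n t \<omega> - degree_process n (\<pi> n \<omega>) t\<bar> \<le> 4 * e k + 9 * (1 / real n)"
    if "n \<ge> 1" "t \<in> J" "\<omega> \<in> space (M n)" for k n t \<omega>
    using degree_process_ramp_error[OF permutes[OF that(1,3)] that(1) _ e(1)] J(2) that(2)
    by (auto simp: degree_test_def)
  have D_close: "\<bar>?D' k t \<omega> - ?D t \<omega>\<bar> \<le> 4 * e k" if "t \<in> J" "\<omega> \<in> space N" for k t \<omega>
    using that J(2) by (intro degree_test_error[OF unit \<mu>] e(1)) auto
  show ?thesis
  \<comment> \<open>The averages are bounded by 4 and the degrees by \<open>4 + (4 e + 9/n)\<close> with \<open>e, 1/n \<le> 1\<close>, hence 17.\<close>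
  proof (rule expectation_tendsto_by_approximation[where c = 17 and X' = ?X' and D' = ?D', OF prob_M prob_N J(1) \<phi>])
    fix n :: nat and t assume n: "n \<ge> 1" and t: "t \<in> J"
    show "(\<lambda>\<omega>. degree_process n (\<pi> n \<omega>) t) \<in> borel_measurable (M n)"
      by (rule borel_measurable_integrable) (rule integrable_perm[OF n, of "\<lambda>p. degree_process n p t"])
    show "?X' k n t \<in> borel_measurable (M n)" for k
      by (rule borel_measurable_integrable)
         (rule integrable_perm[OF n, of "\<lambda>p. graph_average n p (\<lambda>w. degree_test (e k) t (w, perm_process n p t))"])
    fix \<omega> assume \<omega>: "\<omega> \<in> space (M n)"
    show "\<bar>?X' k n t \<omega>\<bar> \<le> 17" for k
      using X'_bound[OF n t \<omega>, of k] by linarith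
    have "1 / real n \<le> 1" using n by simp
    then show "\<bar>degree_process n (\<pi> n \<omega>) t\<bar> \<le> 17"
      using X'_bound[OF n t \<omega>, of 0] X_close[OF n t \<omega>, of 0] e(2)[of 0] by linarith
  next
    fix t assume t: "t \<in> J"
    have t': "t \<in> {0<..1}" using t J(2) by blast
    show "?D t \<in> borel_measurable N" by (rule degree_limit_measurable[OF unit \<mu> t'])
    show D'_meas: "?D' k t \<in> borel_measurable N" for k by (rule degree_test_measurable[OF unit \<mu> t'])
    show D_bound: "\<bar>?D t \<omega>\<bar> \<le> 17" if "\<omega> \<in> space N" for \<omega>
      using degree_limit_bound[OF unit \<mu> t' that] by linarith
    show D'_bound: "\<bar>?D' k t \<omega>\<bar> \<le> 17" if "\<omega> \<in> space N" for k \<omega>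
      using degree_limit_bound[OF unit \<mu> t' that] D_close[OF t that, of k] e(2)[of k] by linarith
    show "(\<lambda>k. \<integral>\<omega>. \<bar>?D' k t \<omega> - ?D t \<omega>\<bar> \<partial>N) \<longlonglongrightarrow> 0"
    proof (rule Lim_null_comparison[OF _ e_lim], intro always_eventually allI)
      fix k
      interpret prob_space N by (rule prob_N)
      have "integrable N (\<lambda>\<omega>. \<bar>?D' k t \<omega> - ?D t \<omega>\<bar>)"
        using D_close[OF t] D'_meas[of k] degree_limit_measurable[OF unit \<mu> t']
        by (intro integrable_const_bound[where B = "4 * e k"] AE_I2) auto
      then have "(\<integral>\<omega>. \<bar>?D' k t \<omega> - ?D t \<omega>\<bar> \<partial>N) \<le> 4 * e k"
        using D_close[OF t] by (intro integral_le_const AE_I2) auto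
      then show "norm (\<integral>\<omega>. \<bar>?D' k t \<omega> - ?D t \<omega>\<bar> \<partial>N) \<le> 4 * e k" by simp
    qed
    fix \<epsilon> :: real assume \<epsilon>: "\<epsilon> > 0"
    have "\<forall>\<^sub>F k in sequentially. 4 * e k < \<epsilon> / 2" by (rule order_tendstoD(2)[OF e_lim]) (use \<epsilon> in simp)
    then show "\<forall>\<^sub>F k in sequentially. \<forall>\<^sub>F n in sequentially. (\<integral>\<omega>. \<bar>?X' k n t \<omega> - degree_process n (\<pi> n \<omega>) t\<bar> \<partial>M n) \<le> \<epsilon>"
    proof eventually_elim
      case (elim k)
      have "(\<lambda>n. 9 * (1 / real n)) \<longlonglongrightarrow> 9 * 0" by (intro tendsto_mult_left lim_1_over_n)
      then have "\<forall>\<^sub>F n in sequentially. 9 * (1 / real n) < \<epsilon> / 2" using \<epsilon> by (intro order_tendstoD(2)) auto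
      with eventually_ge_at_top[of 1] show ?case
      proof eventually_elim
        case (elim n)
        interpret Mn: prob_space "M n" by (rule prob_M[OF elim(1)])
        have "\<bar>?X' k n t \<omega> - degree_process n (\<pi> n \<omega>) t\<bar> \<le> \<epsilon>" if "\<omega> \<in> space (M n)" for \<omega>
          using X_close[OF elim(1) t that, of k] elim(2) \<open>4 * e k < \<epsilon> / 2\<close> by linarith
        then show ?case
          by (intro Mn.integral_le_const AE_I2 integrable_perm[OF elim(1), of "\<lambda>p. \<bar>graph_average n p
            (\<lambda>w. degree_test (e k) t (w, perm_process n p t)) - degree_process n p t\<bar>"])
      qed
    qed
  next
    fix k
    show "(\<lambda>n. \<integral>\<omega>. \<phi> (\<lambda>t\<in>J. ?X' k n t \<omega>) \<partial>M n) \<longlonglongrightarrow> (\<integral>\<omega>. \<phi> (\<lambda>t\<in>J. ?D' k t \<omega>) \<partial>N)"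
      by (rule joint_convergence[OF \<mu> conv_\<mu> J continuous_on_degree_test \<phi>])
  qed
qed

text \<open>Joint convergence for the single time 1 and a test function that ignores the value of the process gives the
convergence of the graph averages; the integrals against the permutons differ from these by a uniformly
small amount.\<close>

theorem permuton_convergence:
  fixes f :: "real \<times> real \<Rightarrow> real"
  assumes \<mu>: "random_permuton N \<mu>" and conv_\<mu>: "AE \<omega> in N. samples_converge_to \<omega> (\<mu> \<omega>)"
    and f: "continuous_on unit_square f"
  shows "weak_conv_m (\<lambda>n. distr (M n) borel (\<lambda>\<omega>. \<integral>w. f w \<partial>permuton_of_perm n (\<pi> n \<omega>)))
           (distr N borel (\<lambda>\<omega>. \<integral>w. f w \<partial>\<mu> \<omega>))"
proof -
  define X where "X n \<omega> = (\<integral>w. f w \<partial>permuton_of_perm n (\<pi> n \<omega>))" for n \<omega>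
  define D where "D \<omega> = (\<integral>w. f w \<partial>\<mu> \<omega>)" for \<omega>
  \<comment> \<open>Joint convergence wants test functions on the whole plane, so \<open>f\<close> is extended by the retraction onto the square.\<close>
  define f' where "f' w = f (max 0 (min 1 (fst w)), max 0 (min 1 (snd w)))" for w
  have f'_cont: "continuous_on UNIV f'"
    unfolding f'_def by (intro continuous_on_compose2[OF f] continuous_intros) auto
  have f'_eq: "f' w = f w" if "w \<in> unit_square" for w
    using that by (cases w) (simp add: f'_def)
  obtain B where B: "\<And>w. w \<in> unit_square \<Longrightarrow> \<bar>f w\<bar> \<le> B" using continuous_square_bounded[OF f] by blast
  have X_meas: "X n \<in> borel_measurable (M n)" if "n \<ge> 1" for n
    unfolding X_def by (rule borel_measurable_integrable)
      (rule integrable_perm[OF that, of "\<lambda>p. \<integral>w. f w \<partial>permuton_of_perm n p"])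
  have \<mu>_meas: "\<mu> \<in> N \<rightarrow>\<^sub>M prob_algebra borel_square" using \<mu> by (simp add: random_permuton_def)
  have D_meas: "D \<in> borel_measurable N"
    unfolding D_def
    by (rule measurable_compose[OF measurable_prob_algebraD[OF \<mu>_meas]])
       (intro integral_measurable_subprob_algebra continuous_square_measurable f)
  have \<mu>_space: "\<mu> \<omega> \<in> space (prob_algebra borel_square)" if "\<omega> \<in> space N" for \<omega>
    using \<mu> that by (simp add: random_permuton_def permutons_def)
  have D_f': "(\<integral>w. f' w \<partial>\<mu> \<omega>) = D \<omega>" if "\<omega> \<in> space N" for \<omega>
  proof -
    have "space (\<mu> \<omega>) = unit_square"
      using \<mu>_space[OF that] sets_eq_imp_space_eq[of "\<mu> \<omega>" borel_square]
      by (simp add: space_prob_algebra space_restrict_space)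
    then show ?thesis unfolding D_def by (intro Bochner_Integration.integral_cong refl f'_eq) simp
  qed
  have avg_f': "graph_average n (\<pi> n \<omega>) f' = graph_average n (\<pi> n \<omega>) f" if "n \<ge> 1" "\<omega> \<in> space (M n)" for n \<omega>
    unfolding graph_average_def
    using graph_point_in_square[OF permutes[OF that]] f'_eq by (intro arg_cong2[where f = "(/)"] sum.cong refl) blast
  have avg_bound: "\<bar>graph_average n (\<pi> n \<omega>) f\<bar> \<le> B" if "n \<ge> 1" "\<omega> \<in> space (M n)" for n \<omega>
  proof -
    have "\<bar>graph_average n (\<pi> n \<omega>) f - graph_average n (\<pi> n \<omega>) (\<lambda>_. 0)\<bar> \<le> B"
      using that(1) B graph_point_in_square[OF permutes[OF that]] by (intro graph_average_le) auto
    then show ?thesis by (simp add: graph_average_def)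
  qed
  have main: "(\<lambda>n. \<integral>\<omega>. h (X n \<omega>) \<partial>M n) \<longlonglongrightarrow> (\<integral>\<omega>. h (D \<omega>) \<partial>N)"
    if h: "\<And>x. isCont h x" "\<And>x. \<bar>h x\<bar> \<le> 1" for h :: "real \<Rightarrow> real"
  proof -
    have h_cont: "continuous_on UNIV h" using h(1) by (simp add: continuous_on_eq_continuous_at)
    have "(\<lambda>n. \<integral>\<omega>. h (graph_average n (\<pi> n \<omega>) f') \<partial>M n) \<longlonglongrightarrow> (\<integral>\<omega>. h (\<integral>w. f' w \<partial>\<mu> \<omega>) \<partial>N)"
    proof -
      have "continuous_on UNIV (\<lambda>x :: (real \<times> real) \<times> real. f' (fst x))"
        by (intro continuous_on_compose2[OF f'_cont] continuous_intros) auto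
      from joint_convergence[OF \<mu> conv_\<mu>, of "{1}" "\<lambda>_ x. f' (fst x)", OF _ _ this
          continuous_map_coordinate[OF h_cont]]
      show ?thesis by simp
    qed
    moreover have "(\<integral>\<omega>. h (\<integral>w. f' w \<partial>\<mu> \<omega>) \<partial>N) = (\<integral>\<omega>. h (D \<omega>) \<partial>N)"
      by (intro Bochner_Integration.integral_cong refl) (simp add: D_f')
    moreover have "(\<lambda>n. (\<integral>\<omega>. h (X n \<omega>) \<partial>M n) - (\<integral>\<omega>. h (graph_average n (\<pi> n \<omega>) f') \<partial>M n)) \<longlonglongrightarrow> 0"
    proof (rule tendstoI)
      fix \<epsilon> :: real assume \<epsilon>: "\<epsilon> > 0"
      have "uniformly_continuous_on {- (B + 1)..B + 1} h"
        by (intro compact_uniformly_continuous continuous_on_subset[OF h_cont]) auto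
      then obtain d where d: "d > 0" "\<And>x y. x \<in> {- (B + 1)..B + 1} \<Longrightarrow> y \<in> {- (B + 1)..B + 1} \<Longrightarrow> dist y x < d \<Longrightarrow> dist (h y) (h x) < \<epsilon> / 2"
        using half_gt_zero[OF \<epsilon>] unfolding uniformly_continuous_on_def by blast
      have "min 1 (d / 2) > 0" using d(1) by simp
      from permuton_of_perm_close[OF f this] eventually_ge_at_top[of 1]
      show "\<forall>\<^sub>F n in sequentially. dist ((\<integral>\<omega>. h (X n \<omega>) \<partial>M n) - (\<integral>\<omega>. h (graph_average n (\<pi> n \<omega>) f') \<partial>M n)) 0 < \<epsilon>"
      proof eventually_elim
        case (elim n)
        interpret Mn: prob_space "M n" by (rule prob_M[OF elim(2)])
        have int1: "integrable (M n) (\<lambda>\<omega>. h (X n \<omega>))"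
          unfolding X_def by (rule integrable_perm[OF elim(2), of "\<lambda>p. h (\<integral>w. f w \<partial>permuton_of_perm n p)"])
        have int2: "integrable (M n) (\<lambda>\<omega>. h (graph_average n (\<pi> n \<omega>) f'))"
          by (rule integrable_perm[OF elim(2), of "\<lambda>p. h (graph_average n p f')"])
        have "\<bar>h (X n \<omega>) - h (graph_average n (\<pi> n \<omega>) f')\<bar> \<le> \<epsilon> / 2" if \<omega>: "\<omega> \<in> space (M n)" for \<omega>
        proof -
          have close: "\<bar>X n \<omega> - graph_average n (\<pi> n \<omega>) f\<bar> \<le> min 1 (d / 2)"
            unfolding X_def using elim(1) permutes[OF elim(2) \<omega>] by blast
          have "X n \<omega> \<in> {- (B + 1)..B + 1}" "graph_average n (\<pi> n \<omega>) f \<in> {- (B + 1)..B + 1}"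
            unfolding atLeastAtMost_iff using close avg_bound[OF elim(2) \<omega>] by linarith+
          moreover have "dist (X n \<omega>) (graph_average n (\<pi> n \<omega>) f) < d"
            unfolding dist_real_def using close d(1) by linarith
          ultimately show ?thesis
            using d(2)[of "graph_average n (\<pi> n \<omega>) f" "X n \<omega>"] unfolding avg_f'[OF elim(2) \<omega>] by (simp add: dist_real_def)
        qed
        then have "(\<integral>\<omega>. \<bar>h (X n \<omega>) - h (graph_average n (\<pi> n \<omega>) f')\<bar> \<partial>M n) \<le> \<epsilon> / 2"
          using int1 int2 by (intro Mn.integral_le_const AE_I2 integrable_abs Bochner_Integration.integrable_diff)
        then have "\<bar>\<integral>\<omega>. h (X n \<omega>) - h (graph_average n (\<pi> n \<omega>) f') \<partial>M n\<bar> \<le> \<epsilon> / 2"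
          by (rule order_trans[OF integral_abs_bound])
        then show ?case using int1 int2 \<epsilon> by (simp add: dist_real_def)
      qed
    qed
    ultimately show ?thesis using tendsto_add by fastforce
  qed
  \<comment> \<open>The space \<open>M 0\<close> is arbitrary and need not carry a probability, hence the shift by one.\<close>
  have rd: "real_distribution (distr (M (Suc n)) borel (X (Suc n)))" for n
    using prob_M[of "Suc n"] X_meas[of "Suc n"]
    by (auto simp: real_distribution_def real_distribution_axioms_def intro!: prob_space.prob_space_distr)
  have rd': "real_distribution (distr N borel D)"
    using prob_N D_meas
    by (auto simp: real_distribution_def real_distribution_axioms_def intro!: prob_space.prob_space_distr)
  have "weak_conv_m (\<lambda>n. distr (M (Suc n)) borel (X (Suc n))) (distr N borel D)"
  proof (rule integral_bdd_continuous_conv_imp_weak_conv[OF rd rd'])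
    fix h :: "real \<Rightarrow> real" assume h: "\<And>x. isCont h x" "\<And>x. \<bar>h x\<bar> \<le> 1"
    have [measurable]: "h \<in> borel_measurable borel"
      using h(1) by (intro borel_measurable_continuous_onI) (simp add: continuous_on_eq_continuous_at)
    have "integral\<^sup>L (distr (M (Suc n)) borel (X (Suc n))) h = (\<integral>\<omega>. h (X (Suc n) \<omega>) \<partial>M (Suc n))" for n
      using X_meas[of "Suc n"] by (intro integral_distr) auto
    moreover have "integral\<^sup>L (distr N borel D) h = (\<integral>\<omega>. h (D \<omega>) \<partial>N)"
      using D_meas by (intro integral_distr) auto
    ultimately show "(\<lambda>n. integral\<^sup>L (distr (M (Suc n)) borel (X (Suc n))) h) \<longlonglongrightarrow> integral\<^sup>L (distr N borel D) h"
      using LIMSEQ_Suc[OF main[OF h]] by simp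
  qed
  then have "weak_conv_m (\<lambda>n. distr (M n) borel (X n)) (distr N borel D)"
    unfolding weak_conv_m_def weak_conv_def by (auto intro: LIMSEQ_imp_Suc)
  then show ?thesis unfolding X_def[abs_def] D_def[abs_def] .
qed

end


section \<open>The canonical probability space\<close>

text \<open>Restricting the paths to values in the unit interval and the measures to permutons makes the requirements on
processes and random permutons hold at every point of the space.\<close>

definition canonical_space :: "((real \<Rightarrow> real) \<times> (real \<times> real) measure) measure" where
  "canonical_space = PiM {0<..1} (\<lambda>_. restrict_space borel {0..1}) \<Otimes>\<^sub>M
     restrict_space (prob_algebra borel_square) permutons"

lemma canonical_space_member:
  assumes "x \<in> space canonical_space"
  shows "t \<in> {0<..1} \<Longrightarrow> fst x t \<in> {0..1}" "snd x \<in> permutons"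
  using assms by (auto simp: canonical_space_def space_pair_measure space_PiM space_restrict_space PiE_iff)

lemma canonical_coordinate_measurable:
  "t \<in> {0<..1} \<Longrightarrow> (\<lambda>x. fst x t) \<in> borel_measurable canonical_space"
proof -
  assume t: "t \<in> {0<..1}"
  have "(\<lambda>z. z t) \<in> PiM {0<..1} (\<lambda>_. restrict_space borel {0..1}) \<rightarrow>\<^sub>M restrict_space borel {0..1 :: real}"
    using t by (rule measurable_component_singleton)
  then have "(\<lambda>z. z t) \<in> PiM {0<..1} (\<lambda>_. restrict_space borel {0..1}) \<rightarrow>\<^sub>M (borel :: real measure)"
    by (simp add: measurable_restrict_space2_iff)
  then show ?thesis unfolding canonical_space_def by (rule measurable_compose[OF measurable_fst])
qed

lemma canonical_permuton_measurable: "snd \<in> canonical_space \<rightarrow>\<^sub>M prob_algebra borel_square"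
proof -
  have "(\<lambda>\<nu>. \<nu>) \<in> restrict_space (prob_algebra borel_square) permutons \<rightarrow>\<^sub>M prob_algebra borel_square"
    by (intro measurable_restrict_space1) simp
  then show ?thesis unfolding canonical_space_def by (rule measurable_compose[OF measurable_snd])
qed

context sampled_permutation_limit begin

text \<open>Everything depends on the underlying space only through the joint law of \<open>Z\<close> and \<open>\<mu>\<close>, so it may be moved to
the image of \<open>N\<close> under \<open>\<omega> \<mapsto> (Z \<omega>, \<mu> \<omega>)\<close>.\<close>

theorem canonical_limit:
  assumes \<mu>: "random_permuton N \<mu>" and conv_\<mu>: "AE \<omega> in N. samples_converge_to \<omega> (\<mu> \<omega>)"
  shows "\<exists>(N' :: ((real \<Rightarrow> real) \<times> (real \<times> real) measure) measure) Z' \<mu>'.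
           unit_process N' Z' \<and> same_fdds N Z N' Z' \<and> random_permuton N' \<mu>' \<and>
           random_permutons_converge M (\<lambda>n \<omega>. permuton_of_perm n (\<pi> n \<omega>)) N' \<mu>' \<and>
           fdd_converges M (\<lambda>n t \<omega>. degree_process n (\<pi> n \<omega>) t) N'
             (\<lambda>t \<omega>. t + Z' t \<omega> - 2 * bivariate_cdf (\<mu>' \<omega>) t (Z' t \<omega>))"
proof -
  interpret prob_space N by (rule prob_N)
  define \<Phi> where "\<Phi> \<omega> = ((\<lambda>t\<in>{0<..1}. Z t \<omega>), \<mu> \<omega>)" for \<omega>
  define N' where "N' = distr N canonical_space \<Phi>"
  define Z' where "Z' t x = fst x t" for t :: real and x :: "(real \<Rightarrow> real) \<times> (real \<times> real) measure"
  have \<Phi>_meas: "\<Phi> \<in> N \<rightarrow>\<^sub>M canonical_space"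
    unfolding \<Phi>_def canonical_space_def
  proof (intro measurable_Pair measurable_restrict)
    show "Z t \<in> N \<rightarrow>\<^sub>M restrict_space borel {0..1}" if "t \<in> {0<..1}" for t
      using Z_measurable[OF that] Z_unit[OF that] by (intro measurable_restrict_space2) auto
    show "\<mu> \<in> N \<rightarrow>\<^sub>M restrict_space (prob_algebra borel_square) permutons"
      using \<mu> by (intro measurable_restrict_space2) (auto simp: random_permuton_def)
  qed
  have prob_N': "prob_space N'" unfolding N'_def by (rule prob_space_distr[OF \<Phi>_meas])
  have space_N': "space N' = space canonical_space" by (simp add: N'_def)
  have meas_N': "g \<in> N' \<rightarrow>\<^sub>M S \<longleftrightarrow> g \<in> canonical_space \<rightarrow>\<^sub>M S" for g and S :: "'c measure"
    by (simp add: N'_def)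
  have Z'\<Phi>: "Z' t (\<Phi> \<omega>) = Z t \<omega>" if "t \<in> {0<..1}" for t \<omega>
    using that by (simp add: Z'_def \<Phi>_def)
  have unit': "unit_process N' Z'"
    unfolding unit_process_def Z'_def
    using prob_N' canonical_coordinate_measurable canonical_space_member(1) by (auto simp: meas_N' space_N')
  have random': "random_permuton N' snd"
    unfolding random_permuton_def
    using prob_N' canonical_permuton_measurable canonical_space_member(2) by (auto simp: meas_N' space_N')
  have same: "same_fdds N Z N' Z'"
    unfolding same_fdds_def
  proof (intro allI impI)
    fix J assume J: "finite J \<and> J \<subseteq> {0<..1 :: real}"
    have "fdd_vector Z' J \<in> canonical_space \<rightarrow>\<^sub>M PiM J (\<lambda>_. borel)"
      unfolding fdd_vector_def Z'_def using J
      by (intro measurable_restrict canonical_coordinate_measurable) auto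
    then have "distr N' (PiM J (\<lambda>_. borel)) (fdd_vector Z' J) = distr N (PiM J (\<lambda>_. borel)) (fdd_vector Z' J \<circ> \<Phi>)"
      unfolding N'_def by (rule distr_distr[OF _ \<Phi>_meas])
    also have "fdd_vector Z' J \<circ> \<Phi> = fdd_vector Z J"
      using J Z'\<Phi> by (auto simp: fdd_vector_def fun_eq_iff subset_iff)
    finally show "distr N (PiM J (\<lambda>_. borel)) (fdd_vector Z J) = distr N' (PiM J (\<lambda>_. borel)) (fdd_vector Z' J)" ..
  qed
  have permuton': "random_permutons_converge M (\<lambda>n \<omega>. permuton_of_perm n (\<pi> n \<omega>)) N' snd"
    unfolding random_permutons_converge_def
  proof (intro allI impI)
    fix f :: "real \<times> real \<Rightarrow> real" assume f: "continuous_on unit_square f"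
    have "(\<lambda>x. \<integral>w. f w \<partial>snd x) \<in> borel_measurable canonical_space"
      by (rule measurable_compose[OF measurable_prob_algebraD[OF canonical_permuton_measurable]])
         (intro integral_measurable_subprob_algebra continuous_square_measurable f)
    then have "distr N' borel (\<lambda>x. \<integral>w. f w \<partial>snd x) = distr N borel ((\<lambda>x. \<integral>w. f w \<partial>snd x) \<circ> \<Phi>)"
      unfolding N'_def by (rule distr_distr[OF _ \<Phi>_meas])
    then show "weak_conv_m (\<lambda>n. distr (M n) borel (\<lambda>\<omega>. \<integral>w. f w \<partial>permuton_of_perm n (\<pi> n \<omega>)))
        (distr N' borel (\<lambda>x. \<integral>w. f w \<partial>snd x))"
      using permuton_convergence[OF \<mu> conv_\<mu> f] by (simp add: comp_def \<Phi>_def)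
  qed
  have degree': "fdd_converges M (\<lambda>n t \<omega>. degree_process n (\<pi> n \<omega>) t) N'
      (\<lambda>t x. t + Z' t x - 2 * bivariate_cdf (snd x) t (Z' t x))"
    unfolding fdd_converges_def
  proof (intro allI impI, elim conjE)
    fix J :: "real set" and \<phi> :: "(real \<Rightarrow> real) \<Rightarrow> real"
    assume J: "finite J" "J \<subseteq> {0<..1}"
      and \<phi>: "continuous_map (powertop_real J) euclideanreal \<phi>"
    have "(\<lambda>x. \<phi> (\<lambda>t\<in>J. t + Z' t x - 2 * bivariate_cdf (snd x) t (Z' t x))) \<in> borel_measurable N'"
      using J(2) by (intro continuous_function_of_vector_measurable[OF J(1) \<phi>] degree_limit_measurable[OF unit' random']) auto
    then have "(\<integral>x. \<phi> (\<lambda>t\<in>J. t + Z' t x - 2 * bivariate_cdf (snd x) t (Z' t x)) \<partial>N') =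
        (\<integral>\<omega>. \<phi> (\<lambda>t\<in>J. t + Z' t (\<Phi> \<omega>) - 2 * bivariate_cdf (snd (\<Phi> \<omega>)) t (Z' t (\<Phi> \<omega>))) \<partial>N)"
      unfolding meas_N' unfolding N'_def by (intro integral_distr[OF \<Phi>_meas])
    also have "\<dots> = (\<integral>\<omega>. \<phi> (\<lambda>t\<in>J. t + Z t \<omega> - 2 * bivariate_cdf (\<mu> \<omega>) t (Z t \<omega>)) \<partial>N)"
    proof -
      have "(\<lambda>t\<in>J. t + Z' t (\<Phi> \<omega>) - 2 * bivariate_cdf (snd (\<Phi> \<omega>)) t (Z' t (\<Phi> \<omega>))) =
          (\<lambda>t\<in>J. t + Z t \<omega> - 2 * bivariate_cdf (\<mu> \<omega>) t (Z t \<omega>))" for \<omega>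
        using J(2) Z'\<Phi> by (intro restrict_ext) (auto simp: \<Phi>_def)
      then show ?thesis by simp
    qed
    finally show "(\<lambda>n. \<integral>\<omega>. \<phi> (fdd_vector (\<lambda>t \<omega>. degree_process n (\<pi> n \<omega>) t) J \<omega>) \<partial>M n) \<longlonglongrightarrow>
        (\<integral>x. \<phi> (fdd_vector (\<lambda>t x. t + Z' t x - 2 * bivariate_cdf (snd x) t (Z' t x)) J x) \<partial>N')"
      using degree_convergence[OF \<mu> conv_\<mu> J \<phi>] by (simp add: fdd_vector_def)
  qed
  show ?thesis using unit' same random' permuton' degree' by blast
qed

end

text \<open>At stage \<open>k\<close> the times are chosen for the finitely many exponents up to \<open>k\<close>.\<close>

lemma (in permutation_limit) sampled_permutation_limit_exists:
  "\<exists>T m. sampled_permutation_limit M \<pi> N Z T m"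
proof -
  define good where "good k \<tau> q \<longleftrightarrow> q > 0 \<and> (\<forall>l. \<tau> l \<in> {0<..1}) \<and> (\<forall>x\<in>{..k} \<times> {..k}. \<forall>\<^sub>F n in sequentially.
     (\<integral>\<omega>. \<bar>sample_average \<tau> q (Ypath n \<omega>) (monomial (fst x) (snd x))
            - graph_average n (\<pi> n \<omega>) (monomial (fst x) (snd x))\<bar> \<partial>M n) \<le> (1 / 2) ^ k)"
    for k and \<tau> :: "nat \<Rightarrow> real" and q :: nat
  have "\<forall>k. \<exists>\<tau> q. good k \<tau> q"
    unfolding good_def by (intro allI good_sample_exists) auto
  then obtain T m where good: "\<And>k. good k (T k) (m k)"
    by metis
  have "sampled_permutation_limit M \<pi> N Z T m"
  proof unfold_locales
    fix a b k :: nat assume "a \<le> k" "b \<le> k"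
    then have "(a, b) \<in> {..k} \<times> {..k}" by simp
    with good[of k] show "\<forall>\<^sub>F n in sequentially.
      (\<integral>\<omega>. \<bar>sample_average (T k) (m k) (Ypath n \<omega>) (monomial a b)
            - graph_average n (\<pi> n \<omega>) (monomial a b)\<bar> \<partial>M n) \<le> (1 / 2) ^ k"
      unfolding good_def by fastforce
  qed (use good in \<open>simp_all add: good_def\<close>)
  then show ?thesis by blast
qed

theorem theorem3p1:
  fixes M :: "nat \<Rightarrow> 'a measure" and \<pi> :: "nat \<Rightarrow> 'a \<Rightarrow> nat \<Rightarrow> nat"
    and N :: "'b measure" and Z :: "real \<Rightarrow> 'b \<Rightarrow> real"
  assumes "random_permutations M \<pi>"
    and "unit_process N Z"
    and "fdd_converges M (\<lambda>n t \<omega>. perm_process n (\<pi> n \<omega>) t) N Z"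
  shows "\<exists>(N' :: ((real \<Rightarrow> real) \<times> (real \<times> real) measure) measure) Z' \<mu>.
           unit_process N' Z' \<and> same_fdds N Z N' Z' \<and> random_permuton N' \<mu> \<and>
           random_permutons_converge M (\<lambda>n \<omega>. permuton_of_perm n (\<pi> n \<omega>)) N' \<mu> \<and>
           fdd_converges M (\<lambda>n t \<omega>. degree_process n (\<pi> n \<omega>) t) N'
             (\<lambda>t \<omega>. t + Z' t \<omega> - 2 * bivariate_cdf (\<mu> \<omega>) t (Z' t \<omega>))"
proof -
  interpret permutation_limit M \<pi> N Z using assms by unfold_locales
  obtain T m where "sampled_permutation_limit M \<pi> N Z T m"
    using sampled_permutation_limit_exists by blast
  then interpret sampled_permutation_limit M \<pi> N Z T m .
  obtain \<mu> where "random_permuton N \<mu>" "AE \<omega> in N. samples_converge_to \<omega> (\<mu> \<omega>)"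
    using limit_permuton_exists by blast
  then show ?thesis by (rule canonical_limit)
qed

end
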